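(* Let $\mathfrak{g}$ be a complex simple Lie algebra of classical type and let $q>0$ be real, $q\neq 1$. Let $(V,\rho)$ be the adjoint representation of $U_q(\mathfrak{g})$ with basis $\{v_i\}$, let $(V^*,\rho^* )$ be its dual with dual basis $\{v_i^*\}$, and put $\Omega=\sum_i v_i\otimes v_i^*\in V\otimes V^*$. Let $\phi:V\to\mathfrak{L}^{\mathrm{op}}_q(\mathfrak{g})\subset U_q(\mathfrak{g})$ and $\tau:V^*\to V$ be isomorphisms of $U_q(\mathfrak{g})$-modules, and let $\gamma_q:V\to \mathrm{cl}_q(\mathfrak{g})$ be the canonical map. Let $s_q$ be an irreducible representation of $\mathrm{cl}_q(\mathfrak{g})$ on $\Sigma$ and $\sigma_q$ a representation of $U_q(\mathfrak{g})$ on $\Sigma$ such that $$s_q(\gamma_q(x\triangleright v))=\sigma_q(x')\,s_q(\gamma_q(v))\,\sigma_q(S(x''))\qquad\text{for all }x\in U_q(\mathfrak{g}),\ v\in V.$$ Define $$D=(\phi\otimes(\gamma_q\circ\tau))(\Omega)\in \mathfrak{L}^{\mathrm{op}}_q(\mathfrak{g})\otimes \mathrm{cl}_q(\mathfrak{g})\subset U_q(\mathfrak{g})\otimes \mathrm{cl}_q(\mathfrak{g}).$$ Then: (1) $D$ is invariant under the action of $U_q(\mathfrak{g})$: writing $D=\sum_{i,j}\alpha_{ij}\,Z_i\otimes\psi_j$ with $\alpha_{ij}\in\mathbb{C}$, $Z_i=\phi(v_i)$, $\psi_j=\gamma_q(v_j)$, one has for all $x\in U_q(\mathfrak{g})$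 $$\sum_{i,j}\alpha_{ij}\,\big(x''_{(1)}\big)\otimes\big(x''_{(2)}\big)=\epsilon(x)D,\qquad \text{where } x''_{(1)}\otimes x''_{(2)}:=\big(x'\blacktriangleright^{\mathrm{op}}Z_i\big)\otimes\big(x''\triangleright\psi_j\big).$$ (2) For every dominant integral weight $\lambda\in P_+$, the operator $\sum_{i,j}\alpha_{ij}\,\pi_{\lambda,q}(Z_i)\otimes s_q(\psi_j)$ by which $D$ acts on $V_\lambda\otimes\Sigma$ commutes with the action $x\mapsto \pi_{\lambda,q}(x')\otimes\sigma_q(x'')$ of $U_q(\mathfrak{g})$ on $V_\lambda\otimes\Sigma$.
   Context: **Quantum group.** $\mathfrak{g}$ has Cartan matrix $(a_{ij})$, coprime positive integers $d_i$ with $d_ia_{ij}$ symmetric, $q_i=q^{d_i}$. $U_q(\mathfrak{g})$ is the unital associative algebra generated by $k_i^{\pm1},e_i,f_i$ with $k_ik_i^{-1}=1$, $[k_i,k_j]=0$, $k_ie_jk_i^{-1}=q_i^{a_{ij}/2}e_j$, $k_if_jk_i^{-1}=q_i^{-a_{ij}/2}f_j$, $[e_i,f_j]=\delta_{ij}(k_i^2-k_i^{-2})/(q_i-q_i^{-1})$ and the usual quantum Serre relations. Hopf structure: $\triangle(k_i)=k_i\otimes k_i$, $\triangle(e_i)=e_i\otimes k_i+k_i^{-1}\otimes e_i$, $\triangle(f_i)=f_i\otimes k_i+k_i^{-1}\otimes f_i$, $S(k_i)=k_i^{-1}$, $S(e_i)=-q_ie_i$, $S(f_i)=-q_i^{-1}f_i$,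 $\epsilon(k_i)=1$, $\epsilon(e_i)=\epsilon(f_i)=0$. Sweedler notation $\triangle(x)=x'\otimes x''$ (summation suppressed) always refers to this coproduct. The opposite Hopf structure has $\triangle^{\mathrm{op}}(x)=x''\otimes x'$ and antipode $S^{\mathrm{op}}=S^{-1}$, i.e. $S^{\mathrm{op}}(k_i)=k_i^{-1}$, $S^{\mathrm{op}}(e_i)=-q_i^{-1}e_i$, $S^{\mathrm{op}}(f_i)=-q_if_i$. **Representations.** For $\lambda\in P_+$ (dominant integral weights), $(V_\lambda,\pi_{\lambda,q})$ is the irreducible finite dimensional module with highest weight vector $\xi$ satisfying $e_i\xi=0$, $k_i\xi=q_i^{\lambda(h_i)/2}\xi$, where $\alpha_j(h_i)=a_{ij}$. The defining (vector) representation is $(U,\pi)$ with basis $\{u_i\}$ and matrix elements $\pi_{ij}$; duals are formed with $S$: $\rho^*_{il}(x)=\rho_{li}(S(x))$. The adjoint representation $(V,\rho)$ is the irreducible module whose highest weight is the highest root; write $x\triangleright v=\rho(x)v$, $x\triangleright v_i=\sum_j\rho_{ji}(x)v_j$. **$R$-matrix.** $R$ is the standard universal $R$-matrix (in a completion of $U_q(\mathfrak{g})\otimes U_q(\mathfrak{g})$), satisfying $R\triangle(x)R^{-1}=\sigma\triangle(x)$ with $\sigma$ the flip; $R^t=\sigma R\sigma$ (tensor factors exchanged). $\check R=\sigma R$ acts on $V\otimes V$, commutes with $U_q(\mathfrak{g})$, and is invertible and diagonalizable with real nonzero eigenvalues. **$q$-Clifford algebra.** $B_q:V\otimes V\to\mathbb{C}$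 is the nondegenerate bilinear form, unique up to scalar, with $B_q(x'\triangleright v\otimes x''\triangleright w)=\epsilon(x)B_q(v\otimes w)$. $\mathrm{cl}_q(\mathfrak{g})=T(V)/\mathfrak{I}$, where $T(V)$ is the tensor algebra and $\mathfrak{I}$ is the two-sided ideal generated by $t-B_q(t)1$ for all $t\in V\otimes V$ that are eigenvectors of $\check R$ with positive eigenvalue. The action of $U_q(\mathfrak{g})$ on $T(V)$ (via iterated coproducts) descends to an action, also written $\triangleright$, on $\mathrm{cl}_q(\mathfrak{g})$; $\gamma_q:V\to\mathrm{cl}_q(\mathfrak{g})$ is the canonical map. $\Sigma$ is the underlying vector space of an irreducible complex representation of the classical Clifford algebra $\mathrm{cl}(\mathfrak{g})$ of $\mathfrak{g}$ with its Killing form. **The module $\mathfrak{L}^{\mathrm{op}}_q(\mathfrak{g})$.** The opposite adjoint action of $U_q(\mathfrak{g})$ on itself is $x\blacktriangleright^{\mathrm{op}}Z=x''\,Z\,S^{\mathrm{op}}(x')$. Put $q=e^h$, $X=h^{-1}(RR^t-1)$ (that is, $h^{-1}(R^tR-1)$ formed with the $R$-matrix $R^t$ of the opposite Hopf structure) and $X_{ij}=(\pi_{ij}\otimes\mathrm{id})X$, regarded as elements of $U_q(\mathfrak{g})$. Let $v_a\mapsto\sum_{i,j}K_a^{ij}\,u_i^*\otimes u_j$ be an injective module map from $V$ to $U^*\otimes U$, where $U^*\otimes U$ carries the action for the opposite structure, $x\cdot(u_l^*\otimes u_k)=\sum_{i,j}\pi_{li}(S^{\mathrm{op}}(x''))\pi_{jk}(x')\,u_i^*\otimes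 u_j$. Set $Z_a=\sum_{i,j}K_a^{ij}X_{ij}$; $\mathfrak{L}^{\mathrm{op}}_q(\mathfrak{g})$ is the span of the $Z_a$. They satisfy $x\blacktriangleright^{\mathrm{op}}Z_i=\sum_j\rho_{ji}(x)Z_j$, so $\phi:V\to\mathfrak{L}^{\mathrm{op}}_q(\mathfrak{g})$, $v_i\mapsto Z_i$, is a module isomorphism. **Notation in (1).** The left-hand side of (1) is simply $\sum_{i,j}\alpha_{ij}\,(x'\blacktriangleright^{\mathrm{op}}Z_i)\otimes(x''\triangleright\psi_j)$, summed also over the Sweedler components of $\triangle(x)=x'\otimes x''$. *)

theory Defs
  imports
    "Jordan_Normal_Form.Matrix"
    "HOL-Algebra.QuotRing"
    "HOL-Library.Poly_Mapping"
    "HOL-Library.Product_Plus"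
    "HOL-Library.Multiset"
    "HOL-Library.FuncSet"
    Complex_Main
begin

section \<open>Free algebras, presentations, tensor products\<close>

datatype 'a fmon = Word (letters: "'a list")

instantiation fmon :: (type) monoid_add
begin
definition zero_fmon :: "'a fmon" where "0 = Word []"
definition plus_fmon :: "'a fmon \<Rightarrow> 'a fmon \<Rightarrow> 'a fmon" where
  "u + v = Word (letters u @ letters v)"
instance by standard (auto simp: zero_fmon_def plus_fmon_def)
end

text \<open>The monoid algebra of the free monoid, with the convolution product of
  \<^theory>\<open>HOL-Library.Poly_Mapping\<close>, is the free algebra. The product monoid
  (\<^theory>\<open>HOL-Library.Product_Plus\<close>) has as its monoid algebra the tensor product of two free
  algebras, with the product \<open>(a \<otimes> b)(c \<otimes> d) = ac \<otimes> bd\<close>.\<close>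

type_synonym 'a falg = "'a fmon \<Rightarrow>\<^sub>0 complex"
type_synonym 'a falg2 = "('a fmon \<times> 'a fmon) \<Rightarrow>\<^sub>0 complex"

definition sc :: "complex \<Rightarrow> ('b \<Rightarrow>\<^sub>0 complex) \<Rightarrow> ('b \<Rightarrow>\<^sub>0 complex)" where
  "sc c y = Poly_Mapping.map (\<lambda>z. c * z) y"

definition mon :: "'b \<Rightarrow> ('b \<Rightarrow>\<^sub>0 complex)" where
  "mon w = Poly_Mapping.single w 1"

definition lett :: "'a \<Rightarrow> 'a falg" where
  "lett a = mon (Word [a])"

definition lin_ext :: "('a \<Rightarrow> ('b \<Rightarrow>\<^sub>0 complex)) \<Rightarrow> ('a \<Rightarrow>\<^sub>0 complex) \<Rightarrow> ('b \<Rightarrow>\<^sub>0 complex)" where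
  "lin_ext f x = (\<Sum>w\<in>Poly_Mapping.keys x. sc (Poly_Mapping.lookup x w) (f w))"

definition free_alg :: "'a set \<Rightarrow> (complex, 'a falg) module" where
  "free_alg L = \<lparr>carrier = {x. \<forall>w\<in>Poly_Mapping.keys x. set (letters w) \<subseteq> L},
     mult = (*), one = 1, zero = 0, add = (+), smult = sc\<rparr>"

text \<open>The unital associative algebra with generators \<open>L\<close> and relations \<open>r = 0\<close>, \<open>r \<in> Rel\<close>;
  \<open>cls L Rel x\<close> is the class of the element \<open>x\<close> of the free algebra. (HOL-Algebra ideals are
  two-sided.)\<close>

definition cls :: "'a set \<Rightarrow> 'a falg set \<Rightarrow> 'a falg \<Rightarrow> 'a falg set" where
  "cls L Rel x = (Idl\<^bsub>free_alg L\<^esub> Rel) +>\<^bsub>free_alg L\<^esub> x"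

definition presented :: "'a set \<Rightarrow> 'a falg set \<Rightarrow> (complex, 'a falg set) module" where
  "presented L Rel = ring.extend (free_alg L Quot (Idl\<^bsub>free_alg L\<^esub> Rel))
     (module.fields (\<lambda>c X. \<Union>x\<in>X. cls L Rel (sc c x)))"

definition alg_hom :: "(complex, 'a) module \<Rightarrow> (complex, 'b) module \<Rightarrow> ('a \<Rightarrow> 'b) set" where
  "alg_hom A B = {f \<in> ring_hom A B. \<forall>c. \<forall>x\<in>carrier A. f (c \<odot>\<^bsub>A\<^esub> x) = c \<odot>\<^bsub>B\<^esub> f x}"

definition repr :: "(complex, 'a) module \<Rightarrow> nat \<Rightarrow> ('a \<Rightarrow> complex mat) \<Rightarrow> bool" where
  "repr A d f \<longleftrightarrow> f \<in> alg_hom A (module_mat TYPE(complex) d d)"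

definition irreducible_on :: "nat \<Rightarrow> complex mat set \<Rightarrow> bool" where
  "irreducible_on d S \<longleftrightarrow> d > 0 \<and>
     (\<forall>W. W \<subseteq> carrier_vec d \<and> 0\<^sub>v d \<in> W \<and> (\<forall>v\<in>W. \<forall>w\<in>W. v + w \<in> W) \<and>
          (\<forall>c. \<forall>v\<in>W. c \<cdot>\<^sub>v v \<in> W) \<and> (\<forall>T\<in>S. \<forall>v\<in>W. T *\<^sub>v v \<in> W)
        \<longrightarrow> W = {0\<^sub>v d} \<or> W = carrier_vec d)"

definition irrep :: "(complex, 'a) module \<Rightarrow> nat \<Rightarrow> ('a \<Rightarrow> complex mat) \<Rightarrow> bool" where
  "irrep A d f \<longleftrightarrow> repr A d f \<and> irreducible_on d (f ` carrier A)"

text \<open>The vector space \<open>A \<otimes> B\<close>: formal combinations of pairs modulo the bilinearity relations.\<close>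

inductive_set tensor_null ::
  "(complex, 'a) module \<Rightarrow> (complex, 'b) module \<Rightarrow> (('a \<times> 'b) \<Rightarrow>\<^sub>0 complex) set"
  for A :: "(complex, 'a) module" and B :: "(complex, 'b) module" where
  zero: "0 \<in> tensor_null A B"
| add: "s \<in> tensor_null A B \<Longrightarrow> t \<in> tensor_null A B \<Longrightarrow> s + t \<in> tensor_null A B"
| scale: "s \<in> tensor_null A B \<Longrightarrow> sc c s \<in> tensor_null A B"
| add_left: "a \<in> carrier A \<Longrightarrow> a' \<in> carrier A \<Longrightarrow> b \<in> carrier B \<Longrightarrow>
    mon (a \<oplus>\<^bsub>A\<^esub> a', b) - mon (a, b) - mon (a', b) \<in> tensor_null A B"
| add_right: "a \<in> carrier A \<Longrightarrow> b \<in> carrier B \<Longrightarrow> b' \<in> carrier B \<Longrightarrow>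
    mon (a, b \<oplus>\<^bsub>B\<^esub> b') - mon (a, b) - mon (a, b') \<in> tensor_null A B"
| smult_left: "a \<in> carrier A \<Longrightarrow> b \<in> carrier B \<Longrightarrow>
    mon (c \<odot>\<^bsub>A\<^esub> a, b) - sc c (mon (a, b)) \<in> tensor_null A B"
| smult_right: "a \<in> carrier A \<Longrightarrow> b \<in> carrier B \<Longrightarrow>
    mon (a, c \<odot>\<^bsub>B\<^esub> b) - sc c (mon (a, b)) \<in> tensor_null A B"

definition tensor_eq :: "(complex, 'a) module \<Rightarrow> (complex, 'b) module \<Rightarrow>
    (('a \<times> 'b) \<Rightarrow>\<^sub>0 complex) \<Rightarrow> (('a \<times> 'b) \<Rightarrow>\<^sub>0 complex) \<Rightarrow> bool" where
  "tensor_eq A B s t \<longleftrightarrow> s - t \<in> tensor_null A B"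

text \<open>Tensor products of matrices and vectors: \<open>e\<^sub>i \<otimes> f\<^sub>j\<close> has index \<open>i * dim + j\<close>, where
  \<open>dim\<close> is the dimension of the second factor. \<open>flip_mat a b\<close> exchanges the factors of a tensor
  product of spaces of dimensions \<open>a\<close> and \<open>b\<close>.\<close>

definition kron :: "complex mat \<Rightarrow> complex mat \<Rightarrow> complex mat" where
  "kron S T = mat (dim_row S * dim_row T) (dim_col S * dim_col T)
     (\<lambda>(r, c). S $$ (r div dim_row T, c div dim_col T) * T $$ (r mod dim_row T, c mod dim_col T))"

definition kron_vec :: "complex vec \<Rightarrow> complex vec \<Rightarrow> complex vec" where
  "kron_vec v w = vec (dim_vec v * dim_vec w) (\<lambda>r. v $ (r div dim_vec w) * w $ (r mod dim_vec w))"

definition flip_mat :: "nat \<Rightarrow> nat \<Rightarrow> complex mat" where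
  "flip_mat a b = mat (b * a) (a * b)
     (\<lambda>(r, c). if r div a = c mod b \<and> r mod a = c div b then 1 else 0)"

text \<open>The matrix \<open>\<Sum> f a b\<close> of size \<open>d\<close>, for \<open>t = \<Sum> a \<otimes> b\<close> and bilinear \<open>f\<close>.\<close>

definition tsum_mat ::
  "nat \<Rightarrow> 'a falg2 \<Rightarrow> ('a falg \<Rightarrow> 'a falg \<Rightarrow> complex mat) \<Rightarrow> complex mat" where
  "tsum_mat d t f = mat d d (\<lambda>rc. \<Sum>p\<in>Poly_Mapping.keys t.
     Poly_Mapping.lookup t p * f (mon (fst p)) (mon (snd p)) $$ rc)"

section \<open>Classical simple Lie algebras\<close>

text \<open>The simple roots are numbered \<open>0, \<dots>, n - 1\<close> as in Bourbaki.\<close>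

datatype ctype = Type_A nat | Type_B nat | Type_C nat | Type_D nat

fun classical :: "ctype \<Rightarrow> bool" where
  "classical (Type_A n) \<longleftrightarrow> n \<ge> 1"
| "classical (Type_B n) \<longleftrightarrow> n \<ge> 2"
| "classical (Type_C n) \<longleftrightarrow> n \<ge> 2"
| "classical (Type_D n) \<longleftrightarrow> n \<ge> 3"

fun rank :: "ctype \<Rightarrow> nat" where
  "rank (Type_A n) = n"
| "rank (Type_B n) = n"
| "rank (Type_C n) = n"
| "rank (Type_D n) = n"

text \<open>\<open>cartan ty i j\<close> is \<open>\<alpha>\<^sub>j(h\<^sub>i)\<close>; \<open>root_len ty i\<close> is \<open>d\<^sub>i\<close>.\<close>

fun cartan :: "ctype \<Rightarrow> nat \<Rightarrow> nat \<Rightarrow> int" where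
  "cartan (Type_A n) i j =
     (if i = j then 2 else if i = j + 1 \<or> j = i + 1 then - 1 else 0)"
| "cartan (Type_B n) i j =
     (if i = j then 2 else if i = n - 1 \<and> j = n - 2 then - 2
      else if i = j + 1 \<or> j = i + 1 then - 1 else 0)"
| "cartan (Type_C n) i j =
     (if i = j then 2 else if i = n - 2 \<and> j = n - 1 then - 2
      else if i = j + 1 \<or> j = i + 1 then - 1 else 0)"
| "cartan (Type_D n) i j =
     (if i = j then 2
      else if (i < n - 1 \<and> j < n - 1 \<and> (i = j + 1 \<or> j = i + 1)) \<or>
              (i = n - 1 \<and> j = n - 3) \<or> (i = n - 3 \<and> j = n - 1) then - 1 else 0)"

fun root_len :: "ctype \<Rightarrow> nat \<Rightarrow> nat" where
  "root_len (Type_A n) i = 1"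
| "root_len (Type_B n) i = (if i = n - 1 then 1 else 2)"
| "root_len (Type_C n) i = (if i = n - 1 then 2 else 1)"
| "root_len (Type_D n) i = 1"

text \<open>The coefficient of \<open>\<alpha>\<^sub>i\<close> in the highest root.\<close>

fun highest_root_coeff :: "ctype \<Rightarrow> nat \<Rightarrow> nat" where
  "highest_root_coeff (Type_A n) i = 1"
| "highest_root_coeff (Type_B n) i = (if i = 0 then 1 else 2)"
| "highest_root_coeff (Type_C n) i = (if i = n - 1 then 1 else 2)"
| "highest_root_coeff (Type_D n) i = (if i = 0 \<or> i \<ge> n - 2 then 1 else 2)"

text \<open>A dominant integral weight is given by its values \<open>\<lambda>(h\<^sub>i)\<close>.\<close>

type_synonym weight = "nat \<Rightarrow> nat"

definition P_plus :: "ctype \<Rightarrow> weight set" where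
  "P_plus ty = {l. \<forall>i\<ge>rank ty. l i = 0}"

definition wt_vector :: weight where
  "wt_vector = (\<lambda>i. if i = 0 then 1 else 0)"

definition wt_adjoint :: "ctype \<Rightarrow> weight" where
  "wt_adjoint ty = (\<lambda>i. if i < rank ty
     then nat (\<Sum>j<rank ty. cartan ty i j * int (highest_root_coeff ty j)) else 0)"

fun natural_dim :: "ctype \<Rightarrow> nat" where
  "natural_dim (Type_A n) = n + 1"
| "natural_dim (Type_B n) = 2 * n + 1"
| "natural_dim (Type_C n) = 2 * n"
| "natural_dim (Type_D n) = 2 * n"

definition symplectic_form :: "nat \<Rightarrow> complex mat" where
  "symplectic_form n = mat (2 * n) (2 * n)
     (\<lambda>(i, j). if j = i + n then 1 else if i = j + n then - 1 else 0)"

fun lie_algebra :: "ctype \<Rightarrow> complex mat set" where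
  "lie_algebra (Type_A n) = {X \<in> carrier_mat (n + 1) (n + 1). (\<Sum>i<n + 1. X $$ (i, i)) = 0}"
| "lie_algebra (Type_B n) = {X \<in> carrier_mat (2 * n + 1) (2 * n + 1). transpose_mat X = - X}"
| "lie_algebra (Type_C n) = {X \<in> carrier_mat (2 * n) (2 * n).
     transpose_mat X * symplectic_form n + symplectic_form n * X = 0\<^sub>m (2 * n) (2 * n)}"
| "lie_algebra (Type_D n) = {X \<in> carrier_mat (2 * n) (2 * n). transpose_mat X = - X}"

definition lie_bracket :: "complex mat \<Rightarrow> complex mat \<Rightarrow> complex mat" where
  "lie_bracket X Y = X * Y - Y * X"

definition lin_comb :: "nat \<Rightarrow> (nat \<Rightarrow> complex) \<Rightarrow> complex mat list \<Rightarrow> complex mat" where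
  "lin_comb d c bs = mat d d (\<lambda>rc. \<Sum>k<length bs. c k * (bs ! k) $$ rc)"

definition lie_basis :: "ctype \<Rightarrow> complex mat list \<Rightarrow> bool" where
  "lie_basis ty bs \<longleftrightarrow> set bs \<subseteq> lie_algebra ty \<and>
     (\<forall>X\<in>lie_algebra ty. \<exists>!c. (\<forall>k\<ge>length bs. c k = 0) \<and> X = lin_comb (natural_dim ty) c bs)"

text \<open>The trace of \<open>ad X \<circ> ad Y\<close>.\<close>

definition killing_form :: "ctype \<Rightarrow> complex mat \<Rightarrow> complex mat \<Rightarrow> complex" where
  "killing_form ty X Y = (THE t. \<exists>bs c. lie_basis ty bs \<and>
     (\<forall>j<length bs. lie_bracket X (lie_bracket Y (bs ! j)) =
        lin_comb (natural_dim ty) (\<lambda>i. c i j) bs) \<and>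
     t = (\<Sum>i<length bs. c i i))"

text \<open>The classical Clifford algebra is generated by the elements of the Lie algebra, with the
  relations of the vector space structure and \<open>X X = \<kappa>(X, X) 1\<close>.\<close>

definition clifford :: "ctype \<Rightarrow> (complex, complex mat falg set) module" where
  "clifford ty = presented (lie_algebra ty)
     ({lett (X + Y) - lett X - lett Y | X Y. X \<in> lie_algebra ty \<and> Y \<in> lie_algebra ty} \<union>
      {lett (c \<cdot>\<^sub>m X) - sc c (lett X) | c X. X \<in> lie_algebra ty} \<union>
      {lett X * lett X - sc (killing_form ty X X) 1 | X. X \<in> lie_algebra ty})"

text \<open>\<open>\<complex>\<^sup>N\<close> carries an irreducible representation of the classical Clifford algebra.\<close>

definition spinor_dim :: "ctype \<Rightarrow> nat \<Rightarrow> bool" where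
  "spinor_dim ty N \<longleftrightarrow> (\<exists>f. irrep (clifford ty) N f)"

section \<open>The quantum group\<close>

datatype qgen = Gk nat | Gki nat | Ge nat | Gf nat

definition q_i :: "ctype \<Rightarrow> real \<Rightarrow> nat \<Rightarrow> real" where
  "q_i ty q i = q ^ root_len ty i"

definition q_int :: "real \<Rightarrow> nat \<Rightarrow> real" where
  "q_int q m = (q ^ m - inverse q ^ m) / (q - inverse q)"

definition q_fact :: "real \<Rightarrow> nat \<Rightarrow> real" where
  "q_fact q m = (\<Prod>k=1..m. q_int q k)"

definition q_binom :: "real \<Rightarrow> nat \<Rightarrow> nat \<Rightarrow> real" where
  "q_binom q m k = q_fact q m / (q_fact q k * q_fact q (m - k))"

definition serre :: "ctype \<Rightarrow> real \<Rightarrow> (nat \<Rightarrow> qgen) \<Rightarrow> nat \<Rightarrow> nat \<Rightarrow> qgen falg" where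
  "serre ty q G i j = (let N = nat (1 - cartan ty i j) in
     \<Sum>m\<le>N. sc ((- 1) ^ m * complex_of_real (q_binom (q_i ty q i) N m))
       (lett (G i) ^ (N - m) * lett (G j) * lett (G i) ^ m))"

definition Uq_gens :: "ctype \<Rightarrow> qgen set" where
  "Uq_gens ty = (\<Union>i<rank ty. {Gk i, Gki i, Ge i, Gf i})"

definition Uq_rels :: "ctype \<Rightarrow> real \<Rightarrow> qgen falg set" where
  "Uq_rels ty q =
    (\<Union>i<rank ty. {lett (Gk i) * lett (Gki i) - 1, lett (Gki i) * lett (Gk i) - 1}) \<union>
    (\<Union>i<rank ty. \<Union>j<rank ty.
      {lett (Gk i) * lett (Gk j) - lett (Gk j) * lett (Gk i),
       lett (Gk i) * lett (Ge j) * lett (Gki i) -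
         sc (complex_of_real (q_i ty q i powr (real_of_int (cartan ty i j) / 2))) (lett (Ge j)),
       lett (Gk i) * lett (Gf j) * lett (Gki i) -
         sc (complex_of_real (q_i ty q i powr (- real_of_int (cartan ty i j) / 2))) (lett (Gf j)),
       lett (Ge i) * lett (Gf j) - lett (Gf j) * lett (Ge i) -
         (if i = j then sc (1 / complex_of_real (q_i ty q i - inverse (q_i ty q i)))
            (lett (Gk i) ^ 2 - lett (Gki i) ^ 2) else 0)}) \<union>
    (\<Union>i<rank ty. \<Union>j\<in>{..<rank ty} - {i}. {serre ty q Ge i j, serre ty q Gf i j})"

definition Uq :: "ctype \<Rightarrow> real \<Rightarrow> (complex, qgen falg set) module" where
  "Uq ty q = presented (Uq_gens ty) (Uq_rels ty q)"

definition Uq_cls :: "ctype \<Rightarrow> real \<Rightarrow> qgen falg \<Rightarrow> qgen falg set" where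
  "Uq_cls ty q = cls (Uq_gens ty) (Uq_rels ty q)"

text \<open>The Hopf structure is given by maps on the free algebra which respect the defining relations.
  Sweedler sums \<open>\<Sum> f x' x''\<close> are formed from a representative \<open>x\<close> in the free algebra; all
  conditions \<open>for all x \<in> U\<^sub>q(g)\<close> below quantify over \<open>Uq_free ty\<close>, i.e. over all representatives
  of all elements.\<close>

definition Uq_free :: "ctype \<Rightarrow> qgen falg set" where
  "Uq_free ty = carrier (free_alg (Uq_gens ty))"

fun coprod_gen :: "qgen \<Rightarrow> qgen falg2" where
  "coprod_gen (Gk i) = mon (Word [Gk i], Word [Gk i])"
| "coprod_gen (Gki i) = mon (Word [Gki i], Word [Gki i])"
| "coprod_gen (Ge i) = mon (Word [Ge i], Word [Gk i]) + mon (Word [Gki i], Word [Ge i])"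
| "coprod_gen (Gf i) = mon (Word [Gf i], Word [Gk i]) + mon (Word [Gki i], Word [Gf i])"

definition coprod :: "qgen falg \<Rightarrow> qgen falg2" where
  "coprod = lin_ext (\<lambda>w. prod_list (map coprod_gen (letters w)))"

definition coprod_op :: "qgen falg \<Rightarrow> qgen falg2" where
  "coprod_op x = Poly_Mapping.map_key prod.swap (coprod x)"

fun antipode_gen :: "ctype \<Rightarrow> real \<Rightarrow> qgen \<Rightarrow> qgen falg" where
  "antipode_gen ty q (Gk i) = lett (Gki i)"
| "antipode_gen ty q (Gki i) = lett (Gk i)"
| "antipode_gen ty q (Ge i) = sc (- complex_of_real (q_i ty q i)) (lett (Ge i))"
| "antipode_gen ty q (Gf i) = sc (- complex_of_real (inverse (q_i ty q i))) (lett (Gf i))"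

definition antipode :: "ctype \<Rightarrow> real \<Rightarrow> qgen falg \<Rightarrow> qgen falg" where
  "antipode ty q = lin_ext (\<lambda>w. prod_list (rev (map (antipode_gen ty q) (letters w))))"

text \<open>\<open>S\<^sup>o\<^sup>p(e\<^sub>i) = -q\<^sub>i\<^sup>-\<^sup>1 e\<^sub>i\<close> and \<open>S\<^sup>o\<^sup>p(f\<^sub>i) = -q\<^sub>i f\<^sub>i\<close>: the antipode with \<open>q\<close> inverted.\<close>

definition antipode_op :: "ctype \<Rightarrow> real \<Rightarrow> qgen falg \<Rightarrow> qgen falg" where
  "antipode_op ty q = antipode ty (inverse q)"

fun counit_gen :: "qgen \<Rightarrow> complex" where
  "counit_gen (Gk i) = 1"
| "counit_gen (Gki i) = 1"
| "counit_gen (Ge i) = 0"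
| "counit_gen (Gf i) = 0"

definition counit :: "qgen falg \<Rightarrow> complex" where
  "counit x = (\<Sum>w\<in>Poly_Mapping.keys x.
     Poly_Mapping.lookup x w * prod_list (map counit_gen (letters w)))"

section \<open>Modules and the R-matrix\<close>

definition highest_weight_module ::
  "ctype \<Rightarrow> real \<Rightarrow> weight \<Rightarrow> nat \<Rightarrow> (qgen falg set \<Rightarrow> complex mat) \<Rightarrow> bool" where
  "highest_weight_module ty q l d f \<longleftrightarrow> irrep (Uq ty q) d f \<and>
     (\<exists>\<xi>\<in>carrier_vec d. \<xi> \<noteq> 0\<^sub>v d \<and> (\<forall>i<rank ty.
        f (Uq_cls ty q (lett (Ge i))) *\<^sub>v \<xi> = 0\<^sub>v d \<and>
        f (Uq_cls ty q (lett (Gk i))) *\<^sub>v \<xi> =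
          complex_of_real (q_i ty q i powr (real (l i) / 2)) \<cdot>\<^sub>v \<xi>))"

text \<open>A choice of a matrix model \<open>\<pi> l\<close> on \<open>\<complex>\<^bsup>d l\<^esup>\<close> of every \<open>V\<^sub>l\<close>. The vector
  representation is \<open>\<pi> wt_vector\<close> and the adjoint one is \<open>\<pi> (wt_adjoint ty)\<close>; their bases are
  arbitrary because the models are.\<close>

definition model_family ::
  "ctype \<Rightarrow> real \<Rightarrow> (weight \<Rightarrow> nat) \<Rightarrow> (weight \<Rightarrow> qgen falg set \<Rightarrow> complex mat) \<Rightarrow> bool" where
  "model_family ty q d \<pi> \<longleftrightarrow> (\<forall>l\<in>P_plus ty. highest_weight_module ty q l (d l) (\<pi> l))"

definition tensor_act :: "ctype \<Rightarrow> real \<Rightarrow> nat \<Rightarrow> (qgen falg set \<Rightarrow> complex mat) \<Rightarrow>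
    nat \<Rightarrow> (qgen falg set \<Rightarrow> complex mat) \<Rightarrow> qgen falg2 \<Rightarrow> complex mat" where
  "tensor_act ty q d1 f1 d2 f2 t =
     tsum_mat (d1 * d2) t (\<lambda>a b. kron (f1 (Uq_cls ty q a)) (f2 (Uq_cls ty q b)))"

definition weight_vector ::
  "ctype \<Rightarrow> real \<Rightarrow> nat \<Rightarrow> (qgen falg set \<Rightarrow> complex mat) \<Rightarrow> (nat \<Rightarrow> real) \<Rightarrow> complex vec \<Rightarrow> bool" where
  "weight_vector ty q d f \<nu> v \<longleftrightarrow> v \<in> carrier_vec d \<and> (\<forall>i<rank ty.
     f (Uq_cls ty q (lett (Gk i))) *\<^sub>v v = complex_of_real (q_i ty q i powr (\<nu> i / 2)) \<cdot>\<^sub>v v)"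

text \<open>The factor \<open>q\<^bsup>(\<nu>, \<mu>)\<^esup>\<close> of the R-matrix. If \<open>\<mu> = \<Sum>\<^sub>j m\<^sub>j \<alpha>\<^sub>j\<close>, then
  \<open>\<mu>(h\<^sub>i) = \<Sum>\<^sub>j a\<^sub>i\<^sub>j m\<^sub>j\<close> and \<open>(\<nu>, \<mu>) = \<Sum>\<^sub>i d\<^sub>i \<nu>(h\<^sub>i) m\<^sub>i\<close>.\<close>

definition cartan_part :: "ctype \<Rightarrow> real \<Rightarrow> nat \<Rightarrow> (qgen falg set \<Rightarrow> complex mat) \<Rightarrow>
    nat \<Rightarrow> (qgen falg set \<Rightarrow> complex mat) \<Rightarrow> complex mat \<Rightarrow> bool" where
  "cartan_part ty q d1 f1 d2 f2 C \<longleftrightarrow> C \<in> carrier_mat (d1 * d2) (d1 * d2) \<and>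
     (\<forall>\<nu> m v w. weight_vector ty q d1 f1 \<nu> v \<and>
        weight_vector ty q d2 f2 (\<lambda>i. \<Sum>j<rank ty. real_of_int (cartan ty i j) * m j) w \<longrightarrow>
        C *\<^sub>v kron_vec v w =
          complex_of_real (q powr (\<Sum>i<rank ty. real (root_len ty i) * \<nu> i * m i)) \<cdot>\<^sub>v kron_vec v w)"

text \<open>The standard universal R-matrix, as the family of its values \<open>R l m\<close> on \<open>V\<^sub>l \<otimes> V\<^sub>m\<close>. It is
  \<open>q\<^bsup>(\<cdot>,\<cdot>)\<^esup> \<Theta>\<close>, where \<open>\<Theta> = \<Sum>\<^sub>h \<Theta>\<^sub>h\<close> is the quasi-R-matrix, characterised as by Lusztig:
  \<open>\<Theta>\<^sub>0 = 1\<close>, and \<open>\<Theta>\<^sub>h\<close> is a combination of terms \<open>x \<otimes> y\<close> with \<open>x\<close> and \<open>y\<close> products of the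
  elements \<open>e\<^sub>i k\<^sub>i\<close> and \<open>f\<^sub>i k\<^sub>i\<^sup>-\<^sup>1\<close> respectively, of opposite weights of height \<open>h\<close>.
  On each \<open>V\<^sub>l \<otimes> V\<^sub>m\<close> the sum is finite. Together with the intertwining property
  \<open>R \<Delta>(x) = \<Delta>\<^sup>o\<^sup>p(x) R\<close> this determines \<open>R\<close>.\<close>

definition universal_R :: "ctype \<Rightarrow> real \<Rightarrow> (weight \<Rightarrow> nat) \<Rightarrow>
    (weight \<Rightarrow> qgen falg set \<Rightarrow> complex mat) \<Rightarrow> (weight \<Rightarrow> weight \<Rightarrow> complex mat) \<Rightarrow> bool" where
  "universal_R ty q d \<pi> R \<longleftrightarrow> (\<exists>\<Theta> :: nat \<Rightarrow> qgen falg2.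
     \<Theta> 0 = 1 \<and>
     (\<forall>h. \<forall>p\<in>Poly_Mapping.keys (\<Theta> h). \<exists>us vs.
        length us = h \<and> mset us = mset vs \<and> set us \<subseteq> {..<rank ty} \<and>
        p = (Word (concat (map (\<lambda>i. [Ge i, Gk i]) us)),
             Word (concat (map (\<lambda>i. [Gf i, Gki i]) vs)))) \<and>
     (\<forall>l\<in>P_plus ty. \<forall>m\<in>P_plus ty.
        (\<exists>C. cartan_part ty q (d l) (\<pi> l) (d m) (\<pi> m) C \<and>
          (\<exists>M. \<forall>M'\<ge>M. R l m =
             C * tensor_act ty q (d l) (\<pi> l) (d m) (\<pi> m) (\<Sum>h\<le>M'. \<Theta> h))) \<and>
        (\<forall>x\<in>Uq_free ty.
           R l m * tensor_act ty q (d l) (\<pi> l) (d m) (\<pi> m) (coprod x) =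
           tensor_act ty q (d l) (\<pi> l) (d m) (\<pi> m) (coprod_op x) * R l m)))"

section \<open>The q-Clifford algebra\<close>

text \<open>\<open>V = \<complex>\<^sup>m\<close> with basis \<open>v\<^sub>0, \<dots>, v\<^bsub>m-1\<^esub>\<close>; the tensor algebra is the free algebra on the
  indices. \<open>B\<close> is the matrix \<open>B\<^sub>q(v\<^sub>i \<otimes> v\<^sub>j)\<close> and \<open>Rc\<close> the matrix of \<open>\<sigma>R\<close> on \<open>V \<otimes> V\<close>.\<close>

definition invariant_form ::
  "ctype \<Rightarrow> real \<Rightarrow> nat \<Rightarrow> (qgen falg set \<Rightarrow> complex mat) \<Rightarrow> complex mat \<Rightarrow> bool" where
  "invariant_form ty q m \<rho> B \<longleftrightarrow> B \<in> carrier_mat m m \<and> invertible_mat B \<and>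
     (\<forall>x\<in>Uq_free ty. tsum_mat m (coprod x)
        (\<lambda>a b. transpose_mat (\<rho> (Uq_cls ty q a)) * B * \<rho> (Uq_cls ty q b)) = counit x \<cdot>\<^sub>m B)"

definition clq_rels :: "nat \<Rightarrow> complex mat \<Rightarrow> complex mat \<Rightarrow> nat falg set" where
  "clq_rels m Rc B =
     {(\<Sum>i<m. \<Sum>j<m. sc (t $ (i * m + j)) (lett i * lett j)) -
        sc (\<Sum>i<m. \<Sum>j<m. B $$ (i, j) * t $ (i * m + j)) 1
      | t. t \<in> carrier_vec (m * m) \<and> (\<exists>c::real. c > 0 \<and> Rc *\<^sub>v t = complex_of_real c \<cdot>\<^sub>v t)}"

definition clq :: "nat \<Rightarrow> complex mat \<Rightarrow> complex mat \<Rightarrow> (complex, nat falg set) module" where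
  "clq m Rc B = presented {..<m} (clq_rels m Rc B)"

definition clq_cls :: "nat \<Rightarrow> complex mat \<Rightarrow> complex mat \<Rightarrow> nat falg \<Rightarrow> nat falg set" where
  "clq_cls m Rc B = cls {..<m} (clq_rels m Rc B)"

definition gamma_q :: "nat \<Rightarrow> complex mat \<Rightarrow> complex mat \<Rightarrow> complex vec \<Rightarrow> nat falg set" where
  "gamma_q m Rc B v = clq_cls m Rc B (\<Sum>j<m. sc (v $ j) (lett j))"

text \<open>The action on the tensor algebra: \<open>x \<triangleright> 1 = \<epsilon>(x) 1\<close> and
  \<open>x \<triangleright> (v\<^sub>j w) = (x' \<triangleright> v\<^sub>j) (x'' \<triangleright> w)\<close>.\<close>

primrec word_act ::
  "(qgen falg \<Rightarrow> complex mat) \<Rightarrow> nat \<Rightarrow> nat list \<Rightarrow> qgen falg \<Rightarrow> nat falg" where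
  "word_act \<rho> m [] = (\<lambda>x. sc (counit x) 1)"
| "word_act \<rho> m (j # w) = (\<lambda>x. \<Sum>p\<in>Poly_Mapping.keys (coprod x).
     sc (Poly_Mapping.lookup (coprod x) p)
       ((\<Sum>k<m. sc (\<rho> (mon (fst p)) $$ (k, j)) (lett k)) * word_act \<rho> m w (mon (snd p))))"

definition clq_act :: "ctype \<Rightarrow> real \<Rightarrow> nat \<Rightarrow> (qgen falg set \<Rightarrow> complex mat) \<Rightarrow>
    complex mat \<Rightarrow> complex mat \<Rightarrow> qgen falg \<Rightarrow> nat falg set \<Rightarrow> nat falg set" where
  "clq_act ty q m \<rho> Rc B x Y =
     (\<Union>y\<in>Y. clq_cls m Rc B
        (lin_ext (\<lambda>w. word_act (\<lambda>a. \<rho> (Uq_cls ty q a)) m (letters w) x) y))"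

section \<open>The quantum Lie algebra \<open>L\<^sub>q\<^sup>o\<^sup>p\<close>\<close>

text \<open>The completion \<open>\<Prod>\<^sub>l End V\<^sub>l\<close> of the quantum group and the canonical map into it.\<close>

definition Uhat :: "ctype \<Rightarrow> (weight \<Rightarrow> nat) \<Rightarrow> (complex, weight \<Rightarrow> complex mat) module" where
  "Uhat ty d = \<lparr>carrier = (\<Pi>\<^sub>E l\<in>P_plus ty. carrier_mat (d l) (d l)),
     mult = (\<lambda>S T. \<lambda>l\<in>P_plus ty. S l * T l),
     one = (\<lambda>l\<in>P_plus ty. 1\<^sub>m (d l)),
     zero = (\<lambda>l\<in>P_plus ty. 0\<^sub>m (d l) (d l)),
     add = (\<lambda>S T. \<lambda>l\<in>P_plus ty. S l + T l),
     smult = (\<lambda>c T. \<lambda>l\<in>P_plus ty. c \<cdot>\<^sub>m T l)\<rparr>"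

definition to_Uhat :: "ctype \<Rightarrow> (weight \<Rightarrow> qgen falg set \<Rightarrow> complex mat) \<Rightarrow>
    qgen falg set \<Rightarrow> (weight \<Rightarrow> complex mat)" where
  "to_Uhat ty \<pi> u = (\<lambda>l\<in>P_plus ty. \<pi> l u)"

text \<open>Below, \<open>A\<close> is an algebra with an algebra map \<open>\<iota>\<close> from the quantum group and evaluation maps
  \<open>ev l\<close> to \<open>End V\<^sub>l\<close>: either the quantum group itself (\<open>\<iota> = id\<close>, \<open>ev = \<pi>\<close>), or its
  completion. The second is needed because the \<open>X\<^sub>i\<^sub>j\<close> involve \<open>q\<close> to the power of elements of
  the Cartan subalgebra dual to weights of the vector representation; for type \<open>A\<^sub>n\<close> these are in
  general not products of the \<open>k\<^sub>i\<^sup>\<plusminus>\<^sup>1\<close>. The opposite adjoint action is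
  \<open>\<Sum> x'' Z S\<^sup>o\<^sup>p(x')\<close>.\<close>

definition op_adjoint :: "ctype \<Rightarrow> real \<Rightarrow> (complex, 'u) module \<Rightarrow> (qgen falg set \<Rightarrow> 'u) \<Rightarrow>
    qgen falg \<Rightarrow> 'u \<Rightarrow> 'u" where
  "op_adjoint ty q A \<iota> x Z = (\<Oplus>\<^bsub>A\<^esub>p\<in>Poly_Mapping.keys (coprod x).
     Poly_Mapping.lookup (coprod x) p \<odot>\<^bsub>A\<^esub>
       (\<iota> (Uq_cls ty q (mon (snd p))) \<otimes>\<^bsub>A\<^esub> Z \<otimes>\<^bsub>A\<^esub>
        \<iota> (Uq_cls ty q (antipode_op ty q (mon (fst p))))))"

text \<open>The operator \<open>X = (R R\<^sup>t - 1) / h\<close>, \<open>q = e\<^sup>h\<close>, on \<open>U \<otimes> V\<^sub>l\<close>, and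
  \<open>X\<^sub>i\<^sub>j = (\<pi>\<^sub>i\<^sub>j \<otimes> id) X\<close> in \<open>End V\<^sub>l\<close>.\<close>

definition X_op :: "real \<Rightarrow> (weight \<Rightarrow> nat) \<Rightarrow> (weight \<Rightarrow> weight \<Rightarrow> complex mat) \<Rightarrow>
    weight \<Rightarrow> complex mat" where
  "X_op q d R l = (let u = wt_vector in
     complex_of_real (1 / ln q) \<cdot>\<^sub>m
       (R u l * (flip_mat (d l) (d u) * R l u * flip_mat (d u) (d l)) - 1\<^sub>m (d u * d l)))"

definition X_entry :: "real \<Rightarrow> (weight \<Rightarrow> nat) \<Rightarrow> (weight \<Rightarrow> weight \<Rightarrow> complex mat) \<Rightarrow>
    nat \<Rightarrow> nat \<Rightarrow> weight \<Rightarrow> complex mat" where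
  "X_entry q d R i j l =
     mat (d l) (d l) (\<lambda>(r, c). X_op q d R l $$ (i * d l + r, j * d l + c))"

text \<open>An injective module map \<open>v\<^sub>a \<mapsto> \<Sum> K\<^sub>a\<^sup>i\<^sup>j u\<^sub>i\<^sup>* \<otimes> u\<^sub>j\<close> from \<open>V\<close> (of dimension \<open>m\<close>)
  to \<open>U\<^sup>* \<otimes> U\<close> (with \<open>U\<close> of dimension \<open>n\<close>) for the opposite Hopf structure.\<close>

definition adjoint_embedding :: "ctype \<Rightarrow> real \<Rightarrow> nat \<Rightarrow> (qgen falg set \<Rightarrow> complex mat) \<Rightarrow>
    nat \<Rightarrow> (qgen falg set \<Rightarrow> complex mat) \<Rightarrow> (nat \<Rightarrow> complex mat) \<Rightarrow> bool" where
  "adjoint_embedding ty q n f m \<rho> K \<longleftrightarrow>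
     (\<forall>a<m. K a \<in> carrier_mat n n) \<and>
     (\<forall>c :: nat \<Rightarrow> complex. (\<forall>i<n. \<forall>j<n. (\<Sum>a<m. c a * K a $$ (i, j)) = 0) \<longrightarrow> (\<forall>a<m. c a = 0)) \<and>
     (\<forall>x\<in>Uq_free ty. \<forall>a<m. \<forall>i<n. \<forall>j<n.
        (\<Sum>b<m. \<rho> (Uq_cls ty q x) $$ (b, a) * K b $$ (i, j)) =
        (\<Sum>p\<in>Poly_Mapping.keys (coprod x). Poly_Mapping.lookup (coprod x) p *
           (\<Sum>l<n. \<Sum>k<n. K a $$ (l, k) *
              f (Uq_cls ty q (antipode_op ty q (mon (snd p)))) $$ (l, i) *
              f (Uq_cls ty q (mon (fst p))) $$ (j, k))))"

text \<open>\<open>L\<close> is the span of the \<open>Z\<^sub>a = \<Sum> K\<^sub>a\<^sup>i\<^sup>j X\<^sub>i\<^sub>j\<close>, the \<open>X\<^sub>i\<^sub>j\<close> being elements of \<open>A\<close>.\<close>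

definition quantum_lie_space :: "ctype \<Rightarrow> real \<Rightarrow> (weight \<Rightarrow> nat) \<Rightarrow>
    (weight \<Rightarrow> weight \<Rightarrow> complex mat) \<Rightarrow> (nat \<Rightarrow> complex mat) \<Rightarrow>
    (complex, 'u) module \<Rightarrow> (weight \<Rightarrow> 'u \<Rightarrow> complex mat) \<Rightarrow> 'u set \<Rightarrow> bool" where
  "quantum_lie_space ty q d R K A ev L \<longleftrightarrow> (\<exists>X.
     (\<forall>i<d wt_vector. \<forall>j<d wt_vector. X i j \<in> carrier A \<and>
        (\<forall>l\<in>P_plus ty. ev l (X i j) = X_entry q d R i j l)) \<and>
     L = {\<Oplus>\<^bsub>A\<^esub>a\<in>{..<d (wt_adjoint ty)}. c a \<odot>\<^bsub>A\<^esub>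
            (\<Oplus>\<^bsub>A\<^esub>ij\<in>{..<d wt_vector} \<times> {..<d wt_vector}. K a $$ ij \<odot>\<^bsub>A\<^esub> X (fst ij) (snd ij))
          | c. True})"

definition is_phi :: "ctype \<Rightarrow> real \<Rightarrow> nat \<Rightarrow> (qgen falg set \<Rightarrow> complex mat) \<Rightarrow>
    (complex, 'u) module \<Rightarrow> (qgen falg set \<Rightarrow> 'u) \<Rightarrow> 'u set \<Rightarrow> (complex vec \<Rightarrow> 'u) \<Rightarrow> bool" where
  "is_phi ty q m \<rho> A \<iota> L \<phi> \<longleftrightarrow> bij_betw \<phi> (carrier_vec m) L \<and>
     (\<forall>v\<in>carrier_vec m. \<forall>w\<in>carrier_vec m. \<phi> (v + w) = \<phi> v \<oplus>\<^bsub>A\<^esub> \<phi> w) \<and>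
     (\<forall>c. \<forall>v\<in>carrier_vec m. \<phi> (c \<cdot>\<^sub>v v) = c \<odot>\<^bsub>A\<^esub> \<phi> v) \<and>
     (\<forall>x\<in>Uq_free ty. \<forall>v\<in>carrier_vec m.
        \<phi> (\<rho> (Uq_cls ty q x) *\<^sub>v v) = op_adjoint ty q A \<iota> x (\<phi> v))"

text \<open>A module isomorphism \<open>V\<^sup>* \<rightarrow> V\<close> as a matrix with respect to the dual basis and the basis;
  the action on \<open>V\<^sup>*\<close> is \<open>\<rho>\<^sup>*\<^sub>i\<^sub>l(x) = \<rho>\<^sub>l\<^sub>i(S(x))\<close>.\<close>

definition is_tau ::
  "ctype \<Rightarrow> real \<Rightarrow> nat \<Rightarrow> (qgen falg set \<Rightarrow> complex mat) \<Rightarrow> complex mat \<Rightarrow> bool" where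
  "is_tau ty q m \<rho> \<tau> \<longleftrightarrow> \<tau> \<in> carrier_mat m m \<and> invertible_mat \<tau> \<and>
     (\<forall>x\<in>Uq_free ty. \<tau> * transpose_mat (\<rho> (Uq_cls ty q (antipode ty q x))) =
        \<rho> (Uq_cls ty q x) * \<tau>)"

section \<open>The Dirac operator\<close>

text \<open>\<open>D = (\<phi> \<otimes> (\<gamma>\<^sub>q \<circ> \<tau>))(\<Omega>)\<close> with \<open>\<Omega> = \<Sum> v\<^sub>i \<otimes> v\<^sub>i\<^sup>*\<close>.\<close>

definition dirac :: "nat \<Rightarrow> (complex vec \<Rightarrow> 'u) \<Rightarrow> (complex vec \<Rightarrow> 'c) \<Rightarrow> complex mat \<Rightarrow>
    (('u \<times> 'c) \<Rightarrow>\<^sub>0 complex)" where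
  "dirac m \<phi> \<gamma> \<tau> = (\<Sum>i<m. mon (\<phi> (unit_vec m i), \<gamma> (\<tau> *\<^sub>v unit_vec m i)))"

definition coord_sum :: "nat \<Rightarrow> (nat \<Rightarrow> nat \<Rightarrow> complex) \<Rightarrow> (nat \<Rightarrow> 'u) \<Rightarrow> (nat \<Rightarrow> 'c) \<Rightarrow>
    (('u \<times> 'c) \<Rightarrow>\<^sub>0 complex)" where
  "coord_sum m \<alpha> Z \<psi> = (\<Sum>i<m. \<Sum>j<m. sc (\<alpha> i j) (mon (Z i, \<psi> j)))"

text \<open>\<open>\<Sum>\<^sub>i\<^sub>j \<alpha>\<^sub>i\<^sub>j (x' \<cdot> Z\<^sub>i) \<otimes> (x'' \<cdot> \<psi>\<^sub>j)\<close> for actions \<open>act1\<close>, \<open>act2\<close>.\<close>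

definition acted_sum :: "nat \<Rightarrow> (nat \<Rightarrow> nat \<Rightarrow> complex) \<Rightarrow> (nat \<Rightarrow> 'u) \<Rightarrow> (nat \<Rightarrow> 'c) \<Rightarrow>
    (qgen falg \<Rightarrow> 'u \<Rightarrow> 'u) \<Rightarrow> (qgen falg \<Rightarrow> 'c \<Rightarrow> 'c) \<Rightarrow> qgen falg \<Rightarrow> (('u \<times> 'c) \<Rightarrow>\<^sub>0 complex)" where
  "acted_sum m \<alpha> Z \<psi> act1 act2 x =
     (\<Sum>i<m. \<Sum>j<m. sc (\<alpha> i j) (\<Sum>p\<in>Poly_Mapping.keys (coprod x).
        sc (Poly_Mapping.lookup (coprod x) p)
          (mon (act1 (mon (fst p)) (Z i), act2 (mon (snd p)) (\<psi> j)))))"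

text \<open>The matrix \<open>\<Sum>\<^sub>i\<^sub>j \<alpha>\<^sub>i\<^sub>j P\<^sub>i \<otimes> Q\<^sub>j\<close> of size \<open>d\<close>.\<close>

definition coord_op :: "nat \<Rightarrow> nat \<Rightarrow> (nat \<Rightarrow> nat \<Rightarrow> complex) \<Rightarrow> (nat \<Rightarrow> complex mat) \<Rightarrow>
    (nat \<Rightarrow> complex mat) \<Rightarrow> complex mat" where
  "coord_op d m \<alpha> P Q = mat d d (\<lambda>rc. \<Sum>i<m. \<Sum>j<m. \<alpha> i j * kron (P i) (Q j) $$ rc)"

end

theory Submission
  imports Defs
begin

text \<open>The coproduct is coassociative already on the free algebra. Hence the action of \<open>U\<^sub>q(g)\<close> on the
  tensor algebra satisfies \<open>x \<triangleright> (a b) = (x' \<triangleright> a) (x'' \<triangleright> b)\<close>, and it preserves the ideal of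
  \<open>cl\<^sub>q(g)\<close> because it preserves the generators: \<open>\<sigma> R\<close> commutes with the action and \<open>B\<^sub>q\<close> is invariant.
  As \<open>\<phi>\<close> and \<open>\<gamma>\<^sub>q\<close> are equivariant and \<open>\<tau> \<rho>(S(x))\<^sup>T = \<rho>(x) \<tau>\<close>, acting with \<open>x\<close> on
  \<open>\<Sum>\<^sub>i \<phi>(v\<^sub>i) \<otimes> \<gamma>\<^sub>q(\<tau> v\<^sub>i\<^sup>*)\<close> amounts to replacing \<open>\<Omega>\<close> by \<open>\<Sum>\<^sub>i \<rho>(x' S(x'')) v\<^sub>i \<otimes> v\<^sub>i\<^sup>*\<close>, which is
  \<open>\<epsilon>(x) \<Omega>\<close>. The action on \<open>U\<^sub>q(g) \<otimes> cl\<^sub>q(g)\<close> respects the bilinearity relations, so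
  it does not matter which coordinates \<open>\<alpha>\<^sub>i\<^sub>j\<close> represent the Dirac operator.

  Since the coproduct is multiplicative, it suffices to prove (2) for generators. There the
  invariance is an identity between products of the operator \<open>D\<close> with
  matrices of \<open>k\<^sub>i\<close>, \<open>e\<^sub>i\<close>, \<open>f\<^sub>i\<close>. For \<open>x = k\<^sub>i\<close> it says that \<open>D\<close> commutes with \<open>k\<^sub>i \<otimes> k\<^sub>i\<close>; given this, for
  \<open>x = e\<^sub>i, f\<^sub>i\<close> the terms with the antipode combine to \<open>D \<triangle>(x)\<close> and the others
  to \<open>\<triangle>(x) D\<close>.\<close>

section \<open>Linear extensions and the coproduct\<close>

text \<open>The Hopf maps are defined on words, and none of them is carried over to the quotient;
  all Sweedler sums run over words. Coassociativity and the counit law use no relation, so they hold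
  there as they stand. The identity \<open>x' S(x'') = \<epsilon>(x)\<close> does rest on relations,
  namely \<open>k k^-1 = 1\<close> and the conjugation of \<open>e\<close>, \<open>f\<close> by
  \<open>k\<close>; it is therefore proved for the matrices of a representation.

  The two factors of the Dirac operator carry different Hopf structures:
  \<open>x'' Z S^op(x')\<close> on the left and \<open>x' \<psi> S(x'')\<close> on the right. For
  \<open>e_i\<close> the antipodes contribute the factors \<open>-c^-1\<close> and \<open>-c\<close>
  with \<open>c = q_i\<close>. Moving \<open>k \<otimes> k\<close> through
  \<open>e \<otimes> k^-1\<close>, and its inverse through \<open>k \<otimes> e\<close>, produces
  \<open>c\<close> and \<open>c^-1\<close>. The constants cancel, and this is why the two opposite
  structures fit together in (2).

  Tensor products are formal sums modulo a subspace, so a map out of them is given by its values on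
  pairs and must be checked to be bilinear, at times only modulo a subspace. Matrices of all sizes
  share one type, so sums of matrices are handled entry by entry.\<close>

lemma lookup_sc [simp]: "Poly_Mapping.lookup (sc c y) w = c * Poly_Mapping.lookup y w"
  unfolding sc_def by (transfer fixing: c) (simp add: when_def)

lemma lookup_mon: "Poly_Mapping.lookup (mon w) v = (if v = w then 1 else 0)"
  by (simp add: mon_def lookup_single when_def)

lemma keys_mon [simp]: "Poly_Mapping.keys (mon w) = {w}"
  by (simp add: mon_def)

lemma keys_sc_subset: "Poly_Mapping.keys (sc c y) \<subseteq> Poly_Mapping.keys y"
  by (auto simp: in_keys_iff)

lemma mon_mult: "mon u * mon v = mon (u + v)"
  by (simp add: mon_def mult_single)

lemma mon_zero: "mon 0 = 1"
  by (simp add: mon_def)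

lemma sc_mon: "sc c (mon p) = Poly_Mapping.single p c"
  by (rule poly_mapping_eqI) (simp add: lookup_mon lookup_single when_def)

lemma sc_eq_single_mult: "sc c x = Poly_Mapping.single 0 c * x"
  unfolding sc_def by (simp flip: mult_map_scale_conv_mult)

lemma sc_mult_left: "sc c x * y = sc c (x * y)"
  by (simp add: sc_eq_single_mult mult.assoc)

text \<open>The linear extension of \<open>h\<close>, and a Sweedler sum when \<open>t\<close> is a
  coproduct. The scalar action is an argument so that one calculus serves formal sums as well as
  complex numbers.\<close>

definition wsum :: "(complex \<Rightarrow> 'z \<Rightarrow> 'z) \<Rightarrow> ('a \<Rightarrow> 'z::comm_monoid_add) \<Rightarrow> ('a \<Rightarrow>\<^sub>0 complex) \<Rightarrow> 'z" where
  "wsum scl h t = (\<Sum>p\<in>Poly_Mapping.keys t. scl (Poly_Mapping.lookup t p) (h p))"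

lemma lin_ext_eq_wsum: "lin_ext = wsum sc"
  by (intro ext) (simp add: lin_ext_def wsum_def)

lemma wsum_cong: "(\<And>p. p \<in> Poly_Mapping.keys t \<Longrightarrow> h p = k p) \<Longrightarrow> wsum scl h t = wsum scl k t"
  by (simp add: wsum_def cong: sum.cong)

lemma poly_mapping_eq_wsum: "wsum sc mon t = t"
proof (rule poly_mapping_eqI)
  fix k
  have "Poly_Mapping.lookup (wsum sc mon t) k =
      (\<Sum>p\<in>Poly_Mapping.keys t. if p = k then Poly_Mapping.lookup t k else 0)"
    unfolding wsum_def lookup_sum by (intro sum.cong refl) (simp add: lookup_mon)
  also have "\<dots> = Poly_Mapping.lookup t k"
    by (simp add: in_keys_iff)
  finally show "Poly_Mapping.lookup (wsum sc mon t) k = Poly_Mapping.lookup t k" .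
qed

text \<open>Scalars are multiples of the monomial of the neutral element, hence central although the
  monoid is not commutative; expanding \<open>x\<close> into monomials makes this visible.\<close>

lemma sc_mult_right: "x * sc c y = sc c (x * y)"
proof -
  have "wsum sc mon x * Poly_Mapping.single 0 c = Poly_Mapping.single 0 c * wsum sc mon x"
    by (simp add: wsum_def sc_mon sum_distrib_left sum_distrib_right mult_single mult.commute)
  then show ?thesis
    by (simp add: poly_mapping_eq_wsum sc_eq_single_mult flip: mult.assoc)
qed

section \<open>Calculus of weighted sums with values in a complex vector space\<close>

locale complex_space = vector_space scale for scale :: "complex \<Rightarrow> 'z::ab_group_add \<Rightarrow> 'z" (infixr \<open>*s\<close> 75)
begin

abbreviation "ws \<equiv> wsum scale"

lemma ws_superset:
  "finite S \<Longrightarrow> Poly_Mapping.keys t \<subseteq> S \<Longrightarrow> ws h t = (\<Sum>p\<in>S. Poly_Mapping.lookup t p *s h p)"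
  unfolding wsum_def by (rule sum.mono_neutral_left) (auto simp: in_keys_iff)

lemma ws_0 [simp]: "ws h 0 = 0"
  by (simp add: wsum_def)

lemma ws_mon [simp]: "ws h (mon p) = h p"
  by (simp add: wsum_def lookup_mon)

lemma ws_one [simp]: "ws h 1 = h 0"
  by (simp flip: mon_zero)

lemma ws_add: "ws h (s + t) = ws h s + ws h t"
proof -
  let ?S = "Poly_Mapping.keys s \<union> Poly_Mapping.keys t"
  have "ws h (s + t) = (\<Sum>p\<in>?S. Poly_Mapping.lookup (s + t) p *s h p)"
    by (rule ws_superset) (use Poly_Mapping.keys_add[of s t] in auto)
  moreover have "ws h s = (\<Sum>p\<in>?S. Poly_Mapping.lookup s p *s h p)"
    "ws h t = (\<Sum>p\<in>?S. Poly_Mapping.lookup t p *s h p)"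
    by (auto intro: ws_superset)
  ultimately show ?thesis
    by (simp add: lookup_add scale_left_distrib sum.distrib)
qed

lemma ws_sc: "ws h (sc c t) = c *s ws h t"
  by (subst ws_superset[OF _ keys_sc_subset]) (auto simp: wsum_def scale_sum_right)

lemma ws_sum: "ws h (sum f I) = (\<Sum>i\<in>I. ws h (f i))"
  by (induction I rule: infinite_finite_induct) (auto simp: ws_add)

lemma ws_uminus: "ws h (- t) = - ws h t"
  using ws_add[of h t "- t"] by (simp add: eq_neg_iff_add_eq_0 add.commute)

lemma ws_diff: "ws h (s - t) = ws h s - ws h t"
  using ws_add[of h s "- t"] by (simp add: ws_uminus)

lemma ws_fun_add: "ws (\<lambda>p. h p + k p) t = ws h t + ws k t"
  by (simp add: wsum_def scale_right_distrib sum.distrib)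

lemma ws_fun_zero [simp]: "ws (\<lambda>p. 0) t = 0"
  by (simp add: wsum_def)

lemma ws_fun_scale: "ws (\<lambda>p. c *s h p) t = c *s ws h t"
  by (simp add: wsum_def scale_sum_right mult.commute)

lemma ws_fun_sum: "ws (\<lambda>p. \<Sum>i\<in>I. h i p) t = (\<Sum>i\<in>I. ws (h i) t)"
  by (induction I rule: infinite_finite_induct) (auto simp: ws_fun_add)

lemma ws_wsum: "ws h (wsum sc f t) = ws (\<lambda>w. ws h (f w)) t"
  by (simp add: wsum_def[of sc] ws_sum ws_sc) (simp add: wsum_def)

lemma ws_swap: "ws (\<lambda>p. ws (\<lambda>q. h p q) t) s = ws (\<lambda>q. ws (\<lambda>p. h p q) s) t"
  unfolding wsum_def scale_sum_right
  by (subst sum.swap) (simp add: mult.commute)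

lemma ws_subspace:
  "subspace S \<Longrightarrow> (\<And>p. p \<in> Poly_Mapping.keys t \<Longrightarrow> h p \<in> S) \<Longrightarrow> ws h t \<in> S"
  unfolding wsum_def by (intro subspace_sum subspace_scale)

end

global_interpretation sc: complex_space "sc :: complex \<Rightarrow> ('b \<Rightarrow>\<^sub>0 complex) \<Rightarrow> _"
  by unfold_locales (auto intro!: poly_mapping_eqI simp: lookup_add algebra_simps)

global_interpretation cx: complex_space "(*) :: complex \<Rightarrow> complex \<Rightarrow> complex"
  by unfold_locales (auto simp: algebra_simps)

declare cx.scale_scale [simp del]

text \<open>Rewrites the convolution product as a double weighted sum. Through
  \<open>ws_mult\<close> it turns every sum over a coproduct of a product into nested sums over the
  coproducts of the factors.\<close>

lemma mult_eq_wsum: "s * t = wsum sc (\<lambda>p. wsum sc (\<lambda>q. mon (p + q)) t) s"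
proof -
  have 1: "mon p * t = wsum sc (\<lambda>q. mon (p + q)) t" for p
  proof -
    have "mon p * t = mon p * wsum sc mon t" by (simp add: poly_mapping_eq_wsum)
    also have "\<dots> = wsum sc (\<lambda>q. mon (p + q)) t"
      by (simp add: wsum_def sum_distrib_left sc_mult_right mon_mult)
    finally show ?thesis .
  qed
  have "s * t = wsum sc mon s * t" by (simp add: poly_mapping_eq_wsum)
  also have "\<dots> = wsum sc (\<lambda>p. mon p * t) s"
    by (simp add: wsum_def sum_distrib_right sc_mult_left)
  finally show ?thesis by (simp add: 1)
qed


lemma (in complex_space) ws_mult: "ws h (s * t) = ws (\<lambda>p. ws (\<lambda>q. h (p + q)) t) s"
  by (subst mult_eq_wsum) (simp add: ws_wsum)

lemma lin_ext_mon [simp]: "lin_ext f (mon w) = f w"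
  by (simp add: lin_ext_eq_wsum)

lemma lin_ext_mult:
  assumes "\<And>u v. f (u + v) = f u * f v"
  shows "lin_ext f (x * y) = lin_ext f x * lin_ext f y"
proof -
  have "lin_ext f (x * y) = wsum sc (\<lambda>p. wsum sc (\<lambda>q. f p * f q) y) x"
    by (simp add: lin_ext_eq_wsum sc.ws_mult assms)
  also have "\<dots> = lin_ext f x * lin_ext f y"
    by (simp add: lin_ext_eq_wsum wsum_def sum_distrib_left sum_distrib_right
        sc_mult_left sc_mult_right mult.commute sc.scale_sum_right)
      (rule sum.swap)
  finally show ?thesis .
qed

section \<open>Words over an alphabet\<close>

lemma zero_fmon: "(0 :: 'a fmon) = Word []" and letters_zero [simp]: "letters (0 :: 'a fmon) = []"
  and letters_add [simp]: "letters (u + v) = letters u @ letters v"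
  by (simp_all add: zero_fmon_def plus_fmon_def)

lemma Word_Cons: "Word (g # w) = Word [g] + Word w"
  by (simp add: plus_fmon_def)

definition words :: "'a set \<Rightarrow> 'a fmon set" where
  "words L = {u. set (letters u) \<subseteq> L}"

lemma words_zero [simp]: "0 \<in> words L"
  and words_add [simp]: "u + v \<in> words L \<longleftrightarrow> u \<in> words L \<and> v \<in> words L"
  and words_letter [simp]: "Word [g] \<in> words L \<longleftrightarrow> g \<in> L"
  and words_UNIV [simp]: "u \<in> words UNIV"
  by (auto simp: words_def)

text \<open>The step adds a letter by the monoid operation instead of \<open>Cons\<close>, because
  coproduct, counit and antipode are computed from sums of words.\<close>

lemma words_induct [consumes 1, case_names zero letter_add]:
  assumes "u \<in> words L" and "P 0"
    and "\<And>g u. g \<in> L \<Longrightarrow> u \<in> words L \<Longrightarrow> P u \<Longrightarrow> P (Word [g] + u)"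
  shows "P u"
proof -
  have "set w \<subseteq> L \<Longrightarrow> P (Word w)" for w
  proof (induction w)
    case Nil
    then show ?case using assms(2) by (simp add: zero_fmon)
  next
    case (Cons g w)
    then show ?case using assms(3)[of g "Word w"] by (simp add: Word_Cons[of g w] words_def)
  qed
  then show ?thesis
    using assms(1) by (cases u) (simp add: words_def)
qed

lemma carrier_free_alg: "x \<in> carrier (free_alg L) \<longleftrightarrow> Poly_Mapping.keys x \<subseteq> words L"
  by (auto simp: free_alg_def words_def)

section \<open>Coproduct and counit on words\<close>

lemma coprod_mult: "coprod (x * y) = coprod x * coprod y"
  unfolding coprod_def by (rule lin_ext_mult) simp

lemma coprod_mon_add: "coprod (mon (u + v)) = coprod (mon u) * coprod (mon v)"
  by (simp add: coprod_mult flip: mon_mult)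

lemma coprod_mon_zero [simp]: "coprod (mon 0) = 1"
  by (simp add: coprod_def)

lemma coprod_mon_letter: "coprod (mon (Word [g])) = coprod_gen g"
  by (simp add: coprod_def)

lemma coprod_eq_wsum: "coprod x = wsum sc (\<lambda>u. coprod (mon u)) x"
  by (simp add: coprod_def lin_ext_eq_wsum)

lemma counit_eq_wsum: "counit = wsum (*) (\<lambda>w. prod_list (map counit_gen (letters w)))"
  by (intro ext) (simp add: counit_def wsum_def)

lemma counit_mon_zero [simp]: "counit (mon 0) = 1"
  and counit_mon_add: "counit (mon (u + v)) = counit (mon u) * counit (mon v)"
  and counit_mon_letter: "counit (mon (Word [g])) = counit_gen g"
  by (simp_all add: counit_eq_wsum)

context complex_space
begin

lemma ws_coprod_letter_add:
  "ws h (coprod (mon (Word [g] + u))) = ws (\<lambda>p. ws (\<lambda>q. h (p + q)) (coprod (mon u))) (coprod_gen g)"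
  by (simp add: coprod_mon_add coprod_mon_letter ws_mult)

text \<open>For \<open>k\<close> and \<open>k^-1\<close> both sides have the single term
  \<open>g \<otimes> g \<otimes> g\<close>; for \<open>g = e, f\<close> both consist of
  \<open>g \<otimes> k \<otimes> k\<close>, \<open>k^-1 \<otimes> g \<otimes> k\<close> and
  \<open>k^-1 \<otimes> k^-1 \<otimes> g\<close>. The function \<open>h\<close> of three words
  replaces a trilinear map and avoids a threefold tensor product.\<close>

lemma coassoc_gen:
  "ws (\<lambda>p. ws (\<lambda>q. h (fst q) (snd q) (snd p)) (coprod (mon (fst p)))) (coprod_gen g) =
   ws (\<lambda>p. ws (\<lambda>q. h (fst p) (fst q) (snd q)) (coprod (mon (snd p)))) (coprod_gen g)"
  by (cases g) (simp_all add: coprod_mon_letter ws_add)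

text \<open>Both iterated coproducts are multiplicative, so the letters decide. The function
  \<open>h\<close> varies in the induction because the hypothesis is applied to \<open>h\<close>
  shifted by the components of the letter.\<close>

lemma coassoc:
  "ws (\<lambda>p. ws (\<lambda>q. h (fst q) (snd q) (snd p)) (coprod (mon (fst p)))) (coprod (mon u)) =
   ws (\<lambda>p. ws (\<lambda>q. h (fst p) (fst q) (snd q)) (coprod (mon (snd p)))) (coprod (mon u))"
proof -
  have "u \<in> words UNIV" by simp
  then show ?thesis
  proof (induction u arbitrary: h rule: words_induct)
    case zero
    then show ?case by simp
  next
    case (letter_add g u)
    let ?\<Delta> = "\<lambda>u. coprod (mon u)"
    have "ws (\<lambda>p. ws (\<lambda>q. h (fst q) (snd q) (snd p)) (?\<Delta> (fst p))) (?\<Delta> (Word [g] + u)) =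
      ws (\<lambda>p. ws (\<lambda>p'. ws (\<lambda>q. ws (\<lambda>q'. h (fst q + fst q') (snd q + snd q') (snd p + snd p'))
        (?\<Delta> (fst p'))) (?\<Delta> (fst p))) (?\<Delta> u)) (coprod_gen g)"
      by (simp add: ws_coprod_letter_add) (simp add: coprod_mon_add ws_mult)
    \<comment> \<open>Exchanging the two middle sums brings the iterated coproduct of
      \<open>u\<close> together as the innermost pair, where the induction hypothesis
      applies.\<close>
    also have "\<dots> = ws (\<lambda>p. ws (\<lambda>q. ws (\<lambda>p'. ws (\<lambda>q'. h (fst q + fst q') (snd q + snd q') (snd p + snd p'))
        (?\<Delta> (fst p'))) (?\<Delta> u)) (?\<Delta> (fst p))) (coprod_gen g)"
      by (subst ws_swap) (rule refl)
    also have "\<dots> = ws (\<lambda>p. ws (\<lambda>q. ws (\<lambda>p'. ws (\<lambda>q'. h (fst q + fst p') (snd q + fst q') (snd p + snd q'))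
        (?\<Delta> (snd p'))) (?\<Delta> u)) (?\<Delta> (fst p))) (coprod_gen g)"
      by (subst letter_add.IH) (rule refl)
    also have "\<dots> = ws (\<lambda>p. ws (\<lambda>q. ws (\<lambda>p'. ws (\<lambda>q'. h (fst p + fst p') (fst q + fst q') (snd q + snd q'))
        (?\<Delta> (snd p'))) (?\<Delta> u)) (?\<Delta> (snd p))) (coprod_gen g)"
      by (rule coassoc_gen)
    also have "\<dots> = ws (\<lambda>p. ws (\<lambda>p'. ws (\<lambda>q. ws (\<lambda>q'. h (fst p + fst p') (fst q + fst q') (snd q + snd q'))
        (?\<Delta> (snd p'))) (?\<Delta> (snd p))) (?\<Delta> u)) (coprod_gen g)"
      by (subst ws_swap) (rule refl)
    also have "\<dots> = ws (\<lambda>p. ws (\<lambda>q. h (fst p) (fst q) (snd q)) (?\<Delta> (snd p))) (?\<Delta> (Word [g] + u))"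
      by (simp add: ws_coprod_letter_add) (simp add: coprod_mon_add ws_mult)
    finally show ?case .
  qed
qed

text \<open>In the coproduct of \<open>e\<close> or \<open>f\<close> the counit kills one summand on
  each side, and the surviving one has \<open>k\<close> or \<open>k^-1\<close> in the slot of the
  counit.\<close>

lemma counit_left: "ws (\<lambda>p. counit (mon (fst p)) *s h (snd p)) (coprod (mon u)) = h u"
  and counit_right: "ws (\<lambda>p. counit (mon (snd p)) *s h (fst p)) (coprod (mon u)) = h u"
proof -
  have "u \<in> words UNIV" by simp
  then have "ws (\<lambda>p. counit (mon (fst p)) *s h (snd p)) (coprod (mon u)) = h u \<and>
    ws (\<lambda>p. counit (mon (snd p)) *s h (fst p)) (coprod (mon u)) = h u"
  proof (induction u arbitrary: h rule: words_induct)
    case zero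
    then show ?case by simp
  next
    case (letter_add g u)
    \<comment> \<open>Here \<open>c\<close> is the counit of one component of the letter and
      \<open>v\<close> is the other component; the hypothesis is used for \<open>h\<close>
      translated by \<open>v\<close>.\<close>
    have "ws (\<lambda>q. (c * counit (mon (fst q))) *s h (v + snd q)) (coprod (mon u)) = c *s h (v + u)"
      "ws (\<lambda>q. (c * counit (mon (snd q))) *s h (v + fst q)) (coprod (mon u)) = c *s h (v + u)" for c v
      unfolding scale_scale[symmetric] ws_fun_scale
      using letter_add.IH[of "\<lambda>w. h (v + w)"] by simp_all
    then show ?case
      by (cases g) (simp_all add: ws_coprod_letter_add counit_mon_add counit_mon_letter ws_add)
  qed
  then show "ws (\<lambda>p. counit (mon (fst p)) *s h (snd p)) (coprod (mon u)) = h u"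
    "ws (\<lambda>p. counit (mon (snd p)) *s h (fst p)) (coprod (mon u)) = h u" by auto
qed

end

text \<open>The relations, and with them all statements about representations, are available only
  for letters of index below the rank; Sweedler components stay among them.\<close>

lemma keys_coprod:
  assumes "u \<in> words (Uq_gens ty)" and "p \<in> Poly_Mapping.keys (coprod (mon u))"
  shows "fst p \<in> words (Uq_gens ty)" and "snd p \<in> words (Uq_gens ty)"
proof -
  have "\<forall>p\<in>Poly_Mapping.keys (coprod (mon u)). fst p \<in> words (Uq_gens ty) \<and> snd p \<in> words (Uq_gens ty)"
    using assms(1)
  proof (induction rule: words_induct)
    case zero
    then show ?case by simp
  next
    case (letter_add g u)
    have "\<forall>p\<in>Poly_Mapping.keys (coprod_gen g). fst p \<in> words (Uq_gens ty) \<and> snd p \<in> words (Uq_gens ty)"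
      using letter_add.hyps(1)
      by (cases g) (auto simp: Uq_gens_def dest!: subsetD[OF Poly_Mapping.keys_add])
    with letter_add.IH show ?case
      by (fastforce simp: coprod_mon_add coprod_mon_letter dest!: subsetD[OF keys_mult])
  qed
  then show "fst p \<in> words (Uq_gens ty)" and "snd p \<in> words (Uq_gens ty)"
    using assms(2) by auto
qed

section \<open>Presented algebras\<close>

text \<open>Scalars are the type of complex numbers rather than a separate ring structure, in line
  with the record type used for the quantum group, its completion and the q-Clifford
  algebra.\<close>

locale complex_algebra = ring A for A (structure) +
  assumes smult_closed [simp, intro]: "x \<in> carrier A \<Longrightarrow> c \<odot>\<^bsub>A\<^esub> x \<in> carrier A"
    and smult_add: "x \<in> carrier A \<Longrightarrow> y \<in> carrier A \<Longrightarrow> c \<odot>\<^bsub>A\<^esub> (x \<oplus>\<^bsub>A\<^esub> y) = c \<odot>\<^bsub>A\<^esub> x \<oplus>\<^bsub>A\<^esub> c \<odot>\<^bsub>A\<^esub> y"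
    and smult_smult: "x \<in> carrier A \<Longrightarrow> c \<odot>\<^bsub>A\<^esub> (d \<odot>\<^bsub>A\<^esub> x) = (c * d :: complex) \<odot>\<^bsub>A\<^esub> x"
    and smult_mult_left: "x \<in> carrier A \<Longrightarrow> y \<in> carrier A \<Longrightarrow> (c \<odot>\<^bsub>A\<^esub> x) \<otimes>\<^bsub>A\<^esub> y = c \<odot>\<^bsub>A\<^esub> (x \<otimes>\<^bsub>A\<^esub> y)"
    and smult_mult_right: "x \<in> carrier A \<Longrightarrow> y \<in> carrier A \<Longrightarrow> x \<otimes>\<^bsub>A\<^esub> (c \<odot>\<^bsub>A\<^esub> y) = c \<odot>\<^bsub>A\<^esub> (x \<otimes>\<^bsub>A\<^esub> y)"
begin

lemma smult_zero: "c \<odot>\<^bsub>A\<^esub> \<zero> = \<zero>"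
  using smult_add[of \<zero> \<zero> c] add.l_cancel_one by simp

lemma finsum_smult:
  "f \<in> I \<rightarrow> carrier A \<Longrightarrow> c \<odot>\<^bsub>A\<^esub> finsum A f I = finsum A (\<lambda>i. c \<odot>\<^bsub>A\<^esub> f i) I"
  by (induction I rule: infinite_finite_induct)
    (auto simp: smult_zero smult_add finsum_insert finsum_infinite Pi_def)

end

section \<open>The free algebra as a ring\<close>

lemma free_alg_sel [simp]:
  "mult (free_alg L) = (*)" "one (free_alg L) = 1" "zero (free_alg L) = 0" "add (free_alg L) = (+)"
  "smult (free_alg L) = sc"
  by (simp_all add: free_alg_def)

lemma free_alg_binary:
  assumes "x \<in> carrier (free_alg L)" "y \<in> carrier (free_alg L)"
  shows "x + y \<in> carrier (free_alg L)" "x * y \<in> carrier (free_alg L)" "x - y \<in> carrier (free_alg L)"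
proof -
  show "x * y \<in> carrier (free_alg L)"
    using assms keys_mult[of x y] unfolding carrier_free_alg by fastforce
qed (use assms Poly_Mapping.keys_add[of x y] keys_diff[of x y] in \<open>auto simp: carrier_free_alg\<close>)

lemma free_alg_unary:
  assumes "x \<in> carrier (free_alg L)"
  shows "- x \<in> carrier (free_alg L)" "sc c x \<in> carrier (free_alg L)"
  using assms keys_sc_subset[of c x] by (auto simp: carrier_free_alg)

lemmas free_alg_closed = free_alg_binary free_alg_unary

lemma free_alg_basic [simp]:
  "0 \<in> carrier (free_alg L)" "1 \<in> carrier (free_alg L)"
  "mon u \<in> carrier (free_alg L) \<longleftrightarrow> u \<in> words L" "lett g \<in> carrier (free_alg L) \<longleftrightarrow> g \<in> L"
  by (auto simp: carrier_free_alg lett_def)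

lemma free_alg_sum:
  "(\<And>i. i \<in> I \<Longrightarrow> f i \<in> carrier (free_alg L)) \<Longrightarrow> sum f I \<in> carrier (free_alg L)"
  by (induction I rule: infinite_finite_induct) (auto intro: free_alg_closed)

lemma free_alg_wsum:
  "(\<And>p. p \<in> Poly_Mapping.keys t \<Longrightarrow> h p \<in> carrier (free_alg L)) \<Longrightarrow> wsum sc h t \<in> carrier (free_alg L)"
  unfolding wsum_def by (intro free_alg_sum free_alg_closed) auto

lemma ring_free_alg: "ring (free_alg L)"
proof (rule ringI)
  show "abelian_group (free_alg L)"
  proof (rule abelian_groupI)
    fix x assume "x \<in> carrier (free_alg L)"
    then show "\<exists>y\<in>carrier (free_alg L). y \<oplus>\<^bsub>free_alg L\<^esub> x = \<zero>\<^bsub>free_alg L\<^esub>"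
      by (intro bexI[of _ "- x"]) (auto intro: free_alg_closed)
  qed (auto intro: free_alg_closed simp: algebra_simps)
  show "Group.monoid (free_alg L)"
    by (rule Group.monoidI) (auto intro: free_alg_closed simp: mult.assoc)
qed (auto intro: free_alg_closed simp: algebra_simps)

section \<open>Quotients by defining relations\<close>

lemma presented_sel:
  "carrier (presented L Rel) = carrier (free_alg L Quot (Idl\<^bsub>free_alg L\<^esub> Rel))"
  "mult (presented L Rel) = mult (free_alg L Quot (Idl\<^bsub>free_alg L\<^esub> Rel))"
  "one (presented L Rel) = one (free_alg L Quot (Idl\<^bsub>free_alg L\<^esub> Rel))"
  "zero (presented L Rel) = zero (free_alg L Quot (Idl\<^bsub>free_alg L\<^esub> Rel))"
  "add (presented L Rel) = add (free_alg L Quot (Idl\<^bsub>free_alg L\<^esub> Rel))"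
  "c \<odot>\<^bsub>presented L Rel\<^esub> X = (\<Union>x\<in>X. cls L Rel (sc c x))"
  by (simp_all add: presented_def ring.defs module.defs)

locale presentation =
  fixes L :: "'a set" and Rel :: "'a falg set"
  assumes rels: "Rel \<subseteq> carrier (free_alg L)"
begin

abbreviation "F \<equiv> free_alg L"
abbreviation "I \<equiv> Idl\<^bsub>F\<^esub> Rel"
abbreviation "P \<equiv> presented L Rel"
abbreviation "cl \<equiv> cls L Rel"

sublocale F: ring F
  by (rule ring_free_alg)

sublocale I: ideal I F
  by (rule F.genideal_ideal) (rule rels)

lemma minus_F: "x \<in> carrier F \<Longrightarrow> y \<in> carrier F \<Longrightarrow> x \<ominus>\<^bsub>F\<^esub> y = x - y"
proof -
  assume "x \<in> carrier F" "y \<in> carrier F"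
  then have "\<ominus>\<^bsub>F\<^esub> y = - y"
    by (intro F.minus_equality) (auto intro: free_alg_closed)
  then show ?thesis by (simp add: a_minus_def)
qed

text \<open>A ring ideal is closed under scalars because \<open>c\<close> is present in the free
  algebra as \<open>sc c 1\<close>.\<close>

lemma I_sc: "x \<in> I \<Longrightarrow> sc a x \<in> I"
  using I.I_l_closed[of x "sc a 1"] by (simp add: sc_mult_left free_alg_closed)

lemma I_subspace: "sc.subspace I"
  using I.zero_closed I.a_closed by (auto intro: sc.subspaceI I_sc)

lemma cls_eq_iff: "x \<in> carrier F \<Longrightarrow> y \<in> carrier F \<Longrightarrow> cl x = cl y \<longleftrightarrow> x - y \<in> I"
  unfolding cls_def
  using F.quotient_eq_iff_same_a_r_cos[OF I.is_ideal, of x y] by (simp add: minus_F)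

lemma cls_carrier [simp]: "x \<in> carrier F \<Longrightarrow> cl x \<in> carrier P"
  using I.rcos_ring_hom by (auto simp: presented_sel cls_def ring_hom_def)

lemma carrier_P: "carrier P = cl ` carrier F"
  by (auto simp: presented_sel FactRing_def A_RCOSETS_def' cls_def)

lemma cls_self: "x \<in> carrier F \<Longrightarrow> x \<in> cl x"
  unfolding cls_def by (rule I.a_rcos_self)

lemma mem_cls: "x \<in> carrier F \<Longrightarrow> y \<in> cl x \<Longrightarrow> y \<in> carrier F \<and> y - x \<in> I"
  unfolding cls_def a_r_coset_def' using I.Icarr by (auto intro: free_alg_closed)

lemma cls_add: "x \<in> carrier F \<Longrightarrow> y \<in> carrier F \<Longrightarrow> cl (x + y) = cl x \<oplus>\<^bsub>P\<^esub> cl y"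
  and cls_mult: "x \<in> carrier F \<Longrightarrow> y \<in> carrier F \<Longrightarrow> cl (x * y) = cl x \<otimes>\<^bsub>P\<^esub> cl y"
  and cls_one: "cl 1 = \<one>\<^bsub>P\<^esub>"
  using I.rcos_ring_hom by (auto simp: presented_sel cls_def ring_hom_def)

text \<open>Operations on classes are defined as unions over representatives; if the result is
  independent of the representative, the union collapses to it.\<close>

lemma UN_cls:
  assumes "x \<in> carrier F" and "\<And>y. y \<in> carrier F \<Longrightarrow> y - x \<in> I \<Longrightarrow> f y = f x"
  shows "(\<Union>y\<in>cl x. f y) = f x"
  using mem_cls[OF assms(1)] assms(2) cls_self[OF assms(1)] by blast

lemma cls_sc: "x \<in> carrier F \<Longrightarrow> cl (sc a x) = a \<odot>\<^bsub>P\<^esub> cl x"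
  unfolding presented_sel
  by (rule UN_cls[symmetric])
    (auto simp: cls_eq_iff free_alg_closed I_sc simp flip: sc.scale_right_diff_distrib)

lemma ring_P: "ring P"
proof -
  interpret Q: ring "F Quot I" by (rule I.quotient_is_ring)
  show ?thesis
  proof (rule ringI)
    show "abelian_group P"
      by (rule abelian_groupI) (auto simp: presented_sel Q.a_assoc Q.a_comm Q.a_lcomm
          intro: Q.add.l_inv_ex)
    show "Group.monoid P"
      by (rule Group.monoidI) (auto simp: presented_sel Q.m_assoc)
  qed (auto simp: presented_sel Q.l_distr Q.r_distr)
qed

sublocale P: complex_algebra P
proof (intro complex_algebra.intro ring_P complex_algebra_axioms.intro, unfold carrier_P)
qed (auto simp: free_alg_closed sc.scale_right_distrib sc_mult_left sc_mult_right
    simp flip: cls_sc cls_add cls_mult)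

end

section \<open>Tensor products\<close>

lemma tensor_null_subspace: "sc.subspace (tensor_null A B)"
  by (auto intro: sc.subspaceI tensor_null.intros)

context complex_space
begin

text \<open>Universal property of the tensor product, with bilinearity demanded only modulo
  \<open>S\<close>. The choice \<open>S = {0}\<close> yields evaluations in the complex numbers;
  taking \<open>S\<close> to be \<open>tensor_null\<close> itself yields maps between tensor
  products.\<close>

lemma ws_tensor_null:
  assumes S: "subspace S"
    and "\<And>a a' b. a \<in> carrier A \<Longrightarrow> a' \<in> carrier A \<Longrightarrow> b \<in> carrier B \<Longrightarrow>
      h (a \<oplus>\<^bsub>A\<^esub> a', b) - h (a, b) - h (a', b) \<in> S"
    and "\<And>a b b'. a \<in> carrier A \<Longrightarrow> b \<in> carrier B \<Longrightarrow> b' \<in> carrier B \<Longrightarrow>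
      h (a, b \<oplus>\<^bsub>B\<^esub> b') - h (a, b) - h (a, b') \<in> S"
    and "\<And>c a b. a \<in> carrier A \<Longrightarrow> b \<in> carrier B \<Longrightarrow> h (c \<odot>\<^bsub>A\<^esub> a, b) - c *s h (a, b) \<in> S"
    and "\<And>c a b. a \<in> carrier A \<Longrightarrow> b \<in> carrier B \<Longrightarrow> h (a, c \<odot>\<^bsub>B\<^esub> b) - c *s h (a, b) \<in> S"
    and "s \<in> tensor_null A B"
  shows "ws h s \<in> S"
  using assms(6)
  by induction (use assms in \<open>auto simp: ws_add ws_diff ws_sc intro: subspace_0 subspace_add subspace_scale\<close>)

text \<open>Meant for \<open>g v = mon (f v, b)\<close>, which is not linear as a map into formal
  sums but is linear modulo the bilinearity relations.\<close>

lemma linear_mod_expand: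
  assumes S: "subspace S"
    and add: "\<And>v w. v \<in> carrier_vec m \<Longrightarrow> w \<in> carrier_vec m \<Longrightarrow> g (v + w) - g v - g w \<in> S"
    and smult: "\<And>c v. v \<in> carrier_vec m \<Longrightarrow> g (c \<cdot>\<^sub>v v) - c *s g v \<in> S"
    and v: "v \<in> carrier_vec m"
  shows "g v - (\<Sum>i<m. v $ i *s g (unit_vec m i)) \<in> S"
proof -
  \<comment> \<open>The truncation of \<open>v\<close> to its first \<open>n\<close> coordinates:
    consecutive truncations differ by one multiple of a unit vector, so each step uses additivity
    once.\<close>
  define t where "t n = vec m (\<lambda>i. if i < n then v $ i else 0)" for n
  have "n \<le> m \<Longrightarrow> g (t n) - (\<Sum>i<n. v $ i *s g (unit_vec m i)) \<in> S" for n
  proof (induction n)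
    case 0
    \<comment> \<open>Homogeneity for the scalar 0 is what puts \<open>g\<close> of the zero vector
      into \<open>S\<close>.\<close>
    have "(0::complex) \<cdot>\<^sub>v t 0 = t 0" by (rule eq_vecI) (auto simp: t_def)
    then show ?case using smult[of "t 0" 0] by (simp add: t_def)
  next
    case (Suc n)
    let ?u = "unit_vec m n :: complex vec"
    have t: "t (Suc n) = t n + v $ n \<cdot>\<^sub>v ?u"
      using Suc.prems by (intro eq_vecI) (auto simp: t_def unit_vec_def less_Suc_eq)
    have "g (t n + v $ n \<cdot>\<^sub>v ?u) - g (t n) - g (v $ n \<cdot>\<^sub>v ?u) \<in> S"
      by (rule add) (auto simp: t_def)
    moreover have "g (v $ n \<cdot>\<^sub>v ?u) - v $ n *s g ?u \<in> S"
      by (rule smult) auto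
    moreover have "g (t n) - (\<Sum>i<n. v $ i *s g (unit_vec m i)) \<in> S"
      using Suc by simp
    ultimately have "(g (t (Suc n)) - g (t n) - g (v $ n \<cdot>\<^sub>v ?u)) + (g (v $ n \<cdot>\<^sub>v ?u) - v $ n *s g ?u)
       + (g (t n) - (\<Sum>i<n. v $ i *s g (unit_vec m i))) \<in> S"
      unfolding t by (intro subspace_add[OF S])
    then show ?case by (simp add: algebra_simps)
  qed
  from this[of m] have "g (t m) - (\<Sum>i<m. v $ i *s g (unit_vec m i)) \<in> S" by simp
  moreover have "t m = v" using v by (intro eq_vecI) (auto simp: t_def)
  ultimately show ?thesis by simp
qed

end

lemma tensor_eq_sym: "tensor_eq A B s t \<Longrightarrow> tensor_eq A B t s"
  unfolding tensor_eq_def using sc.subspace_neg[OF tensor_null_subspace] by fastforce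

lemma tensor_eq_trans [trans]: "tensor_eq A B s t \<Longrightarrow> tensor_eq A B t u \<Longrightarrow> tensor_eq A B s u"
  unfolding tensor_eq_def using tensor_null.add by fastforce

lemma tensor_eq_sc: "tensor_eq A B s t \<Longrightarrow> tensor_eq A B (sc c s) (sc c t)"
  unfolding tensor_eq_def using tensor_null.scale by (fastforce simp flip: sc.scale_right_diff_distrib)

lemma tensor_eq_sum:
  "(\<And>i. i \<in> I \<Longrightarrow> tensor_eq A B (f i) (g i)) \<Longrightarrow> tensor_eq A B (sum f I) (sum g I)"
  unfolding tensor_eq_def sum_subtractf[symmetric] by (rule sc.subspace_sum[OF tensor_null_subspace])

lemma tensor_eq_wsum:
  "(\<And>p. p \<in> Poly_Mapping.keys t \<Longrightarrow> tensor_eq A B (f p) (g p)) \<Longrightarrow>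
     tensor_eq A B (wsum sc f t) (wsum sc g t)"
  unfolding wsum_def by (intro tensor_eq_sum tensor_eq_sc)

lemma (in complex_space) ws_tensor_eq:
  assumes "\<And>a a' b. a \<in> carrier A \<Longrightarrow> a' \<in> carrier A \<Longrightarrow> b \<in> carrier B \<Longrightarrow>
      h (a \<oplus>\<^bsub>A\<^esub> a', b) = h (a, b) + h (a', b)"
    and "\<And>a b b'. a \<in> carrier A \<Longrightarrow> b \<in> carrier B \<Longrightarrow> b' \<in> carrier B \<Longrightarrow>
      h (a, b \<oplus>\<^bsub>B\<^esub> b') = h (a, b) + h (a, b')"
    and "\<And>c a b. a \<in> carrier A \<Longrightarrow> b \<in> carrier B \<Longrightarrow> h (c \<odot>\<^bsub>A\<^esub> a, b) = c *s h (a, b)"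
    and "\<And>c a b. a \<in> carrier A \<Longrightarrow> b \<in> carrier B \<Longrightarrow> h (a, c \<odot>\<^bsub>B\<^esub> b) = c *s h (a, b)"
    and "tensor_eq A B s t"
  shows "ws h s = ws h t"
proof -
  have "ws h (s - t) \<in> {0}"
    by (rule ws_tensor_null[where A = A and B = B and h = h]) (use assms in \<open>auto simp: tensor_eq_def\<close>)
  then show ?thesis by (simp add: ws_diff)
qed

definition linear_into :: "nat \<Rightarrow> (complex, 'a) module \<Rightarrow> (complex vec \<Rightarrow> 'a) \<Rightarrow> bool" where
  "linear_into m A f \<longleftrightarrow> f \<in> carrier_vec m \<rightarrow> carrier A \<and>
     (\<forall>v\<in>carrier_vec m. \<forall>w\<in>carrier_vec m. f (v + w) = f v \<oplus>\<^bsub>A\<^esub> f w) \<and>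
     (\<forall>c. \<forall>v\<in>carrier_vec m. f (c \<cdot>\<^sub>v v) = c \<odot>\<^bsub>A\<^esub> f v)"

lemma tensor_eq_expand:
  assumes f: "linear_into m A f" and g: "linear_into n B g"
    and v: "v \<in> carrier_vec m" and w: "w \<in> carrier_vec n"
  shows "tensor_eq A B (mon (f v, g w))
    (\<Sum>i<m. \<Sum>j<n. sc (v $ i * w $ j) (mon (f (unit_vec m i), g (unit_vec n j))))"
proof -
  have "tensor_eq A B (mon (f v, g w)) (\<Sum>i<m. sc (v $ i) (mon (f (unit_vec m i), g w)))"
    unfolding tensor_eq_def
    by (rule sc.linear_mod_expand[OF tensor_null_subspace _ _ v, where g = "\<lambda>v. mon (f v, g w)"])
      (use f g w in \<open>auto simp: linear_into_def intro!: tensor_null.intros\<close>)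
  also have "tensor_eq A B \<dots>
      (\<Sum>i<m. sc (v $ i) (\<Sum>j<n. sc (w $ j) (mon (f (unit_vec m i), g (unit_vec n j)))))"
  proof (intro tensor_eq_sum tensor_eq_sc)
    fix i assume "i \<in> {..<m}"
    show "tensor_eq A B (mon (f (unit_vec m i), g w))
      (\<Sum>j<n. sc (w $ j) (mon (f (unit_vec m i), g (unit_vec n j))))"
      unfolding tensor_eq_def
      by (rule sc.linear_mod_expand[OF tensor_null_subspace _ _ w,
            where g = "\<lambda>w. mon (f (unit_vec m i), g w)"])
        (use f g in \<open>auto simp: linear_into_def intro!: tensor_null.intros\<close>)
  qed
  finally show ?thesis by (simp add: sc.scale_sum_right)
qed

section \<open>Matrices\<close>

text \<open>Defined entrywise with an explicit size, since a type containing matrices of all sizes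
  has no common zero to start a sum from. The index set is a coproduct support in some uses and the
  set of coordinate pairs in others.\<close>

definition comb_mat :: "nat \<Rightarrow> 'i set \<Rightarrow> ('i \<Rightarrow> complex) \<Rightarrow> ('i \<Rightarrow> complex mat) \<Rightarrow> complex mat" where
  "comb_mat d I c f = mat d d (\<lambda>rc. \<Sum>i\<in>I. c i * f i $$ rc)"

lemma comb_mat_carrier [simp]: "comb_mat d I c f \<in> carrier_mat d d"
  and comb_mat_dim [simp]: "dim_row (comb_mat d I c f) = d" "dim_col (comb_mat d I c f) = d"
  and comb_mat_index [simp]: "r < d \<Longrightarrow> k < d \<Longrightarrow> comb_mat d I c f $$ (r, k) = (\<Sum>i\<in>I. c i * f i $$ (r, k))"
  by (simp_all add: comb_mat_def)

lemma comb_mat_cong: "(\<And>i. i \<in> I \<Longrightarrow> f i = g i) \<Longrightarrow> comb_mat d I c f = comb_mat d I c g"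
  by (simp add: comb_mat_def cong: sum.cong)

lemma mult_mat_index:
  assumes "A \<in> carrier_mat a b" "B \<in> carrier_mat b c" "r < a" "k < c"
  shows "(A * B) $$ (r, k) = (\<Sum>l<b. A $$ (r, l) * B $$ (l, k))"
  using assms by (simp add: scalar_prod_def atLeast0LessThan)

lemma mult_mat_vec_index:
  assumes "A \<in> carrier_mat a b" "v \<in> carrier_vec b" "r < a"
  shows "(A *\<^sub>v v) $ r = (\<Sum>l<b. A $$ (r, l) * v $ l)"
  using assms by (simp add: scalar_prod_def atLeast0LessThan)

lemma mult_comb_mat_left:
  assumes A: "A \<in> carrier_mat d d" and f: "\<And>i. i \<in> I \<Longrightarrow> f i \<in> carrier_mat d d"
  shows "A * comb_mat d I c f = comb_mat d I c (\<lambda>i. A * f i)"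
proof (rule eq_matI)
  fix r k assume "r < dim_row (comb_mat d I c (\<lambda>i. A * f i))" "k < dim_col (comb_mat d I c (\<lambda>i. A * f i))"
  then have rk: "r < d" "k < d" by simp_all
  have "(A * comb_mat d I c f) $$ (r, k) = (\<Sum>l<d. \<Sum>i\<in>I. c i * (A $$ (r, l) * f i $$ (l, k)))"
    by (subst mult_mat_index[OF A comb_mat_carrier rk]) (simp add: rk sum_distrib_left mult_ac)
  also have "\<dots> = (\<Sum>i\<in>I. c i * (A * f i) $$ (r, k))"
    by (subst sum.swap) (auto intro!: sum.cong simp: mult_mat_index[OF A f rk] sum_distrib_left mult_ac
        simp del: index_mult_mat)
  finally show "(A * comb_mat d I c f) $$ (r, k) = comb_mat d I c (\<lambda>i. A * f i) $$ (r, k)"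
    using rk by simp
qed (use A in auto)

lemma mult_comb_mat_right:
  assumes A: "A \<in> carrier_mat d d" and f: "\<And>i. i \<in> I \<Longrightarrow> f i \<in> carrier_mat d d"
  shows "comb_mat d I c f * A = comb_mat d I c (\<lambda>i. f i * A)"
proof (rule eq_matI)
  fix r k assume "r < dim_row (comb_mat d I c (\<lambda>i. f i * A))" "k < dim_col (comb_mat d I c (\<lambda>i. f i * A))"
  then have rk: "r < d" "k < d" by simp_all
  have "(comb_mat d I c f * A) $$ (r, k) = (\<Sum>l<d. \<Sum>i\<in>I. c i * (f i $$ (r, l) * A $$ (l, k)))"
    by (subst mult_mat_index[OF comb_mat_carrier A rk]) (simp add: rk sum_distrib_left sum_distrib_right mult_ac)
  also have "\<dots> = (\<Sum>i\<in>I. c i * (f i * A) $$ (r, k))"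
    by (subst sum.swap) (auto intro!: sum.cong simp: mult_mat_index[OF f A rk] sum_distrib_left mult_ac
        simp del: index_mult_mat)
  finally show "(comb_mat d I c f * A) $$ (r, k) = comb_mat d I c (\<lambda>i. f i * A) $$ (r, k)"
    using rk by simp
qed (use A in auto)

text \<open>The counterpart of \<open>wsum\<close> for matrices; \<open>wsum_mat_index\<close>
  reduces its calculus to complex weighted sums in each entry.\<close>

definition wsum_mat :: "nat \<Rightarrow> ('p \<Rightarrow> complex mat) \<Rightarrow> ('p \<Rightarrow>\<^sub>0 complex) \<Rightarrow> complex mat" where
  "wsum_mat d h t = comb_mat d (Poly_Mapping.keys t) (Poly_Mapping.lookup t) h"

lemma tsum_mat_eq: "tsum_mat d t f = wsum_mat d (\<lambda>p. f (mon (fst p)) (mon (snd p))) t"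
  by (simp add: tsum_mat_def wsum_mat_def comb_mat_def)

lemma wsum_mat_carrier [simp]: "wsum_mat d h t \<in> carrier_mat d d"
  and wsum_mat_dim [simp]: "dim_row (wsum_mat d h t) = d" "dim_col (wsum_mat d h t) = d"
  and wsum_mat_index: "r < d \<Longrightarrow> k < d \<Longrightarrow> wsum_mat d h t $$ (r, k) = wsum (*) (\<lambda>p. h p $$ (r, k)) t"
  by (simp_all add: wsum_mat_def wsum_def)

lemma wsum_mat_cong:
  "(\<And>p. p \<in> Poly_Mapping.keys t \<Longrightarrow> h p = k p) \<Longrightarrow> wsum_mat d h t = wsum_mat d k t"
  unfolding wsum_mat_def by (rule comb_mat_cong)

lemma mult_wsum_mat_left:
  assumes "A \<in> carrier_mat d d" and "\<And>p. p \<in> Poly_Mapping.keys t \<Longrightarrow> h p \<in> carrier_mat d d"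
  shows "A * wsum_mat d h t = wsum_mat d (\<lambda>p. A * h p) t"
  unfolding wsum_mat_def by (rule mult_comb_mat_left[OF assms])

lemma mult_wsum_mat_right:
  assumes "A \<in> carrier_mat d d" and "\<And>p. p \<in> Poly_Mapping.keys t \<Longrightarrow> h p \<in> carrier_mat d d"
  shows "wsum_mat d h t * A = wsum_mat d (\<lambda>p. h p * A) t"
  unfolding wsum_mat_def by (rule mult_comb_mat_right[OF assms])

lemma wsum_mat_mon: "h p \<in> carrier_mat d d \<Longrightarrow> wsum_mat d h (mon p) = h p"
  by (rule eq_matI) (auto simp: wsum_mat_index)

lemma wsum_mat_add: "wsum_mat d h (s + t) = wsum_mat d h s + wsum_mat d h t"
  by (rule eq_matI) (auto simp: wsum_mat_index cx.ws_add)

lemma wsum_mat_mult: "wsum_mat d h (s * t) = wsum_mat d (\<lambda>p. wsum_mat d (\<lambda>q. h (p + q)) t) s"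
  by (rule eq_matI) (auto simp: wsum_mat_index cx.ws_mult)

lemma wsum_mat_wsum: "wsum_mat d h (wsum sc f t) = wsum_mat d (\<lambda>w. wsum_mat d h (f w)) t"
  by (rule eq_matI) (auto simp: wsum_mat_index cx.ws_wsum)

section \<open>Kronecker products and the flip\<close>

lemma sum_div_mod:
  "(\<Sum>k<a * b. f (k div b) (k mod b)) = (\<Sum>i<a. \<Sum>j<b. f i j)" for a b :: nat
proof -
  have "(\<Sum>k<a * b. f (k div b) (k mod b)) = (\<Sum>i<a. \<Sum>k\<in>{i * b..<i * b + b}. f (k div b) (k mod b))"
    by (rule sum.nat_group[symmetric])
  also have "\<dots> = (\<Sum>i<a. \<Sum>j<b. f i j)"
  proof (rule sum.cong[OF refl])
    fix i
    show "(\<Sum>k\<in>{i * b..<i * b + b}. f (k div b) (k mod b)) = (\<Sum>j<b. f i j)"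
    proof (rule sum.reindex_bij_witness[of _ "\<lambda>j. i * b + j" "\<lambda>k. k - i * b"])
      fix k assume k: "k \<in> {i * b..<i * b + b}"
      then have "k div b = i" by (intro div_nat_eqI) (auto simp: algebra_simps)
      then show "f i (k - i * b) = f (k div b) (k mod b)"
        by (simp add: minus_div_mult_eq_mod[symmetric])
    qed auto
  qed
  finally show ?thesis .
qed

lemma div_less_mult: "r < a * b \<Longrightarrow> r div b < a" "r < a * b \<Longrightarrow> r mod b < b" for a b :: nat
  by (auto simp: less_mult_imp_div_less) (metis mod_less_divisor mult_0_right not_gr_zero not_less_zero)

lemma kron_carrier [simp]:
  "S \<in> carrier_mat a a' \<Longrightarrow> T \<in> carrier_mat b b' \<Longrightarrow> kron S T \<in> carrier_mat (a * b) (a' * b')"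
  by (auto simp: kron_def)

lemma kron_index:
  "S \<in> carrier_mat a a' \<Longrightarrow> T \<in> carrier_mat b b' \<Longrightarrow> r < a * b \<Longrightarrow> k < a' * b' \<Longrightarrow>
     kron S T $$ (r, k) = S $$ (r div b, k div b') * T $$ (r mod b, k mod b')"
  by (auto simp: kron_def)

lemma kron_mult:
  assumes S: "S \<in> carrier_mat a a" "S' \<in> carrier_mat a a" and T: "T \<in> carrier_mat b b" "T' \<in> carrier_mat b b"
  shows "kron S T * kron S' T' = kron (S * S') (T * T')"
proof (rule eq_matI)
  fix r k assume "r < dim_row (kron (S * S') (T * T'))" "k < dim_col (kron (S * S') (T * T'))"
  then have rk: "r < a * b" "k < a * b" using S T by (auto simp: kron_def)
  note rk' = div_less_mult[OF rk(1)] div_less_mult[OF rk(2)]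
  have "(kron S T * kron S' T') $$ (r, k) = (\<Sum>l<a * b.
      (S $$ (r div b, l div b) * T $$ (r mod b, l mod b)) * (S' $$ (l div b, k div b) * T' $$ (l mod b, k mod b)))"
    by (subst mult_mat_index[OF kron_carrier[OF S(1) T(1)] kron_carrier[OF S(2) T(2)] rk])
      (simp add: kron_index[OF S(1) T(1)] kron_index[OF S(2) T(2)] rk)
  also have "\<dots> = (\<Sum>i<a. \<Sum>j<b.
      (S $$ (r div b, i) * T $$ (r mod b, j)) * (S' $$ (i, k div b) * T' $$ (j, k mod b)))"
    by (rule sum_div_mod)
  also have "\<dots> = (S * S') $$ (r div b, k div b) * (T * T') $$ (r mod b, k mod b)"
    by (subst mult_mat_index[OF S rk'(1,3)], subst mult_mat_index[OF T rk'(2,4)])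
      (simp add: sum_product mult_ac)
  also have "\<dots> = kron (S * S') (T * T') $$ (r, k)"
    by (rule kron_index[symmetric]) (use S T rk in auto)
  finally show "(kron S T * kron S' T') $$ (r, k) = kron (S * S') (T * T') $$ (r, k)" .
qed (use S T in \<open>auto simp: kron_def\<close>)

lemma kron_flip:
  assumes S: "S \<in> carrier_mat m m" and T: "T \<in> carrier_mat m m"
  shows "flip_mat m m * kron S T = kron T S * flip_mat m m"
proof (rule eq_matI)
  have F: "flip_mat m m \<in> carrier_mat (m * m) (m * m)" by (simp add: flip_mat_def)
  fix r k assume "r < dim_row (kron T S * flip_mat m m)" "k < dim_col (kron T S * flip_mat m m)"
  then have rk: "r < m * m" "k < m * m" using S T by (auto simp: kron_def flip_mat_def)
  note rk' = div_less_mult[OF rk(1)] div_less_mult[OF rk(2)]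
  have "(flip_mat m m * kron S T) $$ (r, k) = (\<Sum>l<m * m.
      (if r div m = l mod m \<and> r mod m = l div m then 1 else 0) *
      (S $$ (l div m, k div m) * T $$ (l mod m, k mod m)))"
    by (subst mult_mat_index[OF F kron_carrier[OF S T] rk])
      (simp add: kron_index[OF S T] rk flip_mat_def)
  also have "\<dots> = (\<Sum>i<m. \<Sum>j<m. (if r div m = j \<and> r mod m = i then 1 else 0) *
      (S $$ (i, k div m) * T $$ (j, k mod m)))"
    by (rule sum_div_mod)
  also have "\<dots> = (\<Sum>i<m. \<Sum>j<m. if r mod m = i then if r div m = j then
      S $$ (i, k div m) * T $$ (j, k mod m) else 0 else 0)"
    by (intro sum.cong refl) simp
  also have "\<dots> = (\<Sum>i<m. if r mod m = i then (\<Sum>j<m. if r div m = j then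
      S $$ (i, k div m) * T $$ (j, k mod m) else 0) else 0)"
    by (intro sum.cong refl) (simp del: sum.delta sum.delta')
  also have "\<dots> = T $$ (r div m, k mod m) * S $$ (r mod m, k div m)"
    using rk' by (simp add: mult.commute)
  finally have 1: "(flip_mat m m * kron S T) $$ (r, k) = T $$ (r div m, k mod m) * S $$ (r mod m, k div m)" .
  have "(kron T S * flip_mat m m) $$ (r, k) = (\<Sum>l<m * m.
      (T $$ (r div m, l div m) * S $$ (r mod m, l mod m)) *
      (if l div m = k mod m \<and> l mod m = k div m then 1 else 0))"
    by (subst mult_mat_index[OF kron_carrier[OF T S] F rk])
      (simp add: kron_index[OF T S] rk flip_mat_def)
  also have "\<dots> = (\<Sum>i<m. \<Sum>j<m. (T $$ (r div m, i) * S $$ (r mod m, j)) *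
      (if i = k mod m \<and> j = k div m then 1 else 0))"
    by (rule sum_div_mod)
  also have "\<dots> = (\<Sum>i<m. \<Sum>j<m. if i = k mod m then if j = k div m then
      T $$ (r div m, i) * S $$ (r mod m, j) else 0 else 0)"
    by (intro sum.cong refl) simp
  also have "\<dots> = (\<Sum>i<m. if i = k mod m then (\<Sum>j<m. if j = k div m then
      T $$ (r div m, i) * S $$ (r mod m, j) else 0) else 0)"
    by (intro sum.cong refl) (simp del: sum.delta sum.delta')
  also have "\<dots> = T $$ (r div m, k mod m) * S $$ (r mod m, k div m)"
    using rk' by simp
  finally show "(flip_mat m m * kron S T) $$ (r, k) = (kron T S * flip_mat m m) $$ (r, k)"
    using 1 by simp
qed (use S T in \<open>auto simp: kron_def flip_mat_def\<close>)

section \<open>The action on the q-Clifford algebra\<close>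

lemma mult_wsum_left: "a * wsum sc h t = wsum sc (\<lambda>p. a * h p) t"
  by (simp add: wsum_def sum_distrib_left sc_mult_right)

lemma mult_wsum_right: "wsum sc h t * a = wsum sc (\<lambda>p. h p * a) t"
  by (simp add: wsum_def sum_distrib_right sc_mult_left)

lemma (in complex_space) ws_scale_left: "ws (\<lambda>p. f p *s x) t = wsum (*) f t *s x"
  by (simp add: wsum_def scale_sum_left)

definition tens_act :: "(qgen falg \<Rightarrow> complex mat) \<Rightarrow> nat \<Rightarrow> qgen falg \<Rightarrow> nat falg \<Rightarrow> nat falg" where
  "tens_act r m x = lin_ext (\<lambda>w. word_act r m (letters w) x)"

definition letter_sum :: "nat \<Rightarrow> (nat \<Rightarrow> complex) \<Rightarrow> nat falg" where
  "letter_sum m c = (\<Sum>k<m. sc (c k) (lett k))"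

lemma word_act_Cons:
  "word_act r m (j # w) x = wsum sc (\<lambda>p. letter_sum m (\<lambda>k. r (mon (fst p)) $$ (k, j)) *
     word_act r m w (mon (snd p))) (coprod x)"
  by (simp add: wsum_def letter_sum_def)

declare word_act.simps(2) [simp del]

text \<open>The action on a word peels off one letter at a time, so its Sweedler components are
  bracketed to the right; coassociativity regroups them into those of \<open>w\<close> and
  \<open>w'\<close>.\<close>

lemma word_act_append:
  "word_act r m (w @ w') (mon u) =
     wsum sc (\<lambda>p. word_act r m w (mon (fst p)) * word_act r m w' (mon (snd p))) (coprod (mon u))"
proof (induction w arbitrary: u)
  case Nil
  then show ?case by (simp add: sc_mult_left sc.counit_left[of "\<lambda>v. word_act r m w' (mon v)"])
next
  case (Cons j w)
  let ?l = "\<lambda>p. letter_sum m (\<lambda>k. r (mon p) $$ (k, j))"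
  have "word_act r m ((j # w) @ w') (mon u) =
    wsum sc (\<lambda>p. wsum sc (\<lambda>q. ?l (fst p) * word_act r m w (mon (fst q)) * word_act r m w' (mon (snd q)))
      (coprod (mon (snd p)))) (coprod (mon u))"
    by (simp add: word_act_Cons Cons.IH mult_wsum_left mult.assoc)
  also have "\<dots> = wsum sc (\<lambda>p. wsum sc (\<lambda>q. ?l (fst q) * word_act r m w (mon (snd q)) *
      word_act r m w' (mon (snd p))) (coprod (mon (fst p)))) (coprod (mon u))"
    by (rule sc.coassoc[symmetric])
  finally show ?case
    by (simp add: word_act_Cons mult_wsum_right)
qed

lemma tens_act_add: "tens_act r m x (a + b) = tens_act r m x a + tens_act r m x b"
  and tens_act_diff: "tens_act r m x (a - b) = tens_act r m x a - tens_act r m x b"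
  and tens_act_sc: "tens_act r m x (sc c a) = sc c (tens_act r m x a)"
  and tens_act_sum: "tens_act r m x (sum f I) = (\<Sum>i\<in>I. tens_act r m x (f i))"
  by (simp_all add: tens_act_def lin_ext_eq_wsum sc.ws_add sc.ws_diff sc.ws_sc sc.ws_sum)

lemma tens_act_one: "tens_act r m x 1 = sc (counit x) 1"
  by (simp add: tens_act_def lin_ext_eq_wsum)

text \<open>Linear extension of \<open>word_act_append\<close> in both factors. The exchanges of
  sums carry the sum over the coproduct from the innermost place to the outermost.\<close>

lemma tens_act_mult:
  "tens_act r m (mon u) (a * b) =
     wsum sc (\<lambda>p. tens_act r m (mon (fst p)) a * tens_act r m (mon (snd p)) b) (coprod (mon u))"
proof -
  let ?W = "\<lambda>w p. word_act r m (letters w) (mon p)"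
  have "tens_act r m (mon u) (a * b) =
      wsum sc (\<lambda>v. wsum sc (\<lambda>w. wsum sc (\<lambda>p. ?W v (fst p) * ?W w (snd p)) (coprod (mon u))) b) a"
    by (simp add: tens_act_def lin_ext_eq_wsum sc.ws_mult word_act_append)
  also have "\<dots> = wsum sc (\<lambda>w. wsum sc (\<lambda>v. wsum sc (\<lambda>p. ?W v (fst p) * ?W w (snd p)) (coprod (mon u))) a) b"
    by (rule sc.ws_swap)
  also have "\<dots> = wsum sc (\<lambda>w. wsum sc (\<lambda>p. wsum sc (\<lambda>v. ?W v (fst p) * ?W w (snd p)) a) (coprod (mon u))) b"
    by (rule wsum_cong, rule sc.ws_swap)
  also have "\<dots> = wsum sc (\<lambda>p. wsum sc (\<lambda>w. wsum sc (\<lambda>v. ?W v (fst p) * ?W w (snd p)) a) b) (coprod (mon u))"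
    by (rule sc.ws_swap)
  finally show ?thesis
    by (simp add: tens_act_def lin_ext_eq_wsum mult_wsum_left mult_wsum_right)
qed

text \<open>By its recursion the action on a one-letter word is \<open>x' v_j\<close> times the
  counit of \<open>x''\<close>; the counit law absorbs the second component.\<close>

lemma tens_act_lett:
  "tens_act r m (mon u) (lett j) = letter_sum m (\<lambda>k. r (mon u) $$ (k, j))"
  by (simp add: tens_act_def lett_def word_act_Cons sc_mult_right
      sc.counit_right[of "\<lambda>v. letter_sum m (\<lambda>k. r (mon v) $$ (k, j))"])

lemma letter_sum_closed [simp]: "letter_sum m c \<in> carrier (free_alg {..<m})"
  unfolding letter_sum_def by (intro free_alg_sum free_alg_closed) auto

lemma tens_act_closed:
  assumes "y \<in> carrier (free_alg {..<m})"
  shows "tens_act r m x y \<in> carrier (free_alg {..<m})"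
proof -
  have "word_act r m w x \<in> carrier (free_alg {..<m})" for w
    by (induction w arbitrary: x) (auto simp: word_act_Cons intro!: free_alg_wsum free_alg_closed)
  then show ?thesis
    by (simp add: tens_act_def lin_ext_eq_wsum free_alg_wsum)
qed

section \<open>The quadratic relations and their invariance\<close>

definition quad_elem :: "nat \<Rightarrow> complex vec \<Rightarrow> nat falg" where
  "quad_elem m t = (\<Sum>c<m * m. sc (t $ c) (lett (c div m) * lett (c mod m)))"

definition quad_form :: "nat \<Rightarrow> complex mat \<Rightarrow> complex vec \<Rightarrow> complex" where
  "quad_form m B t = (\<Sum>c<m * m. B $$ (c div m, c mod m) * t $ c)"

text \<open>A single index running below \<open>m * m\<close> instead of two indices makes
  \<open>t\<close> an ordinary vector, on which the matrix of the action on
  \<open>V \<otimes> V\<close> operates.\<close>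

lemma clq_rels_eq:
  "clq_rels m Rc B = {quad_elem m t - sc (quad_form m B t) 1
      | t. t \<in> carrier_vec (m * m) \<and> (\<exists>c::real. c > 0 \<and> Rc *\<^sub>v t = complex_of_real c \<cdot>\<^sub>v t)}"
proof -
  have "quad_elem m t = (\<Sum>i<m. \<Sum>j<m. sc (t $ (i * m + j)) (lett i * lett j))" for t
    using sum_div_mod[of "\<lambda>i j. sc (t $ (i * m + j)) (lett i * lett j)" m m] by (simp add: quad_elem_def)
  moreover have "quad_form m B t = (\<Sum>i<m. \<Sum>j<m. B $$ (i, j) * t $ (i * m + j))" for t
    using sum_div_mod[of "\<lambda>i j. B $$ (i, j) * t $ (i * m + j)" m m] by (simp add: quad_form_def)
  ultimately show ?thesis by (simp add: clq_rels_def)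
qed

text \<open>\<open>G\<close> stands for a set of words closed under Sweedler components on which
  \<open>r\<close> takes matrices of size \<open>m\<close>; the instance below is the set of words
  in the generators.\<close>

locale clq_invariant =
  fixes m :: nat and G :: "qgen fmon set" and r :: "qgen falg \<Rightarrow> complex mat" and Rc B :: "complex mat"
  assumes G_coprod: "u \<in> G \<Longrightarrow> p \<in> Poly_Mapping.keys (coprod (mon u)) \<Longrightarrow> fst p \<in> G \<and> snd p \<in> G"
    and r_carrier: "u \<in> G \<Longrightarrow> r (mon u) \<in> carrier_mat m m"
    and Rc_carrier: "Rc \<in> carrier_mat (m * m) (m * m)"
    and B_carrier: "B \<in> carrier_mat m m"
    and Rc_commute: "u \<in> G \<Longrightarrow>
      Rc * tsum_mat (m * m) (coprod (mon u)) (\<lambda>a b. kron (r a) (r b)) =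
      tsum_mat (m * m) (coprod (mon u)) (\<lambda>a b. kron (r a) (r b)) * Rc"
    and B_invariant: "u \<in> G \<Longrightarrow>
      tsum_mat m (coprod (mon u)) (\<lambda>a b. transpose_mat (r a) * B * r b) = counit (mon u) \<cdot>\<^sub>m B"
begin

definition T2 :: "qgen fmon \<Rightarrow> complex mat" where
  "T2 u = tsum_mat (m * m) (coprod (mon u)) (\<lambda>a b. kron (r a) (r b))"

lemma T2_carrier [simp]: "T2 u \<in> carrier_mat (m * m) (m * m)"
  by (simp add: T2_def tsum_mat_eq)

lemma T2_index:
  assumes "u \<in> G" "e < m * m" "c < m * m"
  shows "T2 u $$ (e, c) = wsum (*) (\<lambda>p. r (mon (fst p)) $$ (e div m, c div m) *
    r (mon (snd p)) $$ (e mod m, c mod m)) (coprod (mon u))"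
  unfolding T2_def tsum_mat_eq wsum_mat_index[OF assms(2,3)]
  using G_coprod[OF assms(1)] r_carrier by (intro wsum_cong kron_index[OF _ _ assms(2,3)]) auto

lemma letter_sum_mult:
  "letter_sum m f * letter_sum m g =
    (\<Sum>e<m * m. sc (f (e div m) * g (e mod m)) (lett (e div m) * lett (e mod m)))"
  unfolding sum_div_mod[of "\<lambda>i j. sc (f i * g j) (lett i * lett j)"]
  by (simp add: letter_sum_def sum_product sc_mult_left sc_mult_right mult.commute)

lemma tens_act_quad_elem:
  assumes u: "u \<in> G" and t: "t \<in> carrier_vec (m * m)"
  shows "tens_act r m (mon u) (quad_elem m t) = quad_elem m (T2 u *\<^sub>v t)"
proof -
  let ?L = "\<lambda>c. lett (c div m) * lett (c mod m)"
  have L: "tens_act r m (mon u) (?L c) = (\<Sum>e<m * m. sc (T2 u $$ (e, c)) (?L e))" if "c < m * m" for c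
    using that by (simp add: tens_act_mult tens_act_lett letter_sum_mult sc.ws_fun_sum sc.ws_scale_left T2_index[OF u])
  have "tens_act r m (mon u) (quad_elem m t) = (\<Sum>c<m * m. \<Sum>e<m * m. sc (T2 u $$ (e, c) * t $ c) (?L e))"
    by (simp add: quad_elem_def tens_act_sum tens_act_sc L sc.scale_sum_right mult.commute)
  also have "\<dots> = (\<Sum>e<m * m. sc (\<Sum>c<m * m. T2 u $$ (e, c) * t $ c) (?L e))"
    by (subst sum.swap) (simp add: sc.scale_sum_left)
  also have "\<dots> = quad_elem m (T2 u *\<^sub>v t)"
    unfolding quad_elem_def by (intro sum.cong refl) (simp add: mult_mat_vec_index[OF T2_carrier t] del: index_mult_mat_vec)
  finally show ?thesis .
qed

lemma quad_form_T2:
  assumes u: "u \<in> G" and t: "t \<in> carrier_vec (m * m)"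
  shows "quad_form m B (T2 u *\<^sub>v t) = counit (mon u) * quad_form m B t"
proof -
  let ?b = "\<lambda>c. B $$ (c div m, c mod m)"
  \<comment> \<open>The invariance of the form on the basis tensor with index \<open>c\<close>: row
    and column of the matrix identity \<open>B_invariant\<close> are the two tensor indices packed
    into \<open>c\<close>.\<close>
  have col: "(\<Sum>e<m * m. ?b e * T2 u $$ (e, c)) = counit (mon u) * ?b c" if c: "c < m * m" for c
  proof -
    note c' = div_less_mult[OF c]
    have "(\<Sum>e<m * m. ?b e * T2 u $$ (e, c)) = wsum (*) (\<lambda>p. \<Sum>e<m * m. ?b e *
        (r (mon (fst p)) $$ (e div m, c div m) * r (mon (snd p)) $$ (e mod m, c mod m))) (coprod (mon u))"
      by (simp add: T2_index[OF u _ c] cx.ws_fun_sum cx.ws_fun_scale)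
    also have "\<dots> = wsum (*) (\<lambda>p. (transpose_mat (r (mon (fst p))) * B * r (mon (snd p))) $$ (c div m, c mod m))
        (coprod (mon u))"
    proof (rule wsum_cong)
      fix p assume "p \<in> Poly_Mapping.keys (coprod (mon u))"
      then have R: "r (mon (fst p)) \<in> carrier_mat m m" "r (mon (snd p)) \<in> carrier_mat m m"
        using u G_coprod r_carrier by auto
      let ?R = "r (mon (fst p))" and ?R' = "r (mon (snd p))"
      have "(\<Sum>e<m * m. ?b e * (?R $$ (e div m, c div m) * ?R' $$ (e mod m, c mod m))) =
          (\<Sum>k<m. \<Sum>l<m. B $$ (k, l) * (?R $$ (k, c div m) * ?R' $$ (l, c mod m)))"
        by (rule sum_div_mod)
      also have "\<dots> = (\<Sum>l<m. (\<Sum>k<m. ?R $$ (k, c div m) * B $$ (k, l)) * ?R' $$ (l, c mod m))"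
        by (subst sum.swap) (simp add: sum_distrib_left sum_distrib_right mult_ac)
      also have "\<dots> = (transpose_mat ?R * B * ?R') $$ (c div m, c mod m)"
        by (subst mult_mat_index[OF _ R(2) c'], use R B_carrier in simp,
            intro sum.cong refl, subst mult_mat_index[OF _ B_carrier c'(1)])
          (use R c' in auto)
      finally show "(\<Sum>e<m * m. ?b e * (?R $$ (e div m, c div m) * ?R' $$ (e mod m, c mod m))) =
        (transpose_mat ?R * B * ?R') $$ (c div m, c mod m)" .
    qed
    also have "\<dots> = tsum_mat m (coprod (mon u)) (\<lambda>a b. transpose_mat (r a) * B * r b) $$ (c div m, c mod m)"
      by (simp add: tsum_mat_eq wsum_mat_index[OF c'])
    also have "\<dots> = counit (mon u) * ?b c"
      using B_carrier c' by (simp add: B_invariant[OF u])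
    finally show ?thesis .
  qed
  have "quad_form m B (T2 u *\<^sub>v t) = (\<Sum>e<m * m. \<Sum>c<m * m. (?b e * T2 u $$ (e, c)) * t $ c)"
    by (simp add: quad_form_def mult_mat_vec_index[OF T2_carrier t] sum_distrib_left mult_ac
        del: index_mult_mat_vec)
  also have "\<dots> = (\<Sum>c<m * m. (\<Sum>e<m * m. ?b e * T2 u $$ (e, c)) * t $ c)"
    by (subst sum.swap) (simp add: sum_distrib_right)
  also have "\<dots> = counit (mon u) * quad_form m B t"
    by (simp add: col quad_form_def) (simp add: sum_distrib_left mult.assoc)
  finally show ?thesis .
qed

sublocale presentation "{..<m}" "clq_rels m Rc B"
proof
  have "quad_elem m t \<in> carrier (free_alg {..<m})" for t
    unfolding quad_elem_def by (intro free_alg_sum free_alg_closed) (auto dest: div_less_mult)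
  then show "clq_rels m Rc B \<subseteq> carrier (free_alg {..<m})"
    by (auto simp: clq_rels_eq intro!: free_alg_closed)
qed

text \<open>As \<open>Rc\<close> commutes with the action, it has the same positive eigenvalue on
  the moved tensor; invariance of the form adjusts the constant term. So a generator of the ideal is
  sent to a generator, possibly the one belonging to the zero vector.\<close>

lemma tens_act_rel:
  assumes u: "u \<in> G" and y: "y \<in> clq_rels m Rc B"
  shows "tens_act r m (mon u) y \<in> clq_rels m Rc B"
proof -
  obtain t and a :: real where t: "t \<in> carrier_vec (m * m)" and a: "a > 0" "Rc *\<^sub>v t = complex_of_real a \<cdot>\<^sub>v t"
    and y: "y = quad_elem m t - sc (quad_form m B t) 1"
    using y by (auto simp: clq_rels_eq)
  have "Rc *\<^sub>v (T2 u *\<^sub>v t) = (T2 u * Rc) *\<^sub>v t"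
    using Rc_commute[OF u] by (simp only: T2_def[symmetric] assoc_mult_mat_vec[OF Rc_carrier T2_carrier t, symmetric])
  also have "\<dots> = complex_of_real a \<cdot>\<^sub>v (T2 u *\<^sub>v t)"
    using a t by (simp add: assoc_mult_mat_vec[OF T2_carrier Rc_carrier t] mult_mat_vec[OF T2_carrier])
  finally have "Rc *\<^sub>v (T2 u *\<^sub>v t) = complex_of_real a \<cdot>\<^sub>v (T2 u *\<^sub>v t)" .
  moreover have "tens_act r m (mon u) y =
      quad_elem m (T2 u *\<^sub>v t) - sc (quad_form m B (T2 u *\<^sub>v t)) 1"
    by (simp add: y tens_act_diff tens_act_sc tens_act_one tens_act_quad_elem[OF u t]
        quad_form_T2[OF u t] mult.commute)
  moreover have "T2 u *\<^sub>v t \<in> carrier_vec (m * m)"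
    by (rule mult_mat_vec_carrier[OF T2_carrier t])
  ultimately show ?thesis
    using a(1) unfolding clq_rels_eq by blast
qed

lemma tens_act_ideal:
  assumes "u \<in> G" and "y \<in> I"
  shows "tens_act r m (mon u) y \<in> I"
proof -
  \<comment> \<open>All words of \<open>G\<close> have to be treated at once: the action of one word
    on a product \<open>x * a\<close> lets its Sweedler components, which are other words, act on
    \<open>a\<close>.\<close>
  define J where "J = {y \<in> I. \<forall>u\<in>G. tens_act r m (mon u) y \<in> I}"
  have "ideal J F"
  proof (rule idealI[OF F.ring_axioms])
    show "subgroup J (add_monoid F)"
    proof (rule F.add.subgroupI)
      show "J \<noteq> {}"
        using I.zero_closed sc.ws_0 by (auto simp: J_def tens_act_def lin_ext_eq_wsum)
    next
      fix y assume "y \<in> J"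
      moreover have "\<ominus>\<^bsub>F\<^esub> y = sc (-1) y" if "y \<in> carrier F"
        using minus_F[of 0 y] that F.minus_closed[of 0 y] by (simp add: a_minus_def)
      ultimately show "\<ominus>\<^bsub>F\<^esub> y \<in> J"
        using I.Icarr by (auto simp: J_def tens_act_sc intro: I_sc simp del: sc.scale_minus_left)
    next
      fix x y assume "x \<in> J" "y \<in> J"
      then show "x \<oplus>\<^bsub>F\<^esub> y \<in> J"
        using I.a_closed by (auto simp: J_def tens_act_add)
    qed (use I.Icarr in \<open>auto simp: J_def\<close>)
  next
    fix a x assume a: "a \<in> J" and x: "x \<in> carrier F"
    have "tens_act r m (mon u) (x * a) \<in> I" "tens_act r m (mon u) (a * x) \<in> I" if "u \<in> G" for u
      unfolding tens_act_mult
      by (rule sc.ws_subspace[OF I_subspace];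
          use a x G_coprod[OF that] I.I_l_closed I.I_r_closed tens_act_closed in \<open>auto simp: J_def\<close>)+
    then show "x \<otimes>\<^bsub>F\<^esub> a \<in> J" "a \<otimes>\<^bsub>F\<^esub> x \<in> J"
      using a x I.I_l_closed I.I_r_closed by (auto simp: J_def)
  qed
  moreover have "clq_rels m Rc B \<subseteq> J"
    using F.genideal_self[OF rels] tens_act_rel by (auto simp: J_def)
  ultimately have "I \<subseteq> J" by (rule F.genideal_minimal)
  with assms show ?thesis by (auto simp: J_def)
qed

lemma UN_tens_act:
  assumes u: "u \<in> G" and y: "y \<in> carrier F"
  shows "(\<Union>y\<in>cl y. cl (tens_act r m (mon u) y)) = cl (tens_act r m (mon u) y)"
proof (rule UN_cls[OF y])
  fix z assume "z \<in> carrier F" "z - y \<in> I"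
  then show "cl (tens_act r m (mon u) z) = cl (tens_act r m (mon u) y)"
    using tens_act_ideal[OF u, of "z - y"] y by (simp add: cls_eq_iff tens_act_closed tens_act_diff)
qed

end

section \<open>Representations and the antipode\<close>

lemma free_alg_power:
  "x \<in> carrier (free_alg L) \<Longrightarrow> x ^ n \<in> carrier (free_alg L)"
  by (induction n) (auto intro: free_alg_closed)

lemma Uq_gens_mem [simp]:
  "Gk i \<in> Uq_gens ty \<longleftrightarrow> i < rank ty" "Gki i \<in> Uq_gens ty \<longleftrightarrow> i < rank ty"
  "Ge i \<in> Uq_gens ty \<longleftrightarrow> i < rank ty" "Gf i \<in> Uq_gens ty \<longleftrightarrow> i < rank ty"
  by (auto simp: Uq_gens_def)

lemma serre_closed:
  "G i \<in> L \<Longrightarrow> G j \<in> L \<Longrightarrow> serre ty q G i j \<in> carrier (free_alg L)"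
  unfolding serre_def Let_def by (intro free_alg_sum free_alg_closed free_alg_power) auto

lemma presentation_Uq: "presentation (Uq_gens ty) (Uq_rels ty q)"
proof
  show "Uq_rels ty q \<subseteq> carrier (free_alg (Uq_gens ty))"
    unfolding Uq_rels_def
    by (auto intro!: free_alg_closed free_alg_power serre_closed split: if_splits)
qed

lemmas Uq_cls_hom =
  presentation.cls_carrier[OF presentation_Uq] presentation.cls_add[OF presentation_Uq]
  presentation.cls_mult[OF presentation_Uq] presentation.cls_one[OF presentation_Uq]
  presentation.cls_sc[OF presentation_Uq]

lemma Uq_free_iff: "Uq_free ty = carrier (free_alg (Uq_gens ty))"
  by (simp add: Uq_free_def)

locale Uq_rep =
  fixes ty q d f
  assumes repr: "repr (Uq ty q) d f"
begin

abbreviation "F \<equiv> \<lambda>x. f (Uq_cls ty q x)"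
abbreviation "W \<equiv> words (Uq_gens ty)"
abbreviation "UF \<equiv> carrier (free_alg (Uq_gens ty))"

lemma F_carrier: "x \<in> UF \<Longrightarrow> F x \<in> carrier_mat d d"
  and F_mult: "x \<in> UF \<Longrightarrow> y \<in> UF \<Longrightarrow> F (x * y) = F x * F y"
  and F_one: "F 1 = 1\<^sub>m d"
  and F_sc: "x \<in> UF \<Longrightarrow> F (sc c x) = c \<cdot>\<^sub>m F x"
  using repr unfolding repr_def alg_hom_def ring_hom_def Uq_def Uq_cls_def
  by (auto simp: Uq_cls_hom module_mat_simps Pi_def)

lemma F_word_carrier [simp]: "u \<in> W \<Longrightarrow> F (mon u) \<in> carrier_mat d d"
  by (simp add: F_carrier)

lemma F_mult_carrier: "x \<in> UF \<Longrightarrow> y \<in> UF \<Longrightarrow> F x * F y \<in> carrier_mat d d"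
  by (rule mult_carrier_mat[OF F_carrier F_carrier])

lemma F_word_mult: "u \<in> W \<Longrightarrow> v \<in> W \<Longrightarrow> F (mon (u + v)) = F (mon u) * F (mon v)"
  by (simp add: F_mult flip: mon_mult)

text \<open>The only passage from the presentation to matrices: a defining relation has class zero,
  so it becomes an equation in every representation.\<close>

lemma F_relation:
  assumes "x - y \<in> Uq_rels ty q" "x \<in> UF" "y \<in> UF"
  shows "F x = F y"
proof -
  interpret Uq: presentation "Uq_gens ty" "Uq_rels ty q" by (rule presentation_Uq)
  show ?thesis
    using Uq.F.genideal_self[OF Uq.rels] assms Uq.cls_eq_iff[of x y] by (auto simp: Uq_cls_def)
qed

lemma k_inverse:
  assumes "i < rank ty"
  shows "F (lett (Gk i)) * F (lett (Gki i)) = 1\<^sub>m d" "F (lett (Gki i)) * F (lett (Gk i)) = 1\<^sub>m d"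
proof -
  have "lett (Gk i) * lett (Gki i) - 1 \<in> Uq_rels ty q" "lett (Gki i) * lett (Gk i) - 1 \<in> Uq_rels ty q"
    using assms by (auto simp: Uq_rels_def)
  then show "F (lett (Gk i)) * F (lett (Gki i)) = 1\<^sub>m d" "F (lett (Gki i)) * F (lett (Gk i)) = 1\<^sub>m d"
    using assms F_relation[of "lett (Gk i) * lett (Gki i)" 1] F_relation[of "lett (Gki i) * lett (Gk i)" 1]
    by (auto simp: F_mult F_one free_alg_closed)
qed

lemma k_conj:
  assumes i: "i < rank ty"
  shows "F (lett (Gk i)) * F (lett (Ge i)) * F (lett (Gki i)) =
      complex_of_real (q_i ty q i powr (real_of_int (cartan ty i i) / 2)) \<cdot>\<^sub>m F (lett (Ge i))"
    and "F (lett (Gk i)) * F (lett (Gf i)) * F (lett (Gki i)) =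
      complex_of_real (q_i ty q i powr (- real_of_int (cartan ty i i) / 2)) \<cdot>\<^sub>m F (lett (Gf i))"
proof -
  have "lett (Gk i) * lett (Ge i) * lett (Gki i) -
      sc (complex_of_real (q_i ty q i powr (real_of_int (cartan ty i i) / 2))) (lett (Ge i)) \<in> Uq_rels ty q"
    "lett (Gk i) * lett (Gf i) * lett (Gki i) -
      sc (complex_of_real (q_i ty q i powr (- real_of_int (cartan ty i i) / 2))) (lett (Gf i)) \<in> Uq_rels ty q"
    using i unfolding Uq_rels_def by blast+
  from this[THEN F_relation] show "F (lett (Gk i)) * F (lett (Ge i)) * F (lett (Gki i)) =
      complex_of_real (q_i ty q i powr (real_of_int (cartan ty i i) / 2)) \<cdot>\<^sub>m F (lett (Ge i))"
    "F (lett (Gk i)) * F (lett (Gf i)) * F (lett (Gki i)) =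
      complex_of_real (q_i ty q i powr (- real_of_int (cartan ty i i) / 2)) \<cdot>\<^sub>m F (lett (Gf i))"
    using i by (simp_all add: F_mult F_sc free_alg_closed)
qed

end

text \<open>The generators \<open>e\<^sub>i\<close> and \<open>f\<^sub>i\<close> behave alike, with \<open>c = q\<^sub>i\<close> and \<open>c = q\<^sub>i\<^sup>-\<^sup>1\<close> respectively.\<close>

definition skew_gen :: "ctype \<Rightarrow> real \<Rightarrow> nat \<Rightarrow> qgen \<Rightarrow> complex \<Rightarrow> bool" where
  "skew_gen ty q i g c \<longleftrightarrow> i < rank ty \<and> g \<in> Uq_gens ty \<and> c \<noteq> 0 \<and>
     coprod_gen g = mon (Word [g], Word [Gk i]) + mon (Word [Gki i], Word [g]) \<and> counit_gen g = 0 \<and>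
     antipode_gen ty q g = sc (- c) (lett g) \<and>
     antipode_gen ty (inverse q) g = sc (- inverse c) (lett g) \<and>
     (\<forall>d f. repr (Uq ty q) d f \<longrightarrow> f (Uq_cls ty q (lett (Gk i))) * f (Uq_cls ty q (lett g)) *
        f (Uq_cls ty q (lett (Gki i))) = c \<cdot>\<^sub>m f (Uq_cls ty q (lett g)))"

lemma cartan_diag: "cartan ty i i = 2"
  by (cases ty) auto

text \<open>As \<open>a_ii = 2\<close>, conjugation by \<open>k_i\<close> multiplies
  \<open>e_i\<close> by \<open>q_i\<close> and \<open>f_i\<close> by its inverse. Up to sign these
  are the constants in the antipode, and inverting \<open>q\<close> inverts them, which gives the
  opposite antipode.\<close>

lemma skew_gen_ef:
  assumes q: "q > 0" and i: "i < rank ty"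
  shows "skew_gen ty q i (Ge i) (complex_of_real (q_i ty q i))"
    and "skew_gen ty q i (Gf i) (inverse (complex_of_real (q_i ty q i)))"
proof -
  have qi: "q_i ty q i > 0" using q by (simp add: q_i_def)
  have inv: "q_i ty (inverse q) i = inverse (q_i ty q i)" by (simp add: q_i_def power_inverse)
  have "q_i ty q i powr - 1 = inverse (q_i ty q i)" using qi by (simp add: powr_minus)
  then show "skew_gen ty q i (Ge i) (complex_of_real (q_i ty q i))"
    "skew_gen ty q i (Gf i) (inverse (complex_of_real (q_i ty q i)))"
    using qi i by (auto simp: skew_gen_def inv Uq_rep.k_conj[OF Uq_rep.intro[of ty q]] cartan_diag
        simp del: of_real_inverse simp flip: of_real_inverse)
qed

lemma Uq_gen_cases:
  assumes q: "q > 0" and g: "g \<in> Uq_gens ty"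
  obtains (k) i where "i < rank ty" "g = Gk i"
    | (ki) i where "i < rank ty" "g = Gki i"
    | (skew) i c where "skew_gen ty q i g c"
proof (cases g)
  case (Ge i)
  then show ?thesis using g skew(1) skew_gen_ef(1)[OF q, of i ty] by simp
next
  case (Gf i)
  then show ?thesis using g skew(1) skew_gen_ef(2)[OF q, of i ty] by simp
qed (use k ki g in auto)

section \<open>The antipode identity in a representation\<close>

lemma antipode_mon_zero [simp]: "antipode ty q (mon 0) = 1"
  and antipode_mon_add: "antipode ty q (mon (u + v)) = antipode ty q (mon v) * antipode ty q (mon u)"
  and antipode_mon_letter: "antipode ty q (mon (Word [g])) = antipode_gen ty q g"
  and antipode_lett: "antipode ty q (lett g) = antipode_gen ty q g"
  by (simp_all add: antipode_def lett_def)

lemma one_smult_mat: "(1 :: complex) \<cdot>\<^sub>m A = A"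
  by (rule eq_matI) auto

lemma antipode_closed:
  assumes "u \<in> words (Uq_gens ty)"
  shows "antipode ty q (mon u) \<in> carrier (free_alg (Uq_gens ty))"
  using assms
proof (induction rule: words_induct)
  case zero
  then show ?case by simp
next
  case (letter_add g u)
  then have "antipode_gen ty q g \<in> carrier (free_alg (Uq_gens ty))"
    by (cases g) (auto intro!: free_alg_closed)
  with letter_add show ?case
    by (simp add: antipode_mon_add antipode_mon_letter free_alg_closed)
qed

lemma wsum_mat_smult:
  assumes "\<And>p. p \<in> Poly_Mapping.keys t \<Longrightarrow> h p \<in> carrier_mat d d"
  shows "wsum_mat d (\<lambda>p. c \<cdot>\<^sub>m h p) t = c \<cdot>\<^sub>m wsum_mat d h t"
proof (rule eq_matI)
  fix i j assume "i < dim_row (c \<cdot>\<^sub>m wsum_mat d h t)" "j < dim_col (c \<cdot>\<^sub>m wsum_mat d h t)"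
  then have ij: "i < d" "j < d" by simp_all
  have "wsum (*) (\<lambda>p. (c \<cdot>\<^sub>m h p) $$ (i, j)) t = wsum (*) (\<lambda>p. c * h p $$ (i, j)) t"
    using assms ij by (intro wsum_cong index_smult_mat) auto
  then show "wsum_mat d (\<lambda>p. c \<cdot>\<^sub>m h p) t $$ (i, j) = (c \<cdot>\<^sub>m wsum_mat d h t) $$ (i, j)"
    using ij by (simp add: wsum_mat_index cx.ws_fun_scale)
qed simp_all

lemma wsum_mat_one: "h 0 \<in> carrier_mat d d \<Longrightarrow> wsum_mat d h 1 = h 0"
  using wsum_mat_mon[of h 0] by (simp add: mon_zero)

context Uq_rep
begin

text \<open>The antipode reverses products, so for a letter followed by \<open>u\<close> the sum
  belonging to \<open>u\<close> sits between the two factors of the letter. It is a scalar by the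
  hypothesis, and only the identity for letters is left, where the relations enter.\<close>

lemma antipode_right:
  assumes q: "q > 0" and u: "u \<in> W"
  shows "wsum_mat d (\<lambda>p. F (mon (fst p)) * F (antipode ty q (mon (snd p)))) (coprod (mon u)) =
    counit (mon u) \<cdot>\<^sub>m 1\<^sub>m d"
  using u
proof (induction rule: words_induct)
  case zero
  show ?case
    using F_one F_one[folded mon_zero] by (simp add: wsum_mat_one) (rule eq_matI; simp)
next
  case (letter_add g u)
  let ?S = "\<lambda>v. antipode ty q (mon v)"
  note cl = F_carrier antipode_closed free_alg_closed
  have gW: "Word [g] \<in> W" using letter_add.hyps by simp
  have gen: "wsum_mat d (\<lambda>p. F (mon (fst p)) * F (?S (snd p))) (coprod_gen g) = counit_gen g \<cdot>\<^sub>m 1\<^sub>m d"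
    using q letter_add.hyps(1)
  proof (cases rule: Uq_gen_cases)
    case (k i)
    then show ?thesis
      by (simp add: wsum_mat_mon antipode_mon_letter antipode_lett k_inverse F_mult_carrier
          one_smult_mat flip: lett_def)
  next
    case (ki i)
    then show ?thesis
      by (simp add: wsum_mat_mon antipode_mon_letter antipode_lett k_inverse F_mult_carrier
          one_smult_mat flip: lett_def)
  next
    case (skew i c)
    let ?K = "F (lett (Gk i))" and ?K' = "F (lett (Gki i))" and ?E = "F (lett g)"
    from skew have i: "i < rank ty" and g: "g \<in> Uq_gens ty" and conj: "?K * ?E * ?K' = c \<cdot>\<^sub>m ?E"
      and gs: "coprod_gen g = mon (Word [g], Word [Gk i]) + mon (Word [Gki i], Word [g])"
        "counit_gen g = 0" "antipode_gen ty q g = sc (- c) (lett g)"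
      using repr by (auto simp: skew_gen_def)
    have C: "?K \<in> carrier_mat d d" "?K' \<in> carrier_mat d d" "?E \<in> carrier_mat d d"
      using i g by (auto intro: F_carrier)
    \<comment> \<open>Inserting \<open>k^-1 k\<close> on the left exposes the conjugate
      \<open>k g k^-1\<close>, which is \<open>c g\<close>.\<close>
    have "?E * ?K' = (?K' * ?K) * (?E * ?K')"
      using C by (simp add: k_inverse[OF i])
    also have "\<dots> = ?K' * (?K * ?E * ?K')"
      using C by (simp add: assoc_mult_mat[of _ d d _ d _ d])
    also have "\<dots> = c \<cdot>\<^sub>m (?K' * ?E)"
      by (simp add: conj mult_smult_distrib[OF C(2,3)])
    finally have EK: "?E * ?K' = c \<cdot>\<^sub>m (?K' * ?E)" .
    have "wsum_mat d (\<lambda>p. F (mon (fst p)) * F (?S (snd p))) (coprod_gen g) =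
        ?E * ?K' + - c \<cdot>\<^sub>m (?K' * ?E)"
      using C i g by (simp add: gs wsum_mat_add wsum_mat_mon antipode_mon_letter antipode_lett F_sc mult_smult_distrib[OF C(2,3)]
          F_mult_carrier free_alg_closed mult_carrier_mat[of _ d d] del: sc.scale_minus_left flip: lett_def)
    also have "\<dots> = 0 \<cdot>\<^sub>m 1\<^sub>m d"
      using C by (intro eq_matI) (auto simp: EK)
    finally show ?thesis by (simp add: gs)
  qed
  have "wsum_mat d (\<lambda>p. F (mon (fst p)) * F (?S (snd p))) (coprod (mon (Word [g] + u))) =
    wsum_mat d (\<lambda>p. wsum_mat d (\<lambda>q. F (mon (fst p)) * (F (mon (fst q)) * F (?S (snd q))) * F (?S (snd p)))
      (coprod (mon u))) (coprod_gen g)"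
    unfolding coprod_mon_add coprod_mon_letter wsum_mat_mult
  proof (intro wsum_mat_cong)
    fix p q assume p: "p \<in> Poly_Mapping.keys (coprod_gen g)" and q: "q \<in> Poly_Mapping.keys (coprod (mon u))"
    have W: "fst p \<in> W" "snd p \<in> W" "fst q \<in> W" "snd q \<in> W"
      using keys_coprod[OF gW, of p] p keys_coprod[OF letter_add.hyps(2) q] by (auto simp: coprod_mon_letter)
    then have C: "F (mon (fst p)) \<in> carrier_mat d d" "F (?S (snd p)) \<in> carrier_mat d d"
      "F (mon (fst q)) \<in> carrier_mat d d" "F (?S (snd q)) \<in> carrier_mat d d"
      by (auto intro: cl)
    have "F (mon (fst (p + q))) * F (?S (snd (p + q))) =
        F (mon (fst p)) * F (mon (fst q)) * (F (?S (snd q)) * F (?S (snd p)))"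
      using W by (simp add: F_word_mult antipode_mon_add F_mult antipode_closed)
    also have "\<dots> = F (mon (fst p)) * (F (mon (fst q)) * F (?S (snd q))) * F (?S (snd p))"
      using C by (simp add: assoc_mult_mat[of _ d d _ d _ d])
    finally show "F (mon (fst (p + q))) * F (?S (snd (p + q))) = \<dots>" .
  qed
  \<comment> \<open>The inner sum over the coproduct of \<open>u\<close> has become
    \<open>\<epsilon>(u)\<close> times the identity matrix and drops out of the middle.\<close>
  also have "\<dots> = wsum_mat d (\<lambda>p. counit (mon u) \<cdot>\<^sub>m (F (mon (fst p)) * F (?S (snd p)))) (coprod_gen g)"
  proof (intro wsum_mat_cong)
    fix p assume p: "p \<in> Poly_Mapping.keys (coprod_gen g)"
    have C: "F (mon (fst p)) \<in> carrier_mat d d" "F (?S (snd p)) \<in> carrier_mat d d"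
      using keys_coprod[OF gW, of p] p by (auto simp: coprod_mon_letter intro: cl)
    have Q: "F (mon (fst q)) * F (?S (snd q)) \<in> carrier_mat d d" if "q \<in> Poly_Mapping.keys (coprod (mon u))" for q
      using keys_coprod[OF letter_add.hyps(2) that] by (auto intro!: mult_carrier_mat cl)
    have "wsum_mat d (\<lambda>q. F (mon (fst p)) * (F (mon (fst q)) * F (?S (snd q))) * F (?S (snd p))) (coprod (mon u)) =
      F (mon (fst p)) * wsum_mat d (\<lambda>q. F (mon (fst q)) * F (?S (snd q))) (coprod (mon u)) * F (?S (snd p))"
      using C Q by (simp add: mult_wsum_mat_left mult_wsum_mat_right)
    also have "\<dots> = counit (mon u) \<cdot>\<^sub>m (F (mon (fst p)) * F (?S (snd p)))"
      by (simp add: letter_add.IH mult_smult_distrib[OF C(1) one_carrier_mat] mult_smult_assoc_mat[OF C]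
          right_mult_one_mat[OF C(1)])
    finally show "wsum_mat d (\<lambda>q. F (mon (fst p)) * (F (mon (fst q)) * F (?S (snd q))) * F (?S (snd p)))
      (coprod (mon u)) = \<dots>" .
  qed
  also have "\<dots> = counit (mon u) \<cdot>\<^sub>m wsum_mat d (\<lambda>p. F (mon (fst p)) * F (?S (snd p))) (coprod_gen g)"
    using keys_coprod[OF gW] unfolding coprod_mon_letter
    by (intro wsum_mat_smult mult_carrier_mat[of _ d d]) (auto intro!: cl)
  also have "\<dots> = counit (mon (Word [g] + u)) \<cdot>\<^sub>m 1\<^sub>m d"
    unfolding gen by (intro eq_matI) (auto simp: counit_mon_add counit_mon_letter)
  finally show ?case .
qed

end

section \<open>Invariance of the Dirac operator\<close>

context clq_invariant
begin

lemma gamma_q_eq: "gamma_q m Rc B v = cl (letter_sum m (\<lambda>k. v $ k))"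
  by (simp add: gamma_q_def clq_cls_def letter_sum_def)

lemma letter_sum_add: "letter_sum m (\<lambda>k. f k + g k) = letter_sum m f + letter_sum m g"
  and letter_sum_scale: "letter_sum m (\<lambda>k. c * f k) = sc c (letter_sum m f)"
  by (simp_all add: letter_sum_def sc.scale_left_distrib sum.distrib sc.scale_sum_right)

lemma letter_sum_cong: "(\<And>k. k < m \<Longrightarrow> f k = g k) \<Longrightarrow> letter_sum m f = letter_sum m g"
  by (simp add: letter_sum_def)

lemma linear_gamma_q: "linear_into m P (gamma_q m Rc B)"
proof -
  have "letter_sum m (\<lambda>k. (v + w) $ k) = letter_sum m (\<lambda>k. v $ k) + letter_sum m (\<lambda>k. w $ k)"
    if "v \<in> carrier_vec m" "w \<in> carrier_vec m" for v w
    unfolding letter_sum_add[symmetric] using that by (intro letter_sum_cong) auto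
  moreover have "letter_sum m (\<lambda>k. (c \<cdot>\<^sub>v v) $ k) = sc c (letter_sum m (\<lambda>k. v $ k))"
    if "v \<in> carrier_vec m" for c v
    unfolding letter_sum_scale[symmetric] using that by (intro letter_sum_cong) auto
  ultimately show ?thesis
    by (simp add: linear_into_def gamma_q_eq cls_add cls_sc)
qed

lemma tens_act_letter_sum:
  assumes "u \<in> G" "v \<in> carrier_vec m"
  shows "tens_act r m (mon u) (letter_sum m (\<lambda>k. v $ k)) = letter_sum m (\<lambda>k. (r (mon u) *\<^sub>v v) $ k)"
proof -
  have "tens_act r m (mon u) (letter_sum m (\<lambda>k. v $ k)) =
      (\<Sum>j<m. \<Sum>k<m. sc (r (mon u) $$ (k, j) * v $ j) (lett k))"
    by (simp add: letter_sum_def tens_act_sum tens_act_sc tens_act_lett sc.scale_sum_right mult.commute)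
  also have "\<dots> = letter_sum m (\<lambda>k. \<Sum>j<m. r (mon u) $$ (k, j) * v $ j)"
    by (subst sum.swap) (simp add: letter_sum_def sc.scale_sum_left)
  also have "\<dots> = letter_sum m (\<lambda>k. (r (mon u) *\<^sub>v v) $ k)"
    using mult_mat_vec_index[OF r_carrier[OF assms(1)] assms(2)] by (intro letter_sum_cong) simp
  finally show ?thesis .
qed

end

text \<open>\<open>Rc\<close> is any matrix commuting with the action on
  \<open>V \<otimes> V\<close>; \<open>equivariant_cliffordI\<close> later supplies the braiding
  built from the R-matrix.\<close>

locale equivariant_clifford = Uq_rep ty q m \<rho> for ty q m \<rho> +
  fixes Rc B :: "complex mat"
  assumes q_pos: "q > 0"
    and Rc_carrier: "Rc \<in> carrier_mat (m * m) (m * m)"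
    and Rc_commute: "\<And>x. x \<in> Uq_free ty \<Longrightarrow>
      Rc * tensor_act ty q m \<rho> m \<rho> (coprod x) = tensor_act ty q m \<rho> m \<rho> (coprod x) * Rc"
    and B_invariant: "invariant_form ty q m \<rho> B"
begin

sublocale C: clq_invariant m W F Rc B
  using B_invariant Rc_commute Rc_carrier keys_coprod
  by unfold_locales (auto simp: Uq_free_iff tensor_act_def invariant_form_def)

abbreviation "CL \<equiv> clq m Rc B"
abbreviation "\<gamma> \<equiv> gamma_q m Rc B"
abbreviation "act \<equiv> clq_act ty q m \<rho> Rc B"

lemma CL_eq: "CL = C.P"
  by (simp add: clq_def)

sublocale CL: complex_algebra CL
  unfolding CL_eq by (rule C.P.complex_algebra_axioms)

lemma act_cls:
  "u \<in> W \<Longrightarrow> y \<in> carrier C.F \<Longrightarrow> act (mon u) (C.cl y) = C.cl (tens_act F m (mon u) y)"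
  using C.UN_tens_act by (simp add: clq_act_def clq_cls_def tens_act_def)

lemma act_closed: "u \<in> W \<Longrightarrow> Y \<in> carrier CL \<Longrightarrow> act (mon u) Y \<in> carrier CL"
  and act_add: "u \<in> W \<Longrightarrow> Y \<in> carrier CL \<Longrightarrow> Y' \<in> carrier CL \<Longrightarrow>
    act (mon u) (Y \<oplus>\<^bsub>CL\<^esub> Y') = act (mon u) Y \<oplus>\<^bsub>CL\<^esub> act (mon u) Y'"
  and act_smult: "u \<in> W \<Longrightarrow> Y \<in> carrier CL \<Longrightarrow>
    act (mon u) (c \<odot>\<^bsub>CL\<^esub> Y) = c \<odot>\<^bsub>CL\<^esub> act (mon u) Y"
  unfolding CL_eq C.carrier_P
  by (auto simp: act_cls tens_act_closed free_alg_closed tens_act_add tens_act_sc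
      simp flip: C.cls_add C.cls_sc)

lemma linear_gamma: "linear_into m CL \<gamma>"
  unfolding CL_eq by (rule C.linear_gamma_q)

lemma act_gamma:
  "u \<in> W \<Longrightarrow> v \<in> carrier_vec m \<Longrightarrow> act (mon u) (\<gamma> v) = \<gamma> (F (mon u) *\<^sub>v v)"
  by (simp add: C.gamma_q_eq act_cls C.tens_act_letter_sum)

end

section \<open>The opposite adjoint action\<close>

locale quantum_algebra = A: complex_algebra A for A :: "(complex, 'u) module" +
  fixes ty q and \<iota> :: "qgen falg set \<Rightarrow> 'u"
  assumes \<iota>_closed: "x \<in> carrier (free_alg (Uq_gens ty)) \<Longrightarrow> \<iota> (Uq_cls ty q x) \<in> carrier A"
begin

abbreviation "ad \<equiv> op_adjoint ty q A \<iota>"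

lemma ad_term_closed:
  assumes "u \<in> words (Uq_gens ty)" "p \<in> Poly_Mapping.keys (coprod (mon u))"
  shows "\<iota> (Uq_cls ty q (mon (snd p))) \<in> carrier A"
    "\<iota> (Uq_cls ty q (antipode_op ty q (mon (fst p)))) \<in> carrier A"
  using keys_coprod[OF assms] by (auto intro!: \<iota>_closed antipode_closed simp: antipode_op_def)

lemma ad_closed:
  "u \<in> words (Uq_gens ty) \<Longrightarrow> Z \<in> carrier A \<Longrightarrow> ad (mon u) Z \<in> carrier A"
  unfolding op_adjoint_def by (rule A.finsum_closed) (auto simp: ad_term_closed)

lemma ad_add:
  assumes "u \<in> words (Uq_gens ty)" "Z \<in> carrier A" "Z' \<in> carrier A"
  shows "ad (mon u) (Z \<oplus>\<^bsub>A\<^esub> Z') = ad (mon u) Z \<oplus>\<^bsub>A\<^esub> ad (mon u) Z'"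
  unfolding op_adjoint_def
  by (rule trans[OF A.finsum_cong'[OF refl] A.finsum_addf])
    (use assms ad_term_closed[OF assms(1)] in
      \<open>auto simp: A.r_distr A.l_distr A.smult_add simp del: split_paired_All\<close>)

lemma ad_smult:
  assumes "u \<in> words (Uq_gens ty)" "Z \<in> carrier A"
  shows "ad (mon u) (c \<odot>\<^bsub>A\<^esub> Z) = c \<odot>\<^bsub>A\<^esub> ad (mon u) Z"
  unfolding op_adjoint_def
  by (rule trans[OF A.finsum_cong'[OF refl] A.finsum_smult[symmetric]])
    (use assms ad_term_closed[OF assms(1)] in
      \<open>auto simp: A.smult_mult_left A.smult_mult_right A.smult_smult mult.commute\<close>)

end

section \<open>Moving the canonical element\<close>

locale dirac_setting = equivariant_clifford ty q m \<rho> Rc B + quantum_algebra A ty q \<iota>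
  for ty q m \<rho> Rc B and A :: "(complex, 'u) module" and \<iota> +
  fixes \<tau> :: "complex mat" and \<phi> :: "complex vec \<Rightarrow> 'u"
  assumes \<tau>: "is_tau ty q m \<rho> \<tau>"
    and \<phi>_linear: "linear_into m A \<phi>"
    and \<phi>_equivariant: "\<And>x v. x \<in> Uq_free ty \<Longrightarrow> v \<in> carrier_vec m \<Longrightarrow> \<phi> (F x *\<^sub>v v) = ad x (\<phi> v)"
begin

lemma \<tau>_carrier: "\<tau> \<in> carrier_mat m m"
  using \<tau> by (simp add: is_tau_def)

text \<open>Transposing the module property of \<tau> turns the action on the second factor into
  \<open>\<rho>(S(x''))\<close> next to the transpose of \<tau>. It then meets
  \<open>\<rho>(x')\<close>, and the antipode identity leaves the counit.\<close>

lemma coupling: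
  assumes u: "u \<in> W"
  shows "wsum_mat m (\<lambda>p. F (mon (fst p)) * transpose_mat (F (mon (snd p)) * \<tau>)) (coprod (mon u)) =
    counit (mon u) \<cdot>\<^sub>m transpose_mat \<tau>"
proof -
  note W = keys_coprod[OF u]
  let ?S = "\<lambda>v. F (antipode ty q (mon v))"
  have S: "?S v \<in> carrier_mat m m" if "v \<in> W" for v
    using that by (intro F_carrier antipode_closed)
  have T: "transpose_mat (F (mon v) * \<tau>) = ?S v * transpose_mat \<tau>" if "v \<in> W" for v
  proof -
    have "F (mon v) * \<tau> = \<tau> * transpose_mat (?S v)"
      using \<tau> that by (simp add: is_tau_def Uq_free_iff)
    moreover have "transpose_mat (?S v) \<in> carrier_mat m m"
      using S[OF that] by simp
    ultimately show ?thesis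
      using transpose_mult[OF \<tau>_carrier] by simp
  qed
  have "wsum_mat m (\<lambda>p. F (mon (fst p)) * transpose_mat (F (mon (snd p)) * \<tau>)) (coprod (mon u)) =
    wsum_mat m (\<lambda>p. (F (mon (fst p)) * ?S (snd p)) * transpose_mat \<tau>) (coprod (mon u))"
    using W \<tau>_carrier by (intro wsum_mat_cong) (simp add: T S assoc_mult_mat[of _ m m _ m _ m])
  also have "\<dots> = wsum_mat m (\<lambda>p. F (mon (fst p)) * ?S (snd p)) (coprod (mon u)) * transpose_mat \<tau>"
    using W \<tau>_carrier by (intro mult_wsum_mat_right[symmetric]) (auto intro!: mult_carrier_mat[of _ m m] S)
  also have "\<dots> = counit (mon u) \<cdot>\<^sub>m transpose_mat \<tau>"
    using \<tau>_carrier by (simp add: antipode_right[OF q_pos u] mult_smult_assoc_mat[of _ m m _ m])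
  finally show ?thesis .
qed

definition basis_pair :: "nat \<Rightarrow> nat \<Rightarrow> ('u \<times> nat falg set) \<Rightarrow>\<^sub>0 complex" where
  "basis_pair j k = mon (\<phi> (unit_vec m j), \<gamma> (unit_vec m k))"

text \<open>One Sweedler term of the acted Dirac operator, with both actions already carried back to
  vectors of \<open>V\<close>.\<close>

definition moved :: "qgen fmon \<times> qgen fmon \<Rightarrow> ('u \<times> nat falg set) \<Rightarrow>\<^sub>0 complex" where
  "moved p = (\<Sum>i<m. mon (\<phi> (F (mon (fst p)) *\<^sub>v unit_vec m i), \<gamma> (F (mon (snd p)) *\<^sub>v (\<tau> *\<^sub>v unit_vec m i))))"

text \<open>The coefficient of the basis pair \<open>(j, k)\<close> is the sum over \<open>i\<close>
  of \<open>X_ji Y_ki\<close>, hence an entry of \<open>X\<close> times the transpose of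
  \<open>Y\<close>; this is the matrix summed in \<open>coupling\<close>.\<close>

lemma moved_expand:
  assumes "fst p \<in> W" "snd p \<in> W"
  shows "tensor_eq A CL (moved p) (\<Sum>j<m. \<Sum>k<m.
    sc ((F (mon (fst p)) * transpose_mat (F (mon (snd p)) * \<tau>)) $$ (j, k)) (basis_pair j k))"
proof -
  let ?X = "F (mon (fst p))" and ?Y = "F (mon (snd p)) * \<tau>"
  have X: "?X \<in> carrier_mat m m" and Y: "?Y \<in> carrier_mat m m" and F2: "F (mon (snd p)) \<in> carrier_mat m m"
    using assms \<tau>_carrier by (auto intro!: mult_carrier_mat[of _ m m])
  then have Y': "transpose_mat ?Y \<in> carrier_mat m m" by simp
  have "tensor_eq A CL (moved p) (\<Sum>i<m. \<Sum>j<m. \<Sum>k<m.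
    sc ((?X *\<^sub>v unit_vec m i) $ j * (?Y *\<^sub>v unit_vec m i) $ k) (basis_pair j k))"
    unfolding moved_def basis_pair_def
    by (intro tensor_eq_sum, subst assoc_mult_mat_vec[OF F2 \<tau>_carrier, symmetric], simp,
        intro tensor_eq_expand \<phi>_linear linear_gamma mult_mat_vec_carrier[OF X] mult_mat_vec_carrier[OF Y]) simp_all
  also have "(\<Sum>i<m. \<Sum>j<m. \<Sum>k<m.
      sc ((?X *\<^sub>v unit_vec m i) $ j * (?Y *\<^sub>v unit_vec m i) $ k) (basis_pair j k)) =
    (\<Sum>i<m. \<Sum>j<m. \<Sum>k<m. sc (?X $$ (j, i) * ?Y $$ (k, i)) (basis_pair j k))"
    using X Y by (intro sum.cong refl) (simp del: index_mult_mat)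
  also have "\<dots> = (\<Sum>j<m. \<Sum>k<m. \<Sum>i<m. sc (?X $$ (j, i) * ?Y $$ (k, i)) (basis_pair j k))"
    by (subst sum.swap, subst (2) sum.swap) (rule refl)
  also have "\<dots> = (\<Sum>j<m. \<Sum>k<m. sc ((?X * transpose_mat ?Y) $$ (j, k)) (basis_pair j k))"
    using X Y by (intro sum.cong refl)
      (simp add: mult_mat_index[OF X Y'] sc.scale_sum_left del: index_mult_mat)
  finally show ?thesis .
qed

lemma moved_sum:
  assumes u: "u \<in> W"
  shows "tensor_eq A CL (wsum sc moved (coprod (mon u)))
    (sc (counit (mon u)) (\<Sum>j<m. \<Sum>k<m. sc (transpose_mat \<tau> $$ (j, k)) (basis_pair j k)))"
proof -
  let ?M = "\<lambda>p. F (mon (fst p)) * transpose_mat (F (mon (snd p)) * \<tau>)"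
  have "tensor_eq A CL (wsum sc moved (coprod (mon u)))
      (wsum sc (\<lambda>p. \<Sum>j<m. \<Sum>k<m. sc (?M p $$ (j, k)) (basis_pair j k)) (coprod (mon u)))"
    using keys_coprod[OF u] by (intro tensor_eq_wsum moved_expand)
  also have "wsum sc (\<lambda>p. \<Sum>j<m. \<Sum>k<m. sc (?M p $$ (j, k)) (basis_pair j k)) (coprod (mon u)) =
      (\<Sum>j<m. \<Sum>k<m. sc (wsum_mat m ?M (coprod (mon u)) $$ (j, k)) (basis_pair j k))"
    by (simp add: sc.ws_fun_sum sc.ws_scale_left wsum_mat_index)
  also have "\<dots> = sc (counit (mon u)) (\<Sum>j<m. \<Sum>k<m. sc (transpose_mat \<tau> $$ (j, k)) (basis_pair j k))"
    using \<tau>_carrier by (simp add: coupling[OF u] sc.scale_sum_right)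
  finally show ?thesis .
qed

lemma moved_zero: "moved 0 = dirac m \<phi> \<gamma> \<tau>"
  using \<tau>_carrier F_one unfolding moved_def dirac_def
  by (intro sum.cong refl) (simp flip: mon_zero)

lemma moved_sum_dirac:
  assumes u: "u \<in> W"
  shows "tensor_eq A CL (wsum sc moved (coprod (mon u))) (sc (counit (mon u)) (dirac m \<phi> \<gamma> \<tau>))"
proof -
  \<comment> \<open>For the empty word the moved element is the Dirac operator itself, so the
    general formula at that word also yields its expansion in basis pairs.\<close>
  have "tensor_eq A CL (dirac m \<phi> \<gamma> \<tau>)
      (\<Sum>j<m. \<Sum>k<m. sc (transpose_mat \<tau> $$ (j, k)) (basis_pair j k))"
    using moved_sum[of 0] by (simp add: moved_zero)
  then show ?thesis
    using moved_sum[OF u] by (blast intro: tensor_eq_trans tensor_eq_sym tensor_eq_sc)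
qed

section \<open>The action on formal sums of pairs\<close>

definition both :: "qgen falg \<Rightarrow> 'u \<times> nat falg set \<Rightarrow> ('u \<times> nat falg set) \<Rightarrow>\<^sub>0 complex" where
  "both x ab = wsum sc (\<lambda>p. mon (ad (mon (fst p)) (fst ab), act (mon (snd p)) (snd ab))) (coprod x)"

text \<open>Each term of the coproduct acts linearly on either factor, so each kind of bilinearity
  relation is sent to a combination of relations of the same kind.\<close>

lemma both_tensor_null:
  assumes "u \<in> W" and "s \<in> tensor_null A CL"
  shows "wsum sc (both (mon u)) s \<in> tensor_null A CL"
  using tensor_null_subspace _ _ _ _ assms(2)
proof (rule sc.ws_tensor_null)
  note W = keys_coprod[OF assms(1)]
  note N = tensor_null_subspace[of A CL]
  {
    fix a a' b assume "a \<in> carrier A" "a' \<in> carrier A" "b \<in> carrier CL"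
    then show "both (mon u) (a \<oplus>\<^bsub>A\<^esub> a', b) - both (mon u) (a, b) - both (mon u) (a', b) \<in> tensor_null A CL"
      unfolding both_def fst_conv snd_conv wsum_def sum_subtractf[symmetric] sc.scale_right_diff_distrib[symmetric]
      using W by (intro sc.subspace_sum[OF N] tensor_null.scale)
        (auto simp: ad_add intro!: tensor_null.add_left ad_closed act_closed)
  next
    fix a b b' assume "a \<in> carrier A" "b \<in> carrier CL" "b' \<in> carrier CL"
    then show "both (mon u) (a, b \<oplus>\<^bsub>CL\<^esub> b') - both (mon u) (a, b) - both (mon u) (a, b') \<in> tensor_null A CL"
      unfolding both_def fst_conv snd_conv wsum_def sum_subtractf[symmetric] sc.scale_right_diff_distrib[symmetric]
      using W by (intro sc.subspace_sum[OF N] tensor_null.scale)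
        (auto simp: act_add intro!: tensor_null.add_right ad_closed act_closed)
  next
    fix c a b assume "a \<in> carrier A" "b \<in> carrier CL"
    then show "both (mon u) (c \<odot>\<^bsub>A\<^esub> a, b) - sc c (both (mon u) (a, b)) \<in> tensor_null A CL"
      unfolding both_def fst_conv snd_conv sc.ws_fun_scale[symmetric] unfolding wsum_def sum_subtractf[symmetric] sc.scale_right_diff_distrib[symmetric]
      using W by (intro sc.subspace_sum[OF N] tensor_null.scale)
        (auto simp: ad_smult intro!: tensor_null.smult_left ad_closed act_closed)
  next
    fix c a b assume "a \<in> carrier A" "b \<in> carrier CL"
    then show "both (mon u) (a, c \<odot>\<^bsub>CL\<^esub> b) - sc c (both (mon u) (a, b)) \<in> tensor_null A CL"
      unfolding both_def fst_conv snd_conv sc.ws_fun_scale[symmetric] unfolding wsum_def sum_subtractf[symmetric] sc.scale_right_diff_distrib[symmetric]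
      using W by (intro sc.subspace_sum[OF N] tensor_null.scale)
        (auto simp: act_smult intro!: tensor_null.smult_right ad_closed act_closed)
  }
qed

lemma both_dirac:
  assumes "u \<in> W"
  shows "wsum sc (both (mon u)) (dirac m \<phi> \<gamma> \<tau>) = wsum sc moved (coprod (mon u))"
proof -
  have "wsum sc (both (mon u)) (dirac m \<phi> \<gamma> \<tau>) =
      wsum sc (\<lambda>p. \<Sum>i<m. mon (ad (mon (fst p)) (\<phi> (unit_vec m i)), act (mon (snd p)) (\<gamma> (\<tau> *\<^sub>v unit_vec m i))))
        (coprod (mon u))"
    by (simp add: dirac_def sc.ws_sum both_def sc.ws_fun_sum)
  also have "\<dots> = wsum sc moved (coprod (mon u))"
    using keys_coprod[OF assms] \<tau>_carrier unfolding moved_def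
    by (intro wsum_cong sum.cong refl) (simp add: \<phi>_equivariant Uq_free_iff act_gamma)
  finally show ?thesis .
qed

text \<open>Terms of different words may cancel in the coproduct of \<open>x\<close>, so its support
  is no union over words; linearity in \<open>x\<close> still allows a reduction to words.\<close>

lemma acted_sum_eq:
  "acted_sum m \<alpha> Z \<psi> ad act x = wsum sc (\<lambda>u. wsum sc (both (mon u)) (coord_sum m \<alpha> Z \<psi>)) x"
proof -
  have "acted_sum m \<alpha> Z \<psi> ad act x = (\<Sum>i<m. \<Sum>j<m. sc (\<alpha> i j) (both x (Z i, \<psi> j)))"
    by (simp add: acted_sum_def both_def wsum_def)
  also have "both x = (\<lambda>ab. wsum sc (\<lambda>u. both (mon u) ab) x)"
    unfolding both_def by (subst coprod_eq_wsum) (simp add: sc.ws_wsum)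
  finally show ?thesis
    by (simp add: coord_sum_def sc.ws_sum sc.ws_sc sc.ws_fun_sum sc.ws_fun_scale)
qed

theorem dirac_invariant:
  assumes eq: "tensor_eq A CL (dirac m \<phi> \<gamma> \<tau>) (coord_sum m \<alpha> Z \<psi>)" and x: "x \<in> Uq_free ty"
  shows "tensor_eq A CL (acted_sum m \<alpha> Z \<psi> ad act x) (sc (counit x) (dirac m \<phi> \<gamma> \<tau>))"
proof -
  have "tensor_eq A CL (acted_sum m \<alpha> Z \<psi> ad act x)
      (wsum sc (\<lambda>u. sc (counit (mon u)) (dirac m \<phi> \<gamma> \<tau>)) x)"
    unfolding acted_sum_eq
  proof (rule tensor_eq_wsum)
    fix u assume "u \<in> Poly_Mapping.keys x"
    then have u: "u \<in> W" using x by (auto simp: Uq_free_iff carrier_free_alg)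
    have "tensor_eq A CL (wsum sc (both (mon u)) (coord_sum m \<alpha> Z \<psi>)) (wsum sc (both (mon u)) (dirac m \<phi> \<gamma> \<tau>))"
      using both_tensor_null[OF u] tensor_eq_sym[OF eq] by (auto simp: tensor_eq_def simp flip: sc.ws_diff)
    then show "tensor_eq A CL (wsum sc (both (mon u)) (coord_sum m \<alpha> Z \<psi>)) (sc (counit (mon u)) (dirac m \<phi> \<gamma> \<tau>))"
      using moved_sum_dirac[OF u] by (simp add: both_dirac[OF u]) (blast intro: tensor_eq_trans)
  qed
  also have "wsum sc (\<lambda>u. sc (counit (mon u)) (dirac m \<phi> \<gamma> \<tau>)) x = sc (counit x) (dirac m \<phi> \<gamma> \<tau>)"
    by (simp add: sc.ws_scale_left counit_eq_wsum)
  finally show ?thesis .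
qed

end

section \<open>The Dirac operator commutes with the quantum group\<close>

lemma comb_mat_kron_conj:
  assumes P: "\<And>i. i \<in> I \<Longrightarrow> P i \<in> carrier_mat a a" and Q: "\<And>i. i \<in> I \<Longrightarrow> Q i \<in> carrier_mat b b"
    and S: "S \<in> carrier_mat a a" "S' \<in> carrier_mat a a" and T: "T \<in> carrier_mat b b" "T' \<in> carrier_mat b b"
  shows "comb_mat (a * b) I c (\<lambda>i. kron (S * P i * S') (T * Q i * T')) =
    kron S T * comb_mat (a * b) I c (\<lambda>i. kron (P i) (Q i)) * kron S' T'"
proof -
  have "kron S T * comb_mat (a * b) I c (\<lambda>i. kron (P i) (Q i)) * kron S' T' =
      comb_mat (a * b) I c (\<lambda>i. kron S T * kron (P i) (Q i) * kron S' T')"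
    using assms by (subst mult_comb_mat_left) (auto intro!: mult_comb_mat_right mult_carrier_mat[of _ "a * b" "a * b"])
  also have "\<dots> = comb_mat (a * b) I c (\<lambda>i. kron (S * P i * S') (T * Q i * T'))"
    using assms by (intro comb_mat_cong)
      (simp add: kron_mult[of _ a _ _ b] mult_carrier_mat[of _ a a] mult_carrier_mat[of _ b b])
  finally show ?thesis by simp
qed

lemma comb_mat_add:
  assumes "\<And>i. i \<in> I \<Longrightarrow> f i \<in> carrier_mat d d" "\<And>i. i \<in> I \<Longrightarrow> g i \<in> carrier_mat d d"
  shows "comb_mat d I c (\<lambda>i. f i + g i) = comb_mat d I c f + comb_mat d I c g"
proof (rule eq_matI)
  fix r k assume "r < dim_row (comb_mat d I c f + comb_mat d I c g)" "k < dim_col (comb_mat d I c f + comb_mat d I c g)"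
  then have rk: "r < d" "k < d" by simp_all
  have "(f i + g i) $$ (r, k) = f i $$ (r, k) + g i $$ (r, k)" if "i \<in> I" for i
    using assms[OF that] rk by auto
  then show "comb_mat d I c (\<lambda>i. f i + g i) $$ (r, k) = (comb_mat d I c f + comb_mat d I c g) $$ (r, k)"
    using rk by (simp add: distrib_left sum.distrib del: index_add_mat(1)) (simp add: rk)
qed simp_all

lemma kron_add_left:
  assumes "S \<in> carrier_mat a a'" "S' \<in> carrier_mat a a'" "T \<in> carrier_mat b b'"
  shows "kron (S + S') T = kron S T + kron S' T"
  using assms by (intro eq_matI) (auto simp: kron_def div_less_mult algebra_simps)

lemma kron_add_right:
  assumes "S \<in> carrier_mat a a'" "T \<in> carrier_mat b b'" "T' \<in> carrier_mat b b'"
  shows "kron S (T + T') = kron S T + kron S T'"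
proof (rule eq_matI)
  fix r k assume "r < dim_row (kron S T + kron S T')" "k < dim_col (kron S T + kron S T')"
  then have rk: "r < a * b" "k < a' * b'" using assms by (auto simp: kron_def)
  show "kron S (T + T') $$ (r, k) = (kron S T + kron S T') $$ (r, k)"
    using assms rk div_less_mult[OF rk(1)] div_less_mult[OF rk(2)] by (simp add: kron_def algebra_simps)
qed (use assms in \<open>auto simp: kron_def\<close>)

lemma kron_smult_left: "S \<in> carrier_mat a a' \<Longrightarrow> kron (c \<cdot>\<^sub>m S) T = c \<cdot>\<^sub>m kron S T"
  and kron_smult_right: "T \<in> carrier_mat b b' \<Longrightarrow> kron S (c \<cdot>\<^sub>m T) = c \<cdot>\<^sub>m kron S T"
  by (auto intro!: eq_matI simp: kron_def div_less_mult)

lemma kron_one: "kron (1\<^sub>m a) (1\<^sub>m b) = 1\<^sub>m (a * b)"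
proof (rule eq_matI)
  fix r k assume "r < dim_row (1\<^sub>m (a * b) :: complex mat)" "k < dim_col (1\<^sub>m (a * b) :: complex mat)"
  then have rk: "r < a * b" "k < a * b" by simp_all
  have "r div b = k div b \<and> r mod b = k mod b \<longleftrightarrow> r = k"
    by (metis div_mult_mod_eq)
  then show "kron (1\<^sub>m a) (1\<^sub>m b) $$ (r, k) = (1\<^sub>m (a * b) :: complex mat) $$ (r, k)"
    using rk by (auto simp: kron_def div_less_mult)
qed (auto simp: kron_def)

lemma sum_zero_rearrange:
  fixes D :: "complex mat"
  assumes "D \<in> carrier_mat n n" "X \<in> carrier_mat n n" "Y \<in> carrier_mat n n" "S \<in> carrier_mat n n" "T \<in> carrier_mat n n"
    and eq: "0 \<cdot>\<^sub>m D = - a \<cdot>\<^sub>m X + S + (T + - b \<cdot>\<^sub>m Y)"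
  shows "S + T = a \<cdot>\<^sub>m X + b \<cdot>\<^sub>m Y"
proof (rule eq_matI)
  fix i j assume "i < dim_row (a \<cdot>\<^sub>m X + b \<cdot>\<^sub>m Y)" "j < dim_col (a \<cdot>\<^sub>m X + b \<cdot>\<^sub>m Y)"
  then show "(S + T) $$ (i, j) = (a \<cdot>\<^sub>m X + b \<cdot>\<^sub>m Y) $$ (i, j)"
    using assms(1-5) arg_cong[OF eq, of "\<lambda>M. M $$ (i, j)"] by (auto simp: algebra_simps)
qed (use assms in auto)

text \<open>To be read with \<open>E\<^sub>1 = g \<otimes> k\<close>,
  \<open>E\<^sub>2 = k^-1 \<otimes> g\<close>, \<open>U = k \<otimes> k\<close>,
  \<open>U' = k^-1 \<otimes> k^-1\<close>, \<open>V = k \<otimes> k^-1\<close>,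
  \<open>V' = k^-1 \<otimes> k\<close>, \<open>X = g \<otimes> k^-1\<close> and
  \<open>Y = k \<otimes> g\<close>. Multiplying \<open>eq\<close> by \<open>V'\<close> on the right
  and moving \<open>D\<close> to the left past \<open>U\<close> and \<open>U'\<close> leaves the
  commutation with the coproduct of \<open>g\<close>.\<close>

lemma skew_commute:
  fixes D :: "complex mat"
  assumes C: "D \<in> carrier_mat n n" "E\<^sub>1 \<in> carrier_mat n n" "E\<^sub>2 \<in> carrier_mat n n" "U \<in> carrier_mat n n"
      "U' \<in> carrier_mat n n" "V \<in> carrier_mat n n" "V' \<in> carrier_mat n n" "X \<in> carrier_mat n n" "Y \<in> carrier_mat n n"
    and V: "V * V' = 1\<^sub>m n" and U: "U * D = D * U" "U' * D = D * U'"
    and X: "U * (X * V') = c \<cdot>\<^sub>m E\<^sub>1" and Y: "U' * (Y * V') = inverse c \<cdot>\<^sub>m E\<^sub>2" and c: "c \<noteq> 0"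
    and eq: "E\<^sub>1 * D * V + E\<^sub>2 * D * V = inverse c \<cdot>\<^sub>m (U * D * X) + c \<cdot>\<^sub>m (U' * D * Y)"
  shows "(E\<^sub>1 + E\<^sub>2) * D = D * (E\<^sub>1 + E\<^sub>2)"
proof -
  note [simp] = mult_carrier_mat[of _ n n] assoc_mult_mat[of _ n n _ n _ n] add_mult_distrib_mat[of _ n n _ _ n]
    mult_add_distrib_mat[of _ n n _ n] mult_smult_distrib[of _ n n _ n] mult_smult_assoc_mat[of _ n n _ n]
  have "(E\<^sub>1 + E\<^sub>2) * D = (E\<^sub>1 * D * V + E\<^sub>2 * D * V) * V'"
    using C V by simp
  also have "\<dots> = inverse c \<cdot>\<^sub>m (U * D * X * V') + c \<cdot>\<^sub>m (U' * D * Y * V')"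
    unfolding eq using C by simp
  also have "U * D * X * V' = D * (U * (X * V'))"
    unfolding U using C by simp
  also have "U' * D * Y * V' = D * (U' * (Y * V'))"
    unfolding U using C by simp
  also have "inverse c \<cdot>\<^sub>m (D * (U * (X * V'))) + c \<cdot>\<^sub>m (D * (U' * (Y * V'))) =
      inverse c \<cdot>\<^sub>m (c \<cdot>\<^sub>m (D * E\<^sub>1)) + c \<cdot>\<^sub>m (inverse c \<cdot>\<^sub>m (D * E\<^sub>2))"
    unfolding X Y using C by simp
  also have "\<dots> = D * E\<^sub>1 + D * E\<^sub>2"
    using C c by (intro eq_matI) (auto simp del: index_mult_mat(1) simp flip: mult.assoc)
  also have "\<dots> = D * (E\<^sub>1 + E\<^sub>2)"
    using C by simp
  finally show ?thesis .
qed

section \<open>Evaluating tensors as matrices\<close>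

lemma coprod_lett: "coprod (lett g) = coprod_gen g" and counit_lett: "counit (lett g) = counit_gen g"
  by (simp_all add: lett_def coprod_mon_letter counit_mon_letter)

lemma alg_hom_matD:
  assumes "f \<in> alg_hom A (module_mat TYPE(complex) n n)"
  shows "x \<in> carrier A \<Longrightarrow> f x \<in> carrier_mat n n"
    and "x \<in> carrier A \<Longrightarrow> y \<in> carrier A \<Longrightarrow> f (x \<oplus>\<^bsub>A\<^esub> y) = f x + f y"
    and "x \<in> carrier A \<Longrightarrow> y \<in> carrier A \<Longrightarrow> f (x \<otimes>\<^bsub>A\<^esub> y) = f x * f y"
    and "x \<in> carrier A \<Longrightarrow> f (c \<odot>\<^bsub>A\<^esub> x) = c \<cdot>\<^sub>m f x"
  using assms by (auto simp: alg_hom_def ring_hom_def module_mat_simps)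

text \<open>A single entry of a Kronecker product is a bilinear functional of the two arguments, so
  it cannot distinguish equal tensors.\<close>

lemma kron_index_bilinear:
  assumes f: "f \<in> alg_hom A (module_mat TYPE(complex) a a)" and g: "g \<in> alg_hom C (module_mat TYPE(complex) b b)"
    and rk: "r < a * b" "k < a * b" and eq: "tensor_eq A C s t"
  shows "wsum (*) (\<lambda>x. kron (f (fst x)) (g (snd x)) $$ (r, k)) s =
    wsum (*) (\<lambda>x. kron (f (fst x)) (g (snd x)) $$ (r, k)) t"
proof (rule cx.ws_tensor_eq[OF _ _ _ _ eq])
  note F = alg_hom_matD[OF f] and G = alg_hom_matD[OF g]
  note [simp] = kron_index[of _ a a _ b b] rk div_less_mult[OF rk(1)] div_less_mult[OF rk(2)]
  show "kron (f (fst (x \<oplus>\<^bsub>A\<^esub> x', y))) (g (snd (x \<oplus>\<^bsub>A\<^esub> x', y))) $$ (r, k) =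
      kron (f (fst (x, y))) (g (snd (x, y))) $$ (r, k) + kron (f (fst (x', y))) (g (snd (x', y))) $$ (r, k)"
    if "x \<in> carrier A" "x' \<in> carrier A" "y \<in> carrier C" for x x' y
    using that F(1)[of x] F(1)[of x'] G(1)[of y] by (simp add: F(2) algebra_simps)
  show "kron (f (fst (x, y \<oplus>\<^bsub>C\<^esub> y'))) (g (snd (x, y \<oplus>\<^bsub>C\<^esub> y'))) $$ (r, k) =
      kron (f (fst (x, y))) (g (snd (x, y))) $$ (r, k) + kron (f (fst (x, y'))) (g (snd (x, y'))) $$ (r, k)"
    if "x \<in> carrier A" "y \<in> carrier C" "y' \<in> carrier C" for x y y'
    using that F(1)[of x] G(1)[of y] G(1)[of y'] by (simp add: G(2) algebra_simps)
  show "kron (f (fst (c \<odot>\<^bsub>A\<^esub> x, y))) (g (snd (c \<odot>\<^bsub>A\<^esub> x, y))) $$ (r, k) =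
      c * kron (f (fst (x, y))) (g (snd (x, y))) $$ (r, k)"
    if "x \<in> carrier A" "y \<in> carrier C" for c x y
    using that F(1)[of x] G(1)[of y] by (simp add: F(4))
  show "kron (f (fst (x, c \<odot>\<^bsub>C\<^esub> y))) (g (snd (x, c \<odot>\<^bsub>C\<^esub> y))) $$ (r, k) =
      c * kron (f (fst (x, y))) (g (snd (x, y))) $$ (r, k)"
    if "x \<in> carrier A" "y \<in> carrier C" for c x y
    using that F(1)[of x] G(1)[of y] by (simp add: G(4))
qed

lemma alg_hom_finsum:
  fixes A :: "(complex, 'u) module" (structure)
  assumes "complex_algebra A" and f: "f \<in> alg_hom A (module_mat TYPE(complex) n n)" and "finite I" and "h \<in> I \<rightarrow> carrier A"
  shows "f (\<Oplus>i\<in>I. c i \<odot>\<^bsub>A\<^esub> h i) = comb_mat n I c (\<lambda>i. f (h i))"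
  using assms(3,4)
proof (induction I)
  interpret complex_algebra A by fact
  case empty
  \<comment> \<open>That zero is preserved is not among the clauses of \<open>alg_hom\<close>; it
    comes from compatibility with the scalar 0.\<close>
  have "f (0 \<odot>\<^bsub>A\<^esub> \<zero>) = 0 \<cdot>\<^sub>m f \<zero>" by (rule alg_hom_matD[OF f]) simp
  then have "f \<zero> = 0 \<cdot>\<^sub>m f \<zero>" by (simp add: smult_zero)
  moreover have "0 \<cdot>\<^sub>m f \<zero> = 0\<^sub>m n n"
    using alg_hom_matD(1)[OF f, of \<zero>] by (intro eq_matI) auto
  ultimately have "f \<zero> = 0\<^sub>m n n" by metis
  then show ?case by (intro eq_matI) auto
next
  interpret complex_algebra A by fact
  case (insert i I)
  then have "f (\<Oplus>i\<in>insert i I. c i \<odot>\<^bsub>A\<^esub> h i) = c i \<cdot>\<^sub>m f (h i) + comb_mat n I c (\<lambda>i. f (h i))"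
    using alg_hom_matD[OF f] by (simp add: finsum_insert Pi_def)
  then show ?case
    using insert alg_hom_matD(1)[OF f, of "h i"] by (intro eq_matI) auto
qed

section \<open>The operator on a highest weight module tensored with spinors\<close>

locale dirac_action = dirac_setting ty q m \<rho> Rc B A \<iota> \<tau> \<phi>
  for ty q m \<rho> Rc B and A :: "(complex, 'u) module" and \<iota> \<tau> \<phi> +
  fixes n :: nat and \<pi> :: "qgen falg set \<Rightarrow> complex mat" and ev :: "'u \<Rightarrow> complex mat"
    and N :: nat and \<sigma> :: "qgen falg set \<Rightarrow> complex mat" and s :: "nat falg set \<Rightarrow> complex mat"
    and \<alpha> :: "nat \<Rightarrow> nat \<Rightarrow> complex"
  assumes rep_\<pi>: "repr (Uq ty q) n \<pi>" and rep_\<sigma>: "repr (Uq ty q) N \<sigma>" and rep_s: "repr CL N s"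
    and ev_hom: "ev \<in> alg_hom A (module_mat TYPE(complex) n n)"
    and ev_\<iota>: "\<And>x. x \<in> carrier (free_alg (Uq_gens ty)) \<Longrightarrow> ev (\<iota> (Uq_cls ty q x)) = \<pi> (Uq_cls ty q x)"
    and s_equivariant: "\<And>x v. x \<in> Uq_free ty \<Longrightarrow> v \<in> carrier_vec m \<Longrightarrow>
      s (\<gamma> (F x *\<^sub>v v)) = tsum_mat N (coprod x)
        (\<lambda>a b. \<sigma> (Uq_cls ty q a) * s (\<gamma> v) * \<sigma> (Uq_cls ty q (antipode ty q b)))"
    and coords: "tensor_eq A CL (dirac m \<phi> \<gamma> \<tau>)
      (coord_sum m \<alpha> (\<lambda>i. \<phi> (unit_vec m i)) (\<lambda>j. \<gamma> (unit_vec m j)))"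
begin

sublocale p: Uq_rep ty q n \<pi> by unfold_locales (rule rep_\<pi>)
sublocale s: Uq_rep ty q N \<sigma> by unfold_locales (rule rep_\<sigma>)

abbreviation "nN \<equiv> n * N"

definition PQ :: "nat \<times> nat \<Rightarrow> complex mat \<times> complex mat" where
  "PQ ij = (ev (\<phi> (unit_vec m (fst ij))), s (\<gamma> (unit_vec m (snd ij))))"

abbreviation "idx \<equiv> {..<m} \<times> {..<m}"

definition D :: "complex mat" where
  "D = comb_mat nN idx (\<lambda>ij. \<alpha> (fst ij) (snd ij)) (\<lambda>ij. kron (fst (PQ ij)) (snd (PQ ij)))"

lemma D_eq: "coord_op nN m \<alpha> (\<lambda>i. ev (\<phi> (unit_vec m i))) (\<lambda>j. s (\<gamma> (unit_vec m j))) = D"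
  by (rule eq_matI) (auto simp: coord_op_def D_def PQ_def sum.cartesian_product split_beta)

lemma D_carrier [simp]: "D \<in> carrier_mat nN nN"
  by (simp add: D_def)

lemma s_hom: "s \<in> alg_hom CL (module_mat TYPE(complex) N N)"
  using rep_s by (simp add: repr_def)

lemma \<phi>_closed: "v \<in> carrier_vec m \<Longrightarrow> \<phi> v \<in> carrier A"
  and \<gamma>_closed: "v \<in> carrier_vec m \<Longrightarrow> \<gamma> v \<in> carrier CL"
  using \<phi>_linear linear_gamma by (auto simp: linear_into_def)

lemma PQ_carrier: "fst (PQ ij) \<in> carrier_mat n n" "snd (PQ ij) \<in> carrier_mat N N"
  unfolding PQ_def using \<phi>_closed \<gamma>_closed alg_hom_matD(1)[OF ev_hom] alg_hom_matD(1)[OF s_hom] by auto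

lemma ev_ad:
  assumes "u \<in> W" "Z \<in> carrier A"
  shows "ev (ad (mon u) Z) = wsum_mat n (\<lambda>p. p.F (mon (snd p)) * ev Z * p.F (antipode_op ty q (mon (fst p))))
    (coprod (mon u))"
proof -
  note W = keys_coprod[OF assms(1)] and T = ad_term_closed[OF assms(1)]
  have "ev (ad (mon u) Z) = comb_mat n (Poly_Mapping.keys (coprod (mon u))) (Poly_Mapping.lookup (coprod (mon u)))
     (\<lambda>p. ev (\<iota> (Uq_cls ty q (mon (snd p))) \<otimes>\<^bsub>A\<^esub> Z \<otimes>\<^bsub>A\<^esub> \<iota> (Uq_cls ty q (antipode_op ty q (mon (fst p))))))"
    unfolding op_adjoint_def using T assms by (intro alg_hom_finsum[OF A.complex_algebra_axioms ev_hom]) auto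
  also have "\<dots> = wsum_mat n (\<lambda>p. p.F (mon (snd p)) * ev Z * p.F (antipode_op ty q (mon (fst p)))) (coprod (mon u))"
    unfolding wsum_mat_def
    using T W assms(2) antipode_closed by (intro comb_mat_cong) (simp add: alg_hom_matD[OF ev_hom] ev_\<iota> antipode_op_def)
  finally show ?thesis .
qed

lemma s_act:
  assumes "u \<in> W" "j < m"
  shows "s (act (mon u) (\<gamma> (unit_vec m j))) = wsum_mat N (\<lambda>p. s.F (mon (fst p)) * s (\<gamma> (unit_vec m j)) *
    s.F (antipode ty q (mon (snd p)))) (coprod (mon u))"
  using assms by (simp add: act_gamma s_equivariant Uq_free_iff tsum_mat_eq)

text \<open>Part (1) evaluated by \<open>ev \<otimes> s\<close>, one matrix entry at a time. In this
  form invariance becomes an equation between products of matrices.\<close>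

lemma invariance:
  assumes u: "u \<in> W"
  shows "wsum_mat nN (\<lambda>p. comb_mat nN idx (\<lambda>ij. \<alpha> (fst ij) (snd ij))
      (\<lambda>ij. kron (ev (ad (mon (fst p)) (\<phi> (unit_vec m (fst ij)))))
                 (s (act (mon (snd p)) (\<gamma> (unit_vec m (snd ij))))))) (coprod (mon u)) =
    counit (mon u) \<cdot>\<^sub>m D" (is "?L = _")
proof (rule eq_matI)
  fix r k assume "r < dim_row (counit (mon u) \<cdot>\<^sub>m D)" "k < dim_col (counit (mon u) \<cdot>\<^sub>m D)"
  then have rk: "r < nN" "k < nN" by (simp_all add: D_def)
  let ?h = "\<lambda>x. kron (ev (fst x)) (s (snd x)) $$ (r, k)"
  let ?Z = "\<lambda>i. \<phi> (unit_vec m i)" and ?\<psi> = "\<lambda>j. \<gamma> (unit_vec m j)"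
  let ?coord = "coord_sum m \<alpha> ?Z ?\<psi>"
  have "tensor_eq A CL (acted_sum m \<alpha> ?Z ?\<psi> ad act (mon u)) (sc (counit (mon u)) (dirac m \<phi> \<gamma> \<tau>))"
    using dirac_invariant[OF coords, of "mon u"] u by (simp add: Uq_free_iff)
  also have "tensor_eq A CL (sc (counit (mon u)) (dirac m \<phi> \<gamma> \<tau>)) (sc (counit (mon u)) ?coord)"
    by (intro tensor_eq_sc coords)
  finally have "wsum (*) ?h (acted_sum m \<alpha> ?Z ?\<psi> ad act (mon u)) = wsum (*) ?h (sc (counit (mon u)) ?coord)"
    by (rule kron_index_bilinear[OF ev_hom s_hom rk])
  moreover have "wsum (*) ?h ?coord = D $$ (r, k)"
    using rk by (simp add: coord_sum_def cx.ws_sum cx.ws_sc D_def PQ_def sum.cartesian_product split_beta)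
  moreover have "wsum (*) ?h (acted_sum m \<alpha> ?Z ?\<psi> ad act (mon u)) = ?L $$ (r, k)"
    using rk by (simp add: acted_sum_def wsum_def[of sc, symmetric] cx.ws_sum cx.ws_sc cx.ws_wsum wsum_mat_index
        cx.ws_fun_sum cx.ws_fun_scale sum.cartesian_product split_beta)
  ultimately show "?L $$ (r, k) = (counit (mon u) \<cdot>\<^sub>m D) $$ (r, k)"
    using rk carrier_matD[OF D_carrier] by (simp add: cx.ws_sc)
qed (simp_all add: carrier_matD[OF D_carrier])

definition TA :: "qgen fmon \<Rightarrow> complex mat" where
  "TA u = wsum_mat nN (\<lambda>p. kron (p.F (mon (fst p))) (s.F (mon (snd p)))) (coprod (mon u))"

lemma TA_carrier [simp]: "TA u \<in> carrier_mat nN nN"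
  by (simp add: TA_def)

text \<open>Multiplicativity of the coproduct and of both representations; by it commutation with
  \<open>D\<close> passes from letters to words.\<close>

lemma TA_add:
  assumes u: "u \<in> W" and v: "v \<in> W"
  shows "TA (u + v) = TA u * TA v"
proof -
  note U = keys_coprod[OF u] and V = keys_coprod[OF v]
  let ?h = "\<lambda>p. kron (p.F (mon (fst p))) (s.F (mon (snd p)))"
  have h: "?h p \<in> carrier_mat nN nN" if "fst p \<in> W" "snd p \<in> W" for p
    using that by simp
  have "TA (u + v) = wsum_mat nN (\<lambda>p. wsum_mat nN (\<lambda>q. ?h (p + q)) (coprod (mon v))) (coprod (mon u))"
    by (simp add: TA_def coprod_mon_add wsum_mat_mult)
  also have "\<dots> = wsum_mat nN (\<lambda>p. wsum_mat nN (\<lambda>q. ?h p * ?h q) (coprod (mon v))) (coprod (mon u))"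
    using U V by (intro wsum_mat_cong)
      (simp add: p.F_word_mult s.F_word_mult kron_mult[of _ n _ _ N])
  also have "\<dots> = wsum_mat nN (\<lambda>p. ?h p * TA v) (coprod (mon u))"
    unfolding TA_def using U V by (intro wsum_mat_cong mult_wsum_mat_left[symmetric] h) auto
  also have "\<dots> = TA u * TA v"
    unfolding TA_def[of u] using U by (intro mult_wsum_mat_right[symmetric] h) auto
  finally show ?thesis .
qed

lemma conj_D:
  assumes "S \<in> carrier_mat n n" "S' \<in> carrier_mat n n" "T \<in> carrier_mat N N" "T' \<in> carrier_mat N N"
  shows "comb_mat nN idx (\<lambda>ij. \<alpha> (fst ij) (snd ij))
     (\<lambda>ij. kron (S * ev (\<phi> (unit_vec m (fst ij))) * S') (T * s (\<gamma> (unit_vec m (snd ij))) * T')) =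
    kron S T * D * kron S' T'"
  unfolding D_def
  using comb_mat_kron_conj[of idx "\<lambda>ij. fst (PQ ij)" n "\<lambda>ij. snd (PQ ij)" N S S' T T'] assms PQ_carrier
  by (simp add: PQ_def)

lemma ev_\<phi>_carrier: "v \<in> carrier_vec m \<Longrightarrow> ev (\<phi> v) \<in> carrier_mat n n"
  and s_\<gamma>_carrier: "v \<in> carrier_vec m \<Longrightarrow> s (\<gamma> v) \<in> carrier_mat N N"
  using \<phi>_closed \<gamma>_closed alg_hom_matD(1)[OF ev_hom] alg_hom_matD(1)[OF s_hom] by auto

lemma grouplike_commute:
  assumes g: "g \<in> Uq_gens ty" "h \<in> Uq_gens ty"
    and coprod: "coprod_gen g = mon (Word [g], Word [g])" and counit: "counit_gen g = 1"
    and antipode: "\<And>q. antipode_gen ty q g = lett h"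
    and inv: "p.F (lett g) * p.F (lett h) = 1\<^sub>m n" "p.F (lett h) * p.F (lett g) = 1\<^sub>m n"
      "s.F (lett g) * s.F (lett h) = 1\<^sub>m N" "s.F (lett h) * s.F (lett g) = 1\<^sub>m N"
  shows "TA (Word [g]) * D = D * TA (Word [g])"
proof -
  let ?K = "p.F (lett g)" and ?K' = "p.F (lett h)" and ?L = "s.F (lett g)" and ?L' = "s.F (lett h)"
  have C: "?K \<in> carrier_mat n n" "?K' \<in> carrier_mat n n" "?L \<in> carrier_mat N N" "?L' \<in> carrier_mat N N"
    using g by (auto intro: p.F_carrier s.F_carrier)
  note kc = kron_carrier[OF C(1,3)] kron_carrier[OF C(2,4)]
  have gW: "Word [g] \<in> W" using g by simp
  have ad: "ev (ad (lett g) (\<phi> (unit_vec m i))) = ?K * ev (\<phi> (unit_vec m i)) * ?K'" if "i < m" for i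
    using ev_ad[OF gW, of "\<phi> (unit_vec m i)"] \<phi>_closed[of "unit_vec m i"] C
      alg_hom_matD(1)[OF ev_hom, of "\<phi> (unit_vec m i)"]
    by (simp add: coprod_lett counit_lett coprod wsum_mat_mon antipode_op_def antipode_lett antipode
        mult_carrier_mat[of _ n n] flip: lett_def)
  have act: "s (act (lett g) (\<gamma> (unit_vec m j))) = ?L * s (\<gamma> (unit_vec m j)) * ?L'" if "j < m" for j
    using s_act[OF gW that] \<gamma>_closed[of "unit_vec m j"] C
      alg_hom_matD(1)[OF s_hom, of "\<gamma> (unit_vec m j)"]
    by (simp add: coprod_lett counit_lett coprod wsum_mat_mon antipode_lett antipode
        mult_carrier_mat[of _ N N] flip: lett_def)
  have "comb_mat nN idx (\<lambda>ij. \<alpha> (fst ij) (snd ij))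
      (\<lambda>ij. kron (?K * ev (\<phi> (unit_vec m (fst ij))) * ?K') (?L * s (\<gamma> (unit_vec m (snd ij))) * ?L')) =
    comb_mat nN idx (\<lambda>ij. \<alpha> (fst ij) (snd ij))
      (\<lambda>ij. kron (ev (ad (lett g) (\<phi> (unit_vec m (fst ij))))) (s (act (lett g) (\<gamma> (unit_vec m (snd ij))))))"
    by (rule comb_mat_cong) (auto simp: ad act)
  also have "\<dots> = D"
    using invariance[OF gW]
    by (simp add: coprod_lett counit_lett coprod wsum_mat_mon counit_lett counit one_smult_mat flip: lett_def)
  finally have D: "kron ?K ?L * D * kron ?K' ?L' = D"
    by (simp add: conj_D[OF C(1,2) C(3,4)])
  have one: "kron ?K' ?L' * kron ?K ?L = 1\<^sub>m nN"
    using C by (simp add: kron_mult[of _ n _ _ N] inv kron_one)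
  \<comment> \<open>The inverse is inserted on the right so that the conjugate of \<open>D\<close>
    appears and can be replaced by \<open>D\<close>.\<close>
  have "kron ?K ?L * D = kron ?K ?L * D * (kron ?K' ?L' * kron ?K ?L)"
    using kc by (simp add: one mult_carrier_mat[of _ nN nN] right_mult_one_mat[of _ nN nN])
  also have "\<dots> = D * kron ?K ?L"
    using kc by (subst (2) D[symmetric]) (simp add: assoc_mult_mat[of _ nN nN _ nN _ nN] mult_carrier_mat[of _ nN nN])
  finally show ?thesis
    using kc by (simp add: TA_def coprod_lett coprod wsum_mat_mon flip: lett_def)
qed

lemma TA_grouplike:
  assumes "coprod_gen g = mon (Word [g], Word [g])" "g \<in> Uq_gens ty"
  shows "TA (Word [g]) = kron (p.F (lett g)) (s.F (lett g))"
  using assms p.F_carrier[of "lett g"] s.F_carrier[of "lett g"]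
  by (simp add: TA_def coprod_lett wsum_mat_mon flip: lett_def)

lemma k_commute:
  assumes i: "i < rank ty"
  shows "TA (Word [Gk i]) * D = D * TA (Word [Gk i])" and "TA (Word [Gki i]) * D = D * TA (Word [Gki i])"
  using i p.k_inverse[OF i] s.k_inverse[OF i]
    grouplike_commute[of "Gk i" "Gki i"] grouplike_commute[of "Gki i" "Gk i"] by auto

text \<open>Invariance under \<open>g\<close> is a four-term identity, two terms per summand of the
  coproduct. Those with \<open>g\<close> to the left of \<open>D\<close> carry no sign and become
  \<Delta>(g) D; those with the antipode of \<open>g\<close> to the right become D
  \<Delta>(g).\<close>

lemma skew_gen_commute:
  assumes skew: "skew_gen ty q i g c"
  shows "TA (Word [g]) * D = D * TA (Word [g])"
proof -
  let ?K = "p.F (lett (Gk i))" and ?K' = "p.F (lett (Gki i))" and ?E = "p.F (lett g)"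
  let ?L = "s.F (lett (Gk i))" and ?L' = "s.F (lett (Gki i))" and ?M = "s.F (lett g)"
  from skew have i: "i < rank ty" and g: "g \<in> Uq_gens ty" and c: "c \<noteq> 0"
    and KE: "?K * ?E * ?K' = c \<cdot>\<^sub>m ?E" and LM: "?L * ?M * ?L' = c \<cdot>\<^sub>m ?M"
    and gs: "coprod_gen g = mon (Word [g], Word [Gk i]) + mon (Word [Gki i], Word [g])"
      "counit_gen g = 0" "antipode_gen ty q g = sc (- c) (lett g)"
      "antipode_gen ty (inverse q) g = sc (- inverse c) (lett g)"
    using rep_\<pi> rep_\<sigma> by (auto simp: skew_gen_def)
  have C: "?K \<in> carrier_mat n n" "?K' \<in> carrier_mat n n" "?E \<in> carrier_mat n n"
    "?L \<in> carrier_mat N N" "?L' \<in> carrier_mat N N" "?M \<in> carrier_mat N N"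
    using i g by (auto intro: p.F_carrier s.F_carrier)
  have cE: "- inverse c \<cdot>\<^sub>m ?E \<in> carrier_mat n n" and cM: "- c \<cdot>\<^sub>m ?M \<in> carrier_mat N N"
    using C by auto
  have gW: "Word [g] \<in> W" "Word [Gk i] \<in> W" "Word [Gki i] \<in> W" using g i by auto
  note [simp] = mult_carrier_mat[of _ n n] mult_carrier_mat[of _ N N]
  \<comment> \<open>The legs \<open>(g, k)\<close> and \<open>(k^-1, g)\<close> of the coproduct
    give \<open>k Z S^op(g) + g Z S^op(k^-1)\<close>, with \<open>S^op(g) = -c^-1 g\<close>.\<close>
  have ad: "ev (ad (lett g) (\<phi> (unit_vec m j))) =
      ?K * ev (\<phi> (unit_vec m j)) * (- inverse c \<cdot>\<^sub>m ?E) + ?E * ev (\<phi> (unit_vec m j)) * ?K"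
      "ev (ad (lett (Gki i)) (\<phi> (unit_vec m j))) = ?K' * ev (\<phi> (unit_vec m j)) * ?K" if "j < m" for j
    using ev_ad[OF gW(1), of "\<phi> (unit_vec m j)"] ev_ad[OF gW(3), of "\<phi> (unit_vec m j)"]
      \<phi>_closed[of "unit_vec m j"] C cE i g alg_hom_matD(1)[OF ev_hom, of "\<phi> (unit_vec m j)"]
    by (simp_all add: coprod_lett counit_lett gs wsum_mat_add wsum_mat_mon antipode_op_def antipode_lett p.F_sc
        del: sc.scale_minus_left flip: lett_def)
  have act: "s (act (lett g) (\<gamma> (unit_vec m j))) =
      ?M * s (\<gamma> (unit_vec m j)) * ?L' + ?L' * s (\<gamma> (unit_vec m j)) * (- c \<cdot>\<^sub>m ?M)"
      "s (act (lett (Gk i)) (\<gamma> (unit_vec m j))) = ?L * s (\<gamma> (unit_vec m j)) * ?L'" if "j < m" for j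
    using s_act[OF gW(1) that] s_act[OF gW(2) that] \<gamma>_closed[of "unit_vec m j"] C cM i g
      alg_hom_matD(1)[OF s_hom, of "\<gamma> (unit_vec m j)"]
    by (simp_all add: coprod_lett counit_lett gs wsum_mat_add wsum_mat_mon antipode_lett s.F_sc
        del: sc.scale_minus_left flip: lett_def)
  let ?P = "\<lambda>ij. ev (\<phi> (unit_vec m (fst ij)))" and ?Q = "\<lambda>ij. s (\<gamma> (unit_vec m (snd ij)))"
  let ?sum = "comb_mat nN idx (\<lambda>ij. \<alpha> (fst ij) (snd ij))"
  let ?E\<^sub>1 = "kron ?E ?L" and ?E\<^sub>2 = "kron ?K' ?M" and ?U = "kron ?K ?L" and ?U' = "kron ?K' ?L'"
    and ?V = "kron ?K ?L'" and ?V' = "kron ?K' ?L"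
  \<comment> \<open>The left side is zero because the counit vanishes on \<open>g\<close>; it is
    kept as a multiple of \<open>D\<close> to match \<open>invariance\<close>.\<close>
  have "0 \<cdot>\<^sub>m D = ?sum (\<lambda>ij. kron (ev (ad (lett g) (\<phi> (unit_vec m (fst ij)))))
        (s (act (lett (Gk i)) (\<gamma> (unit_vec m (snd ij)))))) +
      ?sum (\<lambda>ij. kron (ev (ad (lett (Gki i)) (\<phi> (unit_vec m (fst ij)))))
        (s (act (lett g) (\<gamma> (unit_vec m (snd ij))))))"
    using invariance[OF gW(1)]
    by (simp add: coprod_lett counit_lett gs wsum_mat_add wsum_mat_mon counit_lett flip: lett_def)
  also have "?sum (\<lambda>ij. kron (ev (ad (lett g) (\<phi> (unit_vec m (fst ij)))))
        (s (act (lett (Gk i)) (\<gamma> (unit_vec m (snd ij)))))) =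
      ?sum (\<lambda>ij. kron (?K * ?P ij * (- inverse c \<cdot>\<^sub>m ?E)) (?L * ?Q ij * ?L') +
        kron (?E * ?P ij * ?K) (?L * ?Q ij * ?L'))"
    by (rule comb_mat_cong)
      (auto simp: ad act C cE ev_\<phi>_carrier s_\<gamma>_carrier intro!: kron_add_left[of _ n n _ _ N N])
  also have "\<dots> = ?U * D * kron (- inverse c \<cdot>\<^sub>m ?E) ?L' + ?E\<^sub>1 * D * ?V"
    by (subst comb_mat_add) (auto simp: conj_D C cE ev_\<phi>_carrier s_\<gamma>_carrier intro!: kron_carrier)
  also have "?sum (\<lambda>ij. kron (ev (ad (lett (Gki i)) (\<phi> (unit_vec m (fst ij)))))
        (s (act (lett g) (\<gamma> (unit_vec m (snd ij)))))) =
      ?sum (\<lambda>ij. kron (?K' * ?P ij * ?K) (?M * ?Q ij * ?L') +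
        kron (?K' * ?P ij * ?K) (?L' * ?Q ij * (- c \<cdot>\<^sub>m ?M)))"
    by (rule comb_mat_cong)
      (auto simp: ad act C cM ev_\<phi>_carrier s_\<gamma>_carrier intro!: kron_add_right[of _ n n _ N N])
  also have "\<dots> = ?E\<^sub>2 * D * ?V + ?U' * D * kron ?K (- c \<cdot>\<^sub>m ?M)"
    by (subst comb_mat_add) (auto simp: conj_D C cM ev_\<phi>_carrier s_\<gamma>_carrier intro!: kron_carrier)
  finally have inv: "0 \<cdot>\<^sub>m D = ?U * D * kron (- inverse c \<cdot>\<^sub>m ?E) ?L' + ?E\<^sub>1 * D * ?V +
      (?E\<^sub>2 * D * ?V + ?U' * D * kron ?K (- c \<cdot>\<^sub>m ?M))" .
  have kc: "?E\<^sub>1 \<in> carrier_mat nN nN" "?E\<^sub>2 \<in> carrier_mat nN nN" "?U \<in> carrier_mat nN nN" "?U' \<in> carrier_mat nN nN"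
    "?V \<in> carrier_mat nN nN" "?V' \<in> carrier_mat nN nN" "kron ?E ?L' \<in> carrier_mat nN nN" "kron ?K ?M \<in> carrier_mat nN nN"
    using C by auto
  note [simp] = mult_carrier_mat[of _ nN nN]
  have eq: "?E\<^sub>1 * D * ?V + ?E\<^sub>2 * D * ?V = inverse c \<cdot>\<^sub>m (?U * D * kron ?E ?L') + c \<cdot>\<^sub>m (?U' * D * kron ?K ?M)"
  proof (rule sum_zero_rearrange[of _ nN])
    show "0 \<cdot>\<^sub>m D = - inverse c \<cdot>\<^sub>m (?U * D * kron ?E ?L') + ?E\<^sub>1 * D * ?V +
        (?E\<^sub>2 * D * ?V + - c \<cdot>\<^sub>m (?U' * D * kron ?K ?M))"
      using inv kc C by (simp add: kron_smult_left[of _ n n] kron_smult_right[of _ N N] mult_smult_distrib[of _ nN nN _ nN])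
  qed (use kc in auto)
  note asn = assoc_mult_mat[of _ n n _ n _ n] and asN = assoc_mult_mat[of _ N N _ N _ N]
  have UX: "?U * (kron ?E ?L' * ?V') = c \<cdot>\<^sub>m ?E\<^sub>1"
  proof -
    have "?U * (kron ?E ?L' * ?V') = kron (?K * ?E * ?K') (?L * (?L' * ?L))"
      using C by (simp add: kron_mult[of _ n _ _ N] asn)
    also have "\<dots> = c \<cdot>\<^sub>m ?E\<^sub>1"
      using C by (simp add: KE s.k_inverse[OF i] kron_smult_left[of _ n n])
    finally show ?thesis .
  qed
  \<comment> \<open>The inverse conjugation \<open>k^-1 g k = c^-1 g\<close>, obtained by solving
    the relation for \<open>g\<close>; this is where \<open>c\<close> must be nonzero.\<close>
  have LML: "?L' * (?M * ?L) = inverse c \<cdot>\<^sub>m ?M"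
  proof -
    have "?M = inverse c \<cdot>\<^sub>m (?L * ?M * ?L')"
      unfolding LM using c C by (intro eq_matI) auto
    then have "?L' * (?M * ?L) = ?L' * ((inverse c \<cdot>\<^sub>m (?L * ?M * ?L')) * ?L)"
      by simp
    also have "\<dots> = inverse c \<cdot>\<^sub>m ((?L' * ?L) * ?M * (?L' * ?L))"
      using C by (simp add: asN mult_smult_distrib[of _ N N _ N] mult_smult_assoc_mat[of _ N N _ N])
    finally show ?thesis using C by (simp add: s.k_inverse[OF i])
  qed
  have UY: "?U' * (kron ?K ?M * ?V') = inverse c \<cdot>\<^sub>m ?E\<^sub>2"
  proof -
    have "?U' * (kron ?K ?M * ?V') = kron (?K' * (?K * ?K')) (?L' * (?M * ?L))"
      using C by (simp add: kron_mult[of _ n _ _ N])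
    also have "\<dots> = inverse c \<cdot>\<^sub>m ?E\<^sub>2"
      using C by (simp add: LML p.k_inverse[OF i] kron_smult_right[of _ N N])
    finally show ?thesis .
  qed
  have V: "?V * ?V' = 1\<^sub>m nN"
    using C by (simp add: kron_mult[of _ n _ _ N] p.k_inverse[OF i] s.k_inverse[OF i] kron_one)
  have "TA (Word [g]) = ?E\<^sub>1 + ?E\<^sub>2"
    using kc by (simp add: TA_def coprod_lett gs wsum_mat_add wsum_mat_mon flip: lett_def)
  then show ?thesis
    using skew_commute[OF D_carrier kc(1-8) V _ _ UX UY c eq] k_commute[OF i] i by (simp add: TA_grouplike)
qed

lemma TA_commute:
  assumes "u \<in> W"
  shows "D * TA u = TA u * D"
  using assms
proof (induction rule: words_induct)
  case zero
  have "TA 0 = 1\<^sub>m nN"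
    using p.F_one[folded mon_zero] s.F_one[folded mon_zero] by (simp add: TA_def wsum_mat_one kron_one)
  then show ?case by (simp add: left_mult_one_mat[of _ nN nN] right_mult_one_mat[of _ nN nN])
next
  case (letter_add g u)
  have g: "D * TA (Word [g]) = TA (Word [g]) * D"
    using q_pos letter_add.hyps(1)
    by (cases rule: Uq_gen_cases) (auto simp: k_commute skew_gen_commute)
  have "D * TA (Word [g] + u) = D * TA (Word [g]) * TA u"
    using letter_add.hyps by (simp add: TA_add assoc_mult_mat[of _ nN nN _ nN _ nN])
  also have "\<dots> = TA (Word [g]) * (D * TA u)"
    unfolding g by (simp add: assoc_mult_mat[of _ nN nN _ nN _ nN])
  also have "\<dots> = TA (Word [g] + u) * D"
    using letter_add.hyps by (simp add: TA_add letter_add.IH assoc_mult_mat[of _ nN nN _ nN _ nN])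
  finally show ?case .
qed

theorem dirac_commute:
  assumes x: "x \<in> Uq_free ty"
  shows "D * tensor_act ty q n \<pi> N \<sigma> (coprod x) = tensor_act ty q n \<pi> N \<sigma> (coprod x) * D"
proof -
  have "tensor_act ty q n \<pi> N \<sigma> (coprod x) = wsum_mat nN TA x"
    unfolding tensor_act_def tsum_mat_eq TA_def by (subst coprod_eq_wsum) (rule wsum_mat_wsum)
  moreover have "D * wsum_mat nN TA x = wsum_mat nN TA x * D"
    using x by (subst mult_wsum_mat_left, simp, simp, subst mult_wsum_mat_right, simp, simp)
      (auto intro!: wsum_mat_cong TA_commute simp: Uq_free_iff carrier_free_alg)
  ultimately show ?thesis by simp
qed

end

section \<open>The two algebras and the theorem\<close>

lemma keys_coprod_free:
  assumes x: "x \<in> carrier (free_alg (Uq_gens ty))" and p: "p \<in> Poly_Mapping.keys (coprod x)"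
  shows "fst p \<in> words (Uq_gens ty)" "snd p \<in> words (Uq_gens ty)"
proof -
  have "(\<Sum>u\<in>Poly_Mapping.keys x. Poly_Mapping.lookup x u * Poly_Mapping.lookup (coprod (mon u)) p) \<noteq> 0"
    using p unfolding coprod_eq_wsum[of x] in_keys_iff wsum_def lookup_sum lookup_sc .
  then obtain u where "u \<in> Poly_Mapping.keys x" "Poly_Mapping.lookup (coprod (mon u)) p \<noteq> 0"
    by (rule sum.not_neutral_contains_not_neutral) simp
  then show "fst p \<in> words (Uq_gens ty)" "snd p \<in> words (Uq_gens ty)"
    using x keys_coprod[of u ty p] by (auto simp: carrier_free_alg in_keys_iff)
qed

lemma wsum_map_key_swap: "wsum scl h (Poly_Mapping.map_key prod.swap t) = wsum scl (\<lambda>p. h (prod.swap p)) t"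
proof -
  have "Poly_Mapping.keys (Poly_Mapping.map_key prod.swap t) = prod.swap ` Poly_Mapping.keys t"
    by (simp add: set_eq_iff keys_map_key image_iff) (metis swap_swap swap_simp)
  then show ?thesis
    by (simp add: wsum_def sum.reindex map_key.rep_eq)
qed

text \<open>The R-matrix turns the coproduct into the opposite one, and the flip turns it
  back.\<close>

lemma (in Uq_rep) braiding_commute:
  assumes x: "x \<in> Uq_free ty" and R: "R \<in> carrier_mat (d * d) (d * d)"
    and comm: "R * tensor_act ty q d f d f (coprod x) = tensor_act ty q d f d f (coprod_op x) * R"
  shows "flip_mat d d * R * tensor_act ty q d f d f (coprod x) =
    tensor_act ty q d f d f (coprod x) * (flip_mat d d * R)"
proof -
  note keys = keys_coprod_free[OF x[unfolded Uq_free_iff]]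
  let ?h = "\<lambda>p. kron (F (mon (fst p))) (F (mon (snd p)))"
  let ?T = "tensor_act ty q d f d f (coprod x)" and ?T' = "tensor_act ty q d f d f (coprod_op x)"
  have T: "?T = wsum_mat (d * d) ?h (coprod x)" "?T' = wsum_mat (d * d) (\<lambda>p. ?h (prod.swap p)) (coprod x)"
    by (auto intro!: eq_matI simp: tensor_act_def tsum_mat_eq wsum_mat_index coprod_op_def wsum_map_key_swap)
  have C: "flip_mat d d \<in> carrier_mat (d * d) (d * d)" "?T \<in> carrier_mat (d * d) (d * d)"
    "?T' \<in> carrier_mat (d * d) (d * d)"
    by (simp_all add: T flip_mat_def)
  have swap: "flip_mat d d * ?T' = ?T * flip_mat d d"
    unfolding T using keys C(1)
    by (subst mult_wsum_mat_left, simp, simp, subst mult_wsum_mat_right, simp, simp)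
      (intro wsum_mat_cong, simp add: kron_flip)
  have "flip_mat d d * R * ?T = flip_mat d d * ?T' * R"
    using comm by (simp only: assoc_mult_mat[OF C(1) R C(2)] assoc_mult_mat[OF C(1) C(3) R])
  also have "\<dots> = ?T * (flip_mat d d * R)"
    by (simp only: swap assoc_mult_mat[OF C(2) C(1) R])
  finally show ?thesis .
qed

lemma equivariant_cliffordI:
  assumes q: "q > 0" and model: "model_family ty q d \<pi>" and R: "universal_R ty q d \<pi> R"
    and l: "l \<in> P_plus ty" and B: "invariant_form ty q (d l) (\<pi> l) B"
  shows "equivariant_clifford ty q (d l) (\<pi> l) (flip_mat (d l) (d l) * R l l) B"
proof -
  have "repr (Uq ty q) (d l) (\<pi> l)"
    using model l by (auto simp: model_family_def highest_weight_module_def irrep_def)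
  then interpret Uq_rep ty q "d l" "\<pi> l" by unfold_locales
  from R obtain \<Theta> :: "nat \<Rightarrow> qgen falg2" where "\<forall>l\<in>P_plus ty. \<forall>m\<in>P_plus ty.
      (\<exists>C. cartan_part ty q (d l) (\<pi> l) (d m) (\<pi> m) C \<and>
        (\<exists>M. \<forall>M'\<ge>M. R l m = C * tensor_act ty q (d l) (\<pi> l) (d m) (\<pi> m) (\<Sum>h\<le>M'. \<Theta> h))) \<and>
      (\<forall>x\<in>Uq_free ty. R l m * tensor_act ty q (d l) (\<pi> l) (d m) (\<pi> m) (coprod x) =
        tensor_act ty q (d l) (\<pi> l) (d m) (\<pi> m) (coprod_op x) * R l m)"
    unfolding universal_R_def by (elim exE conjE) (rule that)
  from bspec[OF bspec[OF this l] l] obtain C M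
    where C: "cartan_part ty q (d l) (\<pi> l) (d l) (\<pi> l) C"
      and eq: "\<forall>M'\<ge>M. R l l = C * tensor_act ty q (d l) (\<pi> l) (d l) (\<pi> l) (\<Sum>h\<le>M'. \<Theta> h)"
      and comm: "\<And>x. x \<in> Uq_free ty \<Longrightarrow> R l l * tensor_act ty q (d l) (\<pi> l) (d l) (\<pi> l) (coprod x) =
        tensor_act ty q (d l) (\<pi> l) (d l) (\<pi> l) (coprod_op x) * R l l"
    by (elim conjE exE) simp
  \<comment> \<open>The size of the R-matrix is read off from its factorisation, taken at the cutoff
    \<open>M\<close> itself.\<close>
  have R_carrier: "R l l \<in> carrier_mat (d l * d l) (d l * d l)"
    using eq[rule_format, OF order_refl] C
    by (auto simp: cartan_part_def tensor_act_def tsum_mat_eq)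
  show ?thesis
    using q B R_carrier braiding_commute[OF _ R_carrier comm]
    by unfold_locales (auto simp: flip_mat_def)
qed

section \<open>The quantum group and its completion as algebras\<close>

lemma Uq_complex_algebra: "complex_algebra (Uq ty q)"
proof -
  interpret presentation "Uq_gens ty" "Uq_rels ty q" by (rule presentation_Uq)
  show ?thesis unfolding Uq_def by (rule P.complex_algebra_axioms)
qed

lemma Uhat_sel [simp]:
  "carrier (Uhat ty d) = (\<Pi>\<^sub>E l\<in>P_plus ty. carrier_mat (d l) (d l))"
  "mult (Uhat ty d) = (\<lambda>S T. \<lambda>l\<in>P_plus ty. S l * T l)"
  "one (Uhat ty d) = (\<lambda>l\<in>P_plus ty. 1\<^sub>m (d l))"
  "zero (Uhat ty d) = (\<lambda>l\<in>P_plus ty. 0\<^sub>m (d l) (d l))"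
  "add (Uhat ty d) = (\<lambda>S T. \<lambda>l\<in>P_plus ty. S l + T l)"
  "smult (Uhat ty d) = (\<lambda>c T. \<lambda>l\<in>P_plus ty. c \<cdot>\<^sub>m T l)"
  by (simp_all add: Uhat_def)

lemma Uhat_eqI:
  assumes "S \<in> carrier (Uhat ty d)" "T \<in> carrier (Uhat ty d)"
    and "\<And>l. l \<in> P_plus ty \<Longrightarrow> S l = T l"
  shows "S = T"
  using assms by (auto intro: PiE_ext)

lemma Uhat_mem: "S \<in> carrier (Uhat ty d) \<Longrightarrow> l \<in> P_plus ty \<Longrightarrow> S l \<in> carrier_mat (d l) (d l)"
  by auto

lemma Uhat_complex_algebra: "complex_algebra (Uhat ty d)"
proof -
  let ?A = "Uhat ty d"
  note mem = Uhat_mem[of _ ty d]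
  have closed: "\<zero>\<^bsub>?A\<^esub> \<in> carrier ?A" "\<one>\<^bsub>?A\<^esub> \<in> carrier ?A"
    "\<And>S T. S \<in> carrier ?A \<Longrightarrow> T \<in> carrier ?A \<Longrightarrow> S \<oplus>\<^bsub>?A\<^esub> T \<in> carrier ?A"
    "\<And>S T. S \<in> carrier ?A \<Longrightarrow> T \<in> carrier ?A \<Longrightarrow> S \<otimes>\<^bsub>?A\<^esub> T \<in> carrier ?A"
    "\<And>c S. S \<in> carrier ?A \<Longrightarrow> c \<odot>\<^bsub>?A\<^esub> S \<in> carrier ?A"
    by (auto dest: PiE_mem intro!: mult_carrier_mat add_carrier_mat smult_carrier_mat)
  have eqI: "S \<in> carrier ?A \<Longrightarrow> T \<in> carrier ?A \<Longrightarrow> (\<And>l. l \<in> P_plus ty \<Longrightarrow> S l = T l) \<Longrightarrow> S = T" for S T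
    by (rule Uhat_eqI)
  have val: "l \<in> P_plus ty \<Longrightarrow> (S \<oplus>\<^bsub>?A\<^esub> T) l = S l + T l" "l \<in> P_plus ty \<Longrightarrow> (S \<otimes>\<^bsub>?A\<^esub> T) l = S l * T l"
    "l \<in> P_plus ty \<Longrightarrow> (c \<odot>\<^bsub>?A\<^esub> S) l = c \<cdot>\<^sub>m S l" "l \<in> P_plus ty \<Longrightarrow> \<one>\<^bsub>?A\<^esub> l = 1\<^sub>m (d l)"
    "l \<in> P_plus ty \<Longrightarrow> \<zero>\<^bsub>?A\<^esub> l = 0\<^sub>m (d l) (d l)" for S T l c
    by simp_all
  have neg: "\<exists>T\<in>carrier ?A. T \<oplus>\<^bsub>?A\<^esub> S = \<zero>\<^bsub>?A\<^esub>" if "S \<in> carrier ?A" for S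
  proof (intro bexI[of _ "(-1) \<odot>\<^bsub>?A\<^esub> S"] eqI closed that)
    fix l assume l: "l \<in> P_plus ty"
    show "((-1) \<odot>\<^bsub>?A\<^esub> S \<oplus>\<^bsub>?A\<^esub> S) l = \<zero>\<^bsub>?A\<^esub> l"
      unfolding val[OF l] using mem[OF that l] by (intro eq_matI) auto
  qed
  have "ring ?A"
  proof (rule ringI)
    show "abelian_group ?A"
    proof (rule abelian_groupI)
      fix S T U assume S: "S \<in> carrier ?A" and T: "T \<in> carrier ?A" and U: "U \<in> carrier ?A"
      show "S \<oplus>\<^bsub>?A\<^esub> T \<oplus>\<^bsub>?A\<^esub> U = S \<oplus>\<^bsub>?A\<^esub> (T \<oplus>\<^bsub>?A\<^esub> U)"
        by (intro eqI closed S T U, unfold val) (rule assoc_add_mat[OF mem[OF S] mem[OF T] mem[OF U]])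
      show "S \<oplus>\<^bsub>?A\<^esub> T = T \<oplus>\<^bsub>?A\<^esub> S"
        by (intro eqI closed S T, unfold val) (rule comm_add_mat[OF mem[OF S] mem[OF T]])
      show "\<zero>\<^bsub>?A\<^esub> \<oplus>\<^bsub>?A\<^esub> S = S"
        by (intro eqI closed S, unfold val) (rule left_add_zero_mat[OF mem[OF S]])
    qed (use closed neg in auto)
    show "Group.monoid ?A"
    proof (rule Group.monoidI)
      fix S T U assume S: "S \<in> carrier ?A" and T: "T \<in> carrier ?A" and U: "U \<in> carrier ?A"
      show "S \<otimes>\<^bsub>?A\<^esub> T \<otimes>\<^bsub>?A\<^esub> U = S \<otimes>\<^bsub>?A\<^esub> (T \<otimes>\<^bsub>?A\<^esub> U)"
        by (intro eqI closed S T U, unfold val) (rule assoc_mult_mat[OF mem[OF S] mem[OF T] mem[OF U]])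
      show "\<one>\<^bsub>?A\<^esub> \<otimes>\<^bsub>?A\<^esub> S = S"
        by (intro eqI closed S, unfold val) (rule left_mult_one_mat[OF mem[OF S]])
      show "S \<otimes>\<^bsub>?A\<^esub> \<one>\<^bsub>?A\<^esub> = S"
        by (intro eqI closed S, unfold val) (rule right_mult_one_mat[OF mem[OF S]])
    qed (use closed in auto)
  next
    fix S T U assume S: "S \<in> carrier ?A" and T: "T \<in> carrier ?A" and U: "U \<in> carrier ?A"
    show "(S \<oplus>\<^bsub>?A\<^esub> T) \<otimes>\<^bsub>?A\<^esub> U = S \<otimes>\<^bsub>?A\<^esub> U \<oplus>\<^bsub>?A\<^esub> T \<otimes>\<^bsub>?A\<^esub> U"
      by (intro eqI closed S T U, unfold val) (rule add_mult_distrib_mat[OF mem[OF S] mem[OF T] mem[OF U]])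
    show "U \<otimes>\<^bsub>?A\<^esub> (S \<oplus>\<^bsub>?A\<^esub> T) = U \<otimes>\<^bsub>?A\<^esub> S \<oplus>\<^bsub>?A\<^esub> U \<otimes>\<^bsub>?A\<^esub> T"
      by (intro eqI closed S T U, unfold val) (rule mult_add_distrib_mat[OF mem[OF U] mem[OF S] mem[OF T]])
  qed
  moreover have "complex_algebra_axioms ?A"
  proof
    fix S T c e assume S: "S \<in> carrier ?A"
    show "c \<odot>\<^bsub>?A\<^esub> S \<in> carrier ?A" by (rule closed(5)[OF S])
    show "c \<odot>\<^bsub>?A\<^esub> (e \<odot>\<^bsub>?A\<^esub> S) = (c * e) \<odot>\<^bsub>?A\<^esub> S"
      by (intro eqI closed S, unfold val) (intro eq_matI, auto)
    assume T: "T \<in> carrier ?A"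
    show "c \<odot>\<^bsub>?A\<^esub> (S \<oplus>\<^bsub>?A\<^esub> T) = c \<odot>\<^bsub>?A\<^esub> S \<oplus>\<^bsub>?A\<^esub> c \<odot>\<^bsub>?A\<^esub> T"
      by (intro eqI closed S T, unfold val) (rule add_smult_distrib_left_mat[OF mem[OF S] mem[OF T]])
    show "(c \<odot>\<^bsub>?A\<^esub> S) \<otimes>\<^bsub>?A\<^esub> T = c \<odot>\<^bsub>?A\<^esub> (S \<otimes>\<^bsub>?A\<^esub> T)"
      by (intro eqI closed S T, unfold val) (rule mult_smult_assoc_mat[OF mem[OF S] mem[OF T]])
    show "S \<otimes>\<^bsub>?A\<^esub> (c \<odot>\<^bsub>?A\<^esub> T) = c \<odot>\<^bsub>?A\<^esub> (S \<otimes>\<^bsub>?A\<^esub> T)"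
      by (intro eqI closed S T, unfold val) (rule mult_smult_distrib[OF mem[OF S] mem[OF T]])
  qed
  ultimately show ?thesis by (rule complex_algebra.intro)
qed

section \<open>Assembly for both algebras\<close>

lemma quantum_lie_space_carrier:
  fixes A :: "(complex, 'u) module" (structure)
  assumes "complex_algebra A" and "quantum_lie_space ty q d R K A ev L"
  shows "L \<subseteq> carrier A"
proof -
  interpret complex_algebra A by fact
  show ?thesis
    using assms(2) unfolding quantum_lie_space_def
    by (auto intro!: finsum_closed smult_closed)
qed

text \<open>Both conclusions for an abstract algebra with maps \<iota> and \<open>ev\<close>, so
  that the quantum group and its completion become two instances. Part (2) instantiates the
  evaluation afresh for each weight.\<close>

lemma dirac_theorem:
  fixes A :: "(complex, 'u) module"
  assumes clif: "equivariant_clifford ty q m \<rho> Rc B" and alg: "quantum_algebra A ty q \<iota>"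
    and \<tau>: "is_tau ty q m \<rho> \<tau>" and L: "L \<subseteq> carrier A" and \<phi>: "is_phi ty q m \<rho> A \<iota> L \<phi>"
    and coords: "tensor_eq A (clq m Rc B) (dirac m \<phi> (gamma_q m Rc B) \<tau>)
      (coord_sum m \<alpha> (\<lambda>i. \<phi> (unit_vec m i)) (\<lambda>j. gamma_q m Rc B (unit_vec m j)))"
    and s: "repr (clq m Rc B) N s" and \<sigma>: "repr (Uq ty q) N \<sigma>"
    and equivariant: "\<forall>x\<in>Uq_free ty. \<forall>v\<in>carrier_vec m.
      s (gamma_q m Rc B (\<rho> (Uq_cls ty q x) *\<^sub>v v)) =
      tsum_mat N (coprod x) (\<lambda>a b. \<sigma> (Uq_cls ty q a) * s (gamma_q m Rc B v) *
        \<sigma> (Uq_cls ty q (antipode ty q b)))"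
    and \<pi>: "\<And>l. l \<in> P_plus ty \<Longrightarrow> repr (Uq ty q) (d l) (\<pi> l)"
    and ev: "\<And>l. l \<in> P_plus ty \<Longrightarrow> ev l \<in> alg_hom A (module_mat TYPE(complex) (d l) (d l))"
      "\<And>l x. l \<in> P_plus ty \<Longrightarrow> x \<in> carrier (free_alg (Uq_gens ty)) \<Longrightarrow>
        ev l (\<iota> (Uq_cls ty q x)) = \<pi> l (Uq_cls ty q x)"
  shows "(\<forall>x\<in>Uq_free ty. tensor_eq A (clq m Rc B)
      (acted_sum m \<alpha> (\<lambda>i. \<phi> (unit_vec m i)) (\<lambda>j. gamma_q m Rc B (unit_vec m j))
        (op_adjoint ty q A \<iota>) (clq_act ty q m \<rho> Rc B) x)
      (sc (counit x) (dirac m \<phi> (gamma_q m Rc B) \<tau>))) \<and>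
    (\<forall>l\<in>P_plus ty. \<forall>x\<in>Uq_free ty.
      coord_op (d l * N) m \<alpha> (\<lambda>i. ev l (\<phi> (unit_vec m i))) (\<lambda>j. s (gamma_q m Rc B (unit_vec m j))) *
        tensor_act ty q (d l) (\<pi> l) N \<sigma> (coprod x) =
      tensor_act ty q (d l) (\<pi> l) N \<sigma> (coprod x) *
        coord_op (d l * N) m \<alpha> (\<lambda>i. ev l (\<phi> (unit_vec m i))) (\<lambda>j. s (gamma_q m Rc B (unit_vec m j))))"
proof -
  interpret equivariant_clifford ty q m \<rho> Rc B by (rule clif)
  interpret quantum_algebra A ty q \<iota> by (rule alg)
  interpret dirac_setting ty q m \<rho> Rc B A \<iota> \<tau> \<phi>
    using \<tau> \<phi> L by unfold_locales (auto simp: is_phi_def linear_into_def bij_betw_def)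
  have "coord_op (d l * N) m \<alpha> (\<lambda>i. ev l (\<phi> (unit_vec m i))) (\<lambda>j. s (gamma_q m Rc B (unit_vec m j))) *
        tensor_act ty q (d l) (\<pi> l) N \<sigma> (coprod x) =
      tensor_act ty q (d l) (\<pi> l) N \<sigma> (coprod x) *
        coord_op (d l * N) m \<alpha> (\<lambda>i. ev l (\<phi> (unit_vec m i))) (\<lambda>j. s (gamma_q m Rc B (unit_vec m j)))"
    if l: "l \<in> P_plus ty" and x: "x \<in> Uq_free ty" for l x
  proof -
    interpret dirac_action ty q m \<rho> Rc B A \<iota> \<tau> \<phi> "d l" "\<pi> l" "ev l" N \<sigma> s \<alpha>
      using \<pi>[OF l] ev(1)[OF l] ev(2)[OF l] s \<sigma> coords equivariant by unfold_locales auto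
    show ?thesis unfolding D_eq by (rule dirac_commute[OF x])
  qed
  then show ?thesis
    using dirac_invariant[OF coords] by blast
qed

theorem mainTheorem1:
  fixes ty :: ctype and q :: real
    and d :: "weight \<Rightarrow> nat" and \<pi> :: "weight \<Rightarrow> qgen falg set \<Rightarrow> complex mat"
    and R :: "weight \<Rightarrow> weight \<Rightarrow> complex mat"
    and B \<tau> :: "complex mat" and K :: "nat \<Rightarrow> complex mat"
    and N :: nat and s :: "nat falg set \<Rightarrow> complex mat"
    and \<sigma> :: "qgen falg set \<Rightarrow> complex mat"
  defines "cl \<equiv> Uq_cls ty q"
    and "m \<equiv> d (wt_adjoint ty)" and "\<rho> \<equiv> \<pi> (wt_adjoint ty)"
  defines "Rc \<equiv> flip_mat m m * R (wt_adjoint ty) (wt_adjoint ty)"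
  defines "CL \<equiv> clq m Rc B" and "\<gamma> \<equiv> gamma_q m Rc B"
  defines "\<psi> \<equiv> \<lambda>j. \<gamma> (unit_vec m j)"
  assumes "classical ty" and "q > 0" and "q \<noteq> 1"
    and "model_family ty q d \<pi>"
    and "universal_R ty q d \<pi> R"
    and "invariant_form ty q m \<rho> B"
    and "adjoint_embedding ty q (d wt_vector) (\<pi> wt_vector) m \<rho> K"
    and "is_tau ty q m \<rho> \<tau>"
    and "spinor_dim ty N"
    and "irrep CL N s"
    and "repr (Uq ty q) N \<sigma>"
    and "\<forall>x\<in>Uq_free ty. \<forall>v\<in>carrier_vec m.
           s (\<gamma> (\<rho> (cl x) *\<^sub>v v)) =
           tsum_mat N (coprod x) (\<lambda>a b. \<sigma> (cl a) * s (\<gamma> v) * \<sigma> (cl (antipode ty q b)))"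
  shows
    "(\<forall>L \<phi> \<alpha>.
        quantum_lie_space ty q d R K (Uq ty q) \<pi> L \<and>
        is_phi ty q m \<rho> (Uq ty q) (\<lambda>u. u) L \<phi> \<and>
        tensor_eq (Uq ty q) CL (dirac m \<phi> \<gamma> \<tau>) (coord_sum m \<alpha> (\<lambda>i. \<phi> (unit_vec m i)) \<psi>)
      \<longrightarrow>
        (\<forall>x\<in>Uq_free ty. tensor_eq (Uq ty q) CL
           (acted_sum m \<alpha> (\<lambda>i. \<phi> (unit_vec m i)) \<psi>
              (op_adjoint ty q (Uq ty q) (\<lambda>u. u)) (clq_act ty q m \<rho> Rc B) x)
           (sc (counit x) (dirac m \<phi> \<gamma> \<tau>))) \<and>
        (\<forall>l\<in>P_plus ty. \<forall>x\<in>Uq_free ty.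
           coord_op (d l * N) m \<alpha> (\<lambda>i. \<pi> l (\<phi> (unit_vec m i))) (\<lambda>j. s (\<psi> j)) *
             tensor_act ty q (d l) (\<pi> l) N \<sigma> (coprod x) =
           tensor_act ty q (d l) (\<pi> l) N \<sigma> (coprod x) *
             coord_op (d l * N) m \<alpha> (\<lambda>i. \<pi> l (\<phi> (unit_vec m i))) (\<lambda>j. s (\<psi> j))))
     \<and>
     (\<forall>L \<phi> \<alpha>.
        quantum_lie_space ty q d R K (Uhat ty d) (\<lambda>l Z. Z l) L \<and>
        is_phi ty q m \<rho> (Uhat ty d) (to_Uhat ty \<pi>) L \<phi> \<and>
        tensor_eq (Uhat ty d) CL (dirac m \<phi> \<gamma> \<tau>) (coord_sum m \<alpha> (\<lambda>i. \<phi> (unit_vec m i)) \<psi>)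
      \<longrightarrow>
        (\<forall>x\<in>Uq_free ty. tensor_eq (Uhat ty d) CL
           (acted_sum m \<alpha> (\<lambda>i. \<phi> (unit_vec m i)) \<psi>
              (op_adjoint ty q (Uhat ty d) (to_Uhat ty \<pi>)) (clq_act ty q m \<rho> Rc B) x)
           (sc (counit x) (dirac m \<phi> \<gamma> \<tau>))) \<and>
        (\<forall>l\<in>P_plus ty. \<forall>x\<in>Uq_free ty.
           coord_op (d l * N) m \<alpha> (\<lambda>i. \<phi> (unit_vec m i) l) (\<lambda>j. s (\<psi> j)) *
             tensor_act ty q (d l) (\<pi> l) N \<sigma> (coprod x) =
           tensor_act ty q (d l) (\<pi> l) N \<sigma> (coprod x) *
             coord_op (d l * N) m \<alpha> (\<lambda>i. \<phi> (unit_vec m i) l) (\<lambda>j. s (\<psi> j))))"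
proof -
  note defs = cl_def m_def \<rho>_def Rc_def CL_def \<gamma>_def \<psi>_def
  have adj: "wt_adjoint ty \<in> P_plus ty"
    by (simp add: P_plus_def wt_adjoint_def)
  have rep: "repr (Uq ty q) (d l) (\<pi> l)" if "l \<in> P_plus ty" for l
    using \<open>model_family ty q d \<pi>\<close> that
    by (auto simp: model_family_def highest_weight_module_def irrep_def)
  have clif: "equivariant_clifford ty q m \<rho> Rc B"
    using equivariant_cliffordI[OF \<open>q > 0\<close> \<open>model_family ty q d \<pi>\<close> \<open>universal_R ty q d \<pi> R\<close> adj]
      \<open>invariant_form ty q m \<rho> B\<close> by (simp add: defs)
  have s: "repr CL N s"
    using \<open>irrep CL N s\<close> by (simp add: irrep_def)
  have Uq: "quantum_algebra (Uq ty q) ty q (\<lambda>u. u)"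
    using Uq_cls_hom(1)[of _ ty q]
    by (intro quantum_algebra.intro[OF Uq_complex_algebra] quantum_algebra_axioms.intro) (simp add: Uq_def Uq_cls_def)
  have Uhat: "quantum_algebra (Uhat ty d) ty q (to_Uhat ty \<pi>)"
  proof (intro quantum_algebra.intro Uhat_complex_algebra quantum_algebra_axioms.intro)
    fix x assume "x \<in> carrier (free_alg (Uq_gens ty))"
    then show "to_Uhat ty \<pi> (Uq_cls ty q x) \<in> carrier (Uhat ty d)"
      using Uq_rep.F_carrier[OF Uq_rep.intro[OF rep]] by (auto simp: to_Uhat_def)
  qed
  have Uhat_ev: "(\<lambda>Z. Z l) \<in> alg_hom (Uhat ty d) (module_mat TYPE(complex) (d l) (d l))"
    if "l \<in> P_plus ty" for l
    using that by (auto simp: alg_hom_def ring_hom_def module_mat_simps)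
  note common = \<open>is_tau ty q m \<rho> \<tau>\<close> \<open>repr (Uq ty q) N \<sigma>\<close> s[unfolded CL_def]
    \<open>\<forall>x\<in>Uq_free ty. \<forall>v\<in>carrier_vec m. s (\<gamma> (\<rho> (cl x) *\<^sub>v v)) =
      tsum_mat N (coprod x) (\<lambda>a b. \<sigma> (cl a) * s (\<gamma> v) * \<sigma> (cl (antipode ty q b)))\<close>[unfolded \<gamma>_def cl_def]
  show ?thesis
    unfolding CL_def \<gamma>_def \<psi>_def
  \<comment> \<open>In the first case \<open>ev\<close> is the family of representations and \<iota>
    the identity; in the second \<open>ev l\<close> is the component at \<open>l\<close> of a family
    of matrices.\<close>
  proof ((rule conjI; intro allI impI; elim conjE), goal_cases)
    case (1 L \<phi> \<alpha>)
    show ?case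
      by (rule dirac_theorem[OF clif Uq common(1) quantum_lie_space_carrier[OF Uq_complex_algebra 1(1)] 1(2,3)
            common(3,2,4) rep])
        (use rep in \<open>auto simp: repr_def\<close>)
  next
    case (2 L \<phi> \<alpha>)
    show ?case
      by (rule dirac_theorem[OF clif Uhat common(1) quantum_lie_space_carrier[OF Uhat_complex_algebra 2(1)] 2(2,3)
            common(3,2,4) rep])
        (use Uhat_ev in \<open>auto simp: to_Uhat_def\<close>)
  qed
qed

end
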